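(* Let $m\ge 2$ and $\mathcal{T}=(t_{i_1\ldots i_m})\in\mathbb{T}(\mathbb{C}^2,m)$. The characteristic polynomial of $\mathcal{T}$ is $$\psi(\lambda)=\lambda^{2(m-1)}+\sum_{k=1}^{2(m-1)}\lambda^{2(m-1)-k}\sum_{i=1}^k\frac{1}{i!}\sum_{d_j>0,\ \sum_{j=1}^id_j=k}\ \prod_{j=1}^i\frac{-\mathrm{Tr}_{d_j}(\mathcal{T})}{d_j},$$ where, for $d\in\{1,\ldots,2(m-1)\}$, $$\mathrm{Tr}_d(\mathcal{T})=(m-1)\left\{t_{11\ldots1}^d+t_{22\ldots2}^d+\sum_{h+k=d,\ h,k\ge1}\ \sum_{s=1}^{\min\{h,k\}(m-1)}\frac{s(h+k)}{hk(m-1)}\sum_{\substack{(a_1,\ldots,a_h)\in\mathbb{D}^s\\(b_1,\ldots,b_k)\in\mathbb{E}^s}}\left(\prod_{p=1}^h\alpha_{a_p}\right)\left(\prod_{q=1}^k\beta_{b_q}\right)\right\}.$$ Here, for $0\le a,b\le m-1$, $\alpha_a$ is the sum of $t_{1i_2\ldots i_m}$ over all $(i_2,\ldots,i_m)\in\{1,2\}^{m-1}$ with exactly $a$ entries equal to $2$ (and $m-1-a$ equal to $1$), $\beta_b$ is the sum of $t_{2j_2\ldots j_m}$ over all $(j_2,\ldots,j_m)\in\{1,2\}^{m-1}$ with exactly $b$ entries equal to $1$ (and $m-1-b$ equal to $2$), $\mathbb{D}^s=\{(a_1,\ldots,a_h)\in\mathbb{Z}^h: a_1+\cdots+a_h=s,\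 0\le a_p\le m-1\}$ and $\mathbb{E}^s=\{(b_1,\ldots,b_k)\in\mathbb{Z}^k: b_1+\cdots+b_k=s,\ 0\le b_q\le m-1\}$.
   Context: $\mathbb{T}(\mathbb{C}^n,m)$ is the space of $m$-th order $n$-dimensional complex tensors $\mathcal{T}=(t_{i_1\ldots i_m})$, $1\le i_1,\ldots,i_m\le n$. $\mathcal{E}$ is the identity tensor: $e_{i_1\ldots i_m}=1$ if $i_1=\cdots=i_m$ and $0$ otherwise. For $\mathbf{x}\in\mathbb{C}^n$, $\mathcal{T}\mathbf{x}^{m-1}\in\mathbb{C}^n$ has $i$-th entry $\sum_{i_2,\ldots,i_m=1}^n t_{ii_2\ldots i_m}x_{i_2}\cdots x_{i_m}$. The resultant $\mathrm{Res}$ of $n$ homogeneous polynomials in $n$ variables, each of degree $m-1$, is the irreducible polynomial in their coefficients that vanishes if and only if the polynomials have a common zero in $\mathbb{C}^n\setminus\{\mathbf{0}\}$, normalized by $\mathrm{Res}(x_1^{m-1},\ldots,x_n^{m-1})=1$. $\mathrm{Edet}(\mathcal{T})$ is the resultant of the $n$ components of $\mathcal{T}\mathbf{x}^{m-1}$, and the characteristic polynomial is $\psi(\lambda)=\mathrm{Edet}(\lambda\mathcal{E}-\mathcal{T})$. The $d$-th trace is, by definition, $\mathrm{Tr}_d(\mathcal{T}):=(m-1)^{n-1}\left[\sum_{k_1+\cdots+k_n=d}\prod_{i=1}^n\frac{(\hat g_i)^{k_i}}{((m-1)k_i)!}\right]\mathrm{Tr}(A^{(m-1)d})$, where the sum is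 over nonnegative integers $k_i$, $A=(a_{ij})$ is an $n\times n$ matrix of independent variables and $\hat g_i:=\sum_{i_2,\ldots,i_m=1}^n t_{ii_2\ldots i_m}\frac{\partial}{\partial a_{ii_2}}\cdots\frac{\partial}{\partial a_{ii_m}}$ (here $n=2$). *)

theory Defs
  imports
    "HOL-Library.Poly_Mapping"
    "HOL-Computational_Algebra.Factorial_Ring"
    "Jordan_Normal_Form.Matrix"
    Complex_Main
begin

section \<open>Multivariate polynomials\<close>

text \<open>
  Polynomials in variables of type 'v are finitely supported functions from monomials
  (exponent vectors) to coefficients; the ring structure is the one of Poly_Mapping.
\<close>

type_synonym ('v, 'a) mpoly = "('v \<Rightarrow>\<^sub>0 nat) \<Rightarrow>\<^sub>0 'a"

definition mconst :: "'a::zero \<Rightarrow> ('v, 'a) mpoly" where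
  "mconst c = Poly_Mapping.single 0 c"

definition mvar :: "'v \<Rightarrow> ('v, 'a::zero_neq_one) mpoly" where
  "mvar v = Poly_Mapping.single (Poly_Mapping.single v 1) 1"

definition mvars :: "('v, 'a::zero) mpoly \<Rightarrow> 'v set" where
  "mvars p = (\<Union>\<mu>\<in>Poly_Mapping.keys p. Poly_Mapping.keys \<mu>)"

definition meval :: "('v \<Rightarrow> 'a::comm_semiring_1) \<Rightarrow> ('v, 'a) mpoly \<Rightarrow> 'a" where
  "meval x p = (\<Sum>\<mu>\<in>Poly_Mapping.keys p.
     Poly_Mapping.lookup p \<mu> * (\<Prod>v\<in>Poly_Mapping.keys \<mu>. x v ^ Poly_Mapping.lookup \<mu> v))"

text \<open>
  Formal partial derivative. A monomial not containing v contributes the coefficient 0,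
  so the truncated exponent subtraction is harmless.
\<close>

definition mpderiv :: "'v \<Rightarrow> ('v, 'a::comm_semiring_1) mpoly \<Rightarrow> ('v, 'a) mpoly" where
  "mpderiv v p = (\<Sum>\<mu>\<in>Poly_Mapping.keys p.
     Poly_Mapping.single (\<mu> - Poly_Mapping.single v 1)
       (of_nat (Poly_Mapping.lookup \<mu> v) * Poly_Mapping.lookup p \<mu>))"


section \<open>Resultant of n forms of degree d in the variables x_1, ..., x_n\<close>

definition monomials :: "nat \<Rightarrow> nat \<Rightarrow> (nat \<Rightarrow>\<^sub>0 nat) set" where
  "monomials n d = {\<mu>. Poly_Mapping.keys \<mu> \<subseteq> {1..n} \<and>
     (\<Sum>i\<in>Poly_Mapping.keys \<mu>. Poly_Mapping.lookup \<mu> i) = d}"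

definition forms :: "nat \<Rightarrow> nat \<Rightarrow> (nat, complex) mpoly set" where
  "forms n d = {f. Poly_Mapping.keys f \<subseteq> monomials n d}"

definition common_zero :: "nat \<Rightarrow> (nat \<Rightarrow> (nat, complex) mpoly) \<Rightarrow> bool" where
  "common_zero n F \<longleftrightarrow>
     (\<exists>x. (\<exists>i\<in>{1..n}. x i \<noteq> 0) \<and> (\<forall>i\<in>{1..n}. meval x (F i) = 0))"

text \<open>
  The resultant is a polynomial in one variable (i, \<mu>) for the coefficient of each
  monomial \<mu> of degree d in the i-th form.
\<close>

definition form_coeffs :: "(nat \<Rightarrow> (nat, complex) mpoly) \<Rightarrow> nat \<times> (nat \<Rightarrow>\<^sub>0 nat) \<Rightarrow> complex" where
  "form_coeffs F = (\<lambda>(i, \<mu>). Poly_Mapping.lookup (F i) \<mu>)"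

definition is_resultant ::
    "nat \<Rightarrow> nat \<Rightarrow> (nat \<times> (nat \<Rightarrow>\<^sub>0 nat), complex) mpoly \<Rightarrow> bool" where
  "is_resultant n d R \<longleftrightarrow>
     mvars R \<subseteq> {1..n} \<times> monomials n d \<and>
     irreducible R \<and>
     (\<forall>F. (\<forall>i\<in>{1..n}. F i \<in> forms n d) \<longrightarrow>
        (meval (form_coeffs F) R = 0 \<longleftrightarrow> common_zero n F)) \<and>
     meval (form_coeffs (\<lambda>i. mvar i ^ d)) R = 1"

definition resultant_poly ::
    "nat \<Rightarrow> nat \<Rightarrow> (nat \<times> (nat \<Rightarrow>\<^sub>0 nat), complex) mpoly" where
  "resultant_poly n d = (THE R. is_resultant n d R)"

definition Res :: "nat \<Rightarrow> nat \<Rightarrow> (nat \<Rightarrow> (nat, complex) mpoly) \<Rightarrow> complex" where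
  "Res n d F = meval (form_coeffs F) (resultant_poly n d)"


section \<open>Tensors\<close>

text \<open>
  An m-th order n-dimensional complex tensor is given by its entries at the index lists
  in multi_indices n m; values at all other lists are never used.
\<close>

type_synonym tensor = "nat list \<Rightarrow> complex"

definition multi_indices :: "nat \<Rightarrow> nat \<Rightarrow> nat list set" where
  "multi_indices n k = {is. length is = k \<and> set is \<subseteq> {1..n}}"

definition identity_tensor :: tensor where
  "identity_tensor is = (if \<forall>i\<in>set is. \<forall>j\<in>set is. i = j then 1 else 0)"

text \<open>The i-th component of T x^(m-1) as a form in the indeterminates x_1, ..., x_n.\<close>

definition tensor_form :: "nat \<Rightarrow> nat \<Rightarrow> tensor \<Rightarrow> nat \<Rightarrow> (nat, complex) mpoly" where
  "tensor_form n m T i =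
     (\<Sum>is\<in>multi_indices n (m - 1). mconst (T (i # is)) * prod_list (map mvar is))"

definition Edet :: "nat \<Rightarrow> nat \<Rightarrow> tensor \<Rightarrow> complex" where
  "Edet n m T = Res n (m - 1) (tensor_form n m T)"

definition tensor_char_poly :: "nat \<Rightarrow> nat \<Rightarrow> tensor \<Rightarrow> complex \<Rightarrow> complex" where
  "tensor_char_poly n m T z = Edet n m (\<lambda>is. z * identity_tensor is - T is)"


section \<open>Traces of a tensor\<close>

text \<open>
  The matrix library counts rows and columns from 0, so the entry at position (i, j) of the
  matrix is the variable a_(i+1, j+1).
\<close>

definition generic_matrix :: "nat \<Rightarrow> (nat \<times> nat, complex) mpoly mat" where
  "generic_matrix n = mat n n (\<lambda>(i, j). mvar (i + 1, j + 1))"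

definition mat_trace :: "'a::comm_monoid_add mat \<Rightarrow> 'a" where
  "mat_trace M = (\<Sum>i<dim_row M. M $$ (i, i))"

definition g_hat ::
    "nat \<Rightarrow> nat \<Rightarrow> tensor \<Rightarrow> nat \<Rightarrow> (nat \<times> nat, complex) mpoly \<Rightarrow> (nat \<times> nat, complex) mpoly" where
  "g_hat n m T i p =
     (\<Sum>is\<in>multi_indices n (m - 1). mconst (T (i # is)) * foldr (\<lambda>j. mpderiv (i, j)) is p)"

text \<open>
  The product of operators is composition (the operators g_hat commute). The result is a
  constant polynomial, since Tr(A^((m-1)d)) is homogeneous of degree (m-1)d and each operator
  differentiates (m-1)d times; Tr is its constant coefficient.
\<close>

definition trace_mpoly :: "nat \<Rightarrow> nat \<Rightarrow> tensor \<Rightarrow> nat \<Rightarrow> (nat \<times> nat, complex) mpoly" where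
  "trace_mpoly n m T d =
     mconst (of_nat (m - 1) ^ (n - 1)) *
     (\<Sum>ks | length ks = n \<and> sum_list ks = d.
        foldr (\<lambda>i p. mconst (1 / fact ((m - 1) * ks ! (i - 1))) * (g_hat n m T i ^^ (ks ! (i - 1))) p)
          [1..<Suc n] (mat_trace (generic_matrix n ^\<^sub>m ((m - 1) * d))))"

definition Tr :: "nat \<Rightarrow> nat \<Rightarrow> tensor \<Rightarrow> nat \<Rightarrow> complex" where
  "Tr n m T d = Poly_Mapping.lookup (trace_mpoly n m T d) 0"


section \<open>Notions specific to dimension two\<close>

definition alpha :: "nat \<Rightarrow> tensor \<Rightarrow> nat \<Rightarrow> complex" where
  "alpha m T a = (\<Sum>is | is \<in> multi_indices 2 (m - 1) \<and> count_list is 2 = a. T (1 # is))"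

definition beta :: "nat \<Rightarrow> tensor \<Rightarrow> nat \<Rightarrow> complex" where
  "beta m T b = (\<Sum>js | js \<in> multi_indices 2 (m - 1) \<and> count_list js 1 = b. T (2 # js))"

text \<open>
  Tuples (a_1, ..., a_h) with entries in {0, ..., m-1} and sum s. The sets D^s and E^s are the
  instances with h and k entries respectively.
\<close>

definition bounded_tuples :: "nat \<Rightarrow> nat \<Rightarrow> nat \<Rightarrow> nat list set" where
  "bounded_tuples m h s = {as. length as = h \<and> set as \<subseteq> {0..m - 1} \<and> sum_list as = s}"

end

theory Submission
  imports
    Defs
    "HOL-Complex_Analysis.Laurent_Convergence"
    "HOL-Analysis.Infinite_Sum"
    "Jordan_Normal_Form.Determinant"
    "HOL-Computational_Algebra.Fundamental_Theorem_Algebra"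
begin

text \<open>
  Write \<open>e = m - 1\<close>. The resultant of two binary forms of degree \<open>e\<close> is their Bezout determinant
  \<open>R\<close>: if the second form has leading coefficient \<open>b\<close> and roots \<open>q\<^sub>j\<close>, then \<open>R = b ^ e * \<Prod>j. f (q\<^sub>j)\<close>.
  A polynomial \<open>P\<close> in the coefficients that does not vanish where \<open>R\<close> does not vanish is \<open>c R ^ k\<close>:
  as a polynomial in the constant coefficient of \<open>f\<close> it is a product of powers of the \<open>f (q\<^sub>j)\<close>,
  by symmetry in the roots these powers all have the same exponent, and the remaining factor is a
  power of \<open>b\<close>. Hence \<open>R\<close> is irreducible and the only polynomial with the defining properties of
  the resultant.

  With \<open>w = 1 / z\<close> and \<open>A = \<Sum>a. \<alpha>\<^sub>a X ^ a\<close>, \<open>B = \<Sum>b. \<beta>\<^sub>b X ^ b\<close> the product formula gives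
  \<open>\<psi> z = z ^ (2 * e) (1 - w \<beta>\<^sub>0) ^ e \<Prod>j. (1 - w A (q\<^sub>j))\<close>, where the \<open>q\<^sub>j\<close> are the roots of the
  polynomial with reversed coefficients of \<open>1 - w B\<close>. Their power sums are, up to the factor \<open>s\<close>,
  the coefficients of \<open>- ln (1 - w B)\<close>, so for small \<open>w\<close> the logarithm of the product is an
  absolutely convergent double series in the coefficients of the powers of \<open>A\<close> and \<open>B\<close>, and its
  coefficient of \<open>w ^ d\<close> is \<open>- Tr\<^sub>d / d\<close>. The traces themselves are computed by counting the closed
  walks of given type on two vertices.
\<close>


section \<open>Evaluation of multivariate polynomials\<close>

text \<open>\<open>resultant_poly\<close> is a definite description, so nothing explicit is known
  about it until one polynomial with the defining properties is exhibited and shown to be the only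
  one. A rival polynomial, or a factor of the determinant, is at first known only through where it
  can vanish; hence the detour over zero sets instead of a direct study of divisibility.

  In the expansion the roots themselves depend on w. The terms for single roots are therefore not
  expanded in w; only the power sums of all roots are. The coefficient s/(hk) in the double series
  is 1/h from the logarithm in A times s/k from the power sum of order s. The order s = 0 is
  exceptional, because the zeroth power sum is the number e of roots; together with the factor in
  \<beta>_0 it gives the pure terms e (\<alpha>_0^d + \<beta>_0^d)/d. On the side of the traces,
  closed walks based at the two vertices contribute s/(ek) and s/(eh). Their sum is s(h+k)/(ehk),
  and multiplication by e/d turns it into the same s/(hk). The sum over compositions in \<psi> is
  the expansion of the exponential of minus the series of Tr_d w^d / d.\<close>

definition monom_eval :: "('v \<Rightarrow> 'a::comm_semiring_1) \<Rightarrow> ('v \<Rightarrow>\<^sub>0 nat) \<Rightarrow> 'a" where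
  "monom_eval x \<mu> = (\<Prod>v\<in>Poly_Mapping.keys \<mu>. x v ^ Poly_Mapping.lookup \<mu> v)"

lemma monom_eval_superset:
  assumes "finite A" "Poly_Mapping.keys \<mu> \<subseteq> A"
  shows "monom_eval x \<mu> = (\<Prod>v\<in>A. x v ^ Poly_Mapping.lookup \<mu> v)"
  unfolding monom_eval_def
  by (rule prod.mono_neutral_left) (use assms in \<open>auto simp: in_keys_iff\<close>)

lemma monom_eval_add: "monom_eval x (\<mu> + \<nu>) = monom_eval x \<mu> * monom_eval x \<nu>"
proof -
  let ?A = "Poly_Mapping.keys \<mu> \<union> Poly_Mapping.keys \<nu>"
  have "Poly_Mapping.keys (\<mu> + \<nu>) \<subseteq> ?A"
    by (rule Poly_Mapping.keys_add)
  then show ?thesis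
    by (simp add: monom_eval_superset[of ?A] lookup_add power_add prod.distrib)
qed

lemma monom_eval_0 [simp]: "monom_eval x 0 = 1"
  by (simp add: monom_eval_def)

lemma meval_superset:
  assumes "finite A" "Poly_Mapping.keys p \<subseteq> A"
  shows "meval x p = (\<Sum>\<mu>\<in>A. Poly_Mapping.lookup p \<mu> * monom_eval x \<mu>)"
  unfolding meval_def monom_eval_def[symmetric]
  by (rule sum.mono_neutral_left) (use assms in \<open>auto simp: in_keys_iff\<close>)

lemma meval_add: "meval x (p + q) = meval x p + meval x q"
proof -
  let ?A = "Poly_Mapping.keys p \<union> Poly_Mapping.keys q"
  have "Poly_Mapping.keys (p + q) \<subseteq> ?A"
    by (rule Poly_Mapping.keys_add)
  then show ?thesis
    by (simp add: meval_superset[of ?A] lookup_add distrib_right sum.distrib)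
qed

lemma meval_0 [simp]: "meval x 0 = 0"
  by (simp add: meval_def)

lemma meval_sum: "meval x (sum f A) = (\<Sum>a\<in>A. meval x (f a))"
  by (induction A rule: infinite_finite_induct) (auto simp: meval_add)

lemma meval_single: "meval x (Poly_Mapping.single \<mu> c) = c * monom_eval x \<mu>"
  by (subst meval_superset[of "{\<mu>}"]) auto

lemma poly_mapping_sum_monomials:
  "(\<Sum>\<mu>\<in>Poly_Mapping.keys p. Poly_Mapping.single \<mu> (Poly_Mapping.lookup p \<mu>)) = p"
  by (rule poly_mapping_eqI) (simp add: lookup_sum lookup_single when_def in_keys_iff)

lemma meval_mult: "meval x (p * q) = meval x p * meval x q"
proof -
  have "meval x (p * q) = meval x
      ((\<Sum>\<mu>\<in>Poly_Mapping.keys p. Poly_Mapping.single \<mu> (Poly_Mapping.lookup p \<mu>)) *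
       (\<Sum>\<mu>\<in>Poly_Mapping.keys q. Poly_Mapping.single \<mu> (Poly_Mapping.lookup q \<mu>)))"
    by (simp add: poly_mapping_sum_monomials)
  also have "\<dots> = (\<Sum>\<mu>\<in>Poly_Mapping.keys p. Poly_Mapping.lookup p \<mu> * monom_eval x \<mu>) *
      (\<Sum>\<mu>\<in>Poly_Mapping.keys q. Poly_Mapping.lookup q \<mu> * monom_eval x \<mu>)"
    by (simp add: sum_product meval_sum mult_single meval_single monom_eval_add mult_ac)
  also have "\<dots> = meval x p * meval x q"
    by (simp add: meval_superset[of "Poly_Mapping.keys p" p] meval_superset[of "Poly_Mapping.keys q" q])
  finally show ?thesis .
qed

lemma meval_mconst [simp]: "meval x (mconst c) = c"
  by (simp add: mconst_def meval_single)

lemma meval_1 [simp]: "meval x 1 = 1"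
  using meval_mconst[of x 1] by (simp add: mconst_def del: meval_mconst)

lemma meval_mvar [simp]: "meval x (mvar v) = x v"
  by (simp add: mvar_def meval_single monom_eval_def)

lemma meval_power: "meval x (p ^ n) = meval x p ^ n"
  by (induction n) (auto simp: meval_mult)

lemma comm_ring_hom_meval:
  "comm_ring_hom (meval x :: ('v, 'a::comm_ring_1) mpoly \<Rightarrow> 'a)"
  by unfold_locales (auto simp: meval_add meval_mult)

lemma meval_minus: "meval x (p - q) = meval x p - meval x (q :: ('v, 'a::comm_ring_1) mpoly)"
proof -
  interpret comm_ring_hom "meval x :: ('v, 'a) mpoly \<Rightarrow> 'a"
    by (rule comm_ring_hom_meval)
  show ?thesis by (simp add: hom_minus)
qed

lemma meval_cong:
  assumes "\<And>v. v \<in> mvars p \<Longrightarrow> x v = y v"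
  shows "meval x p = meval y p"
proof -
  have "monom_eval x \<mu> = monom_eval y \<mu>" if "\<mu> \<in> Poly_Mapping.keys p" for \<mu>
    unfolding monom_eval_def
  proof (rule prod.cong)
    fix v assume "v \<in> Poly_Mapping.keys \<mu>"
    with that have "x v = y v" by (intro assms) (auto simp: mvars_def)
    then show "x v ^ Poly_Mapping.lookup \<mu> v = y v ^ Poly_Mapping.lookup \<mu> v" by simp
  qed simp
  then show ?thesis by (simp add: meval_superset[of "Poly_Mapping.keys p"])
qed

text \<open>Rescaling a variable in which two monomials differ shortens a linear relation among monomials.\<close>

lemma monom_eval_independent:
  fixes c :: "('v \<Rightarrow>\<^sub>0 nat) \<Rightarrow> complex"
  assumes "finite A" "\<And>x. (\<Sum>\<mu>\<in>A. c \<mu> * monom_eval x \<mu>) = 0"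
  shows "\<forall>\<mu>\<in>A. c \<mu> = 0"
  using assms
proof (induction A arbitrary: c rule: finite_induct)
  case (insert \<nu> A)
  have zero: "c \<mu> = 0" if "\<mu> \<in> A" for \<mu>
  proof -
    have "\<mu> \<noteq> \<nu>" using that insert.hyps by auto
    then obtain v where v: "Poly_Mapping.lookup \<mu> v \<noteq> Poly_Mapping.lookup \<nu> v"
      by (meson poly_mapping_eqI)
    define sc where "sc = (\<lambda>(x::'v \<Rightarrow> complex) w. if w = v then 2 * x w else x w)"
    have sc: "monom_eval (sc x) \<kappa> = 2 ^ Poly_Mapping.lookup \<kappa> v * monom_eval x \<kappa>" for x \<kappa>
    proof -
      let ?B = "insert v (Poly_Mapping.keys \<kappa>)"
      have "monom_eval (sc x) \<kappa> = (\<Prod>w\<in>?B. sc x w ^ Poly_Mapping.lookup \<kappa> w)"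
        by (rule monom_eval_superset) auto
      also have "\<dots> = (\<Prod>w\<in>?B. (if w = v then 2 ^ Poly_Mapping.lookup \<kappa> w else 1) * x w ^ Poly_Mapping.lookup \<kappa> w)"
        by (intro prod.cong) (auto simp: sc_def power_mult_distrib)
      also have "\<dots> = 2 ^ Poly_Mapping.lookup \<kappa> v * (\<Prod>w\<in>?B. x w ^ Poly_Mapping.lookup \<kappa> w)"
        by (subst prod.distrib) (simp add: prod.delta)
      also have "(\<Prod>w\<in>?B. x w ^ Poly_Mapping.lookup \<kappa> w) = monom_eval x \<kappa>"
        by (rule monom_eval_superset[symmetric]) auto
      finally show ?thesis .
    qed
    define d where "d \<kappa> = c \<kappa> * (2 ^ Poly_Mapping.lookup \<kappa> v - 2 ^ Poly_Mapping.lookup \<nu> v)" for \<kappa>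
    have "(\<Sum>\<kappa>\<in>A. d \<kappa> * monom_eval x \<kappa>) = 0" for x
    proof -
      have "(\<Sum>\<kappa>\<in>A. d \<kappa> * monom_eval x \<kappa>) = (\<Sum>\<kappa>\<in>insert \<nu> A. d \<kappa> * monom_eval x \<kappa>)"
        using insert.hyps by (simp add: d_def)
      also have "\<dots> = (\<Sum>\<kappa>\<in>insert \<nu> A. c \<kappa> * monom_eval (sc x) \<kappa>)
          - 2 ^ Poly_Mapping.lookup \<nu> v * (\<Sum>\<kappa>\<in>insert \<nu> A. c \<kappa> * monom_eval x \<kappa>)"
        unfolding sc d_def sum_distrib_left sum_subtractf[symmetric]
        by (intro sum.cong) (auto simp: algebra_simps)
      finally show ?thesis
        by (simp only: insert.prems mult_zero_right diff_zero)
    qed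
    from insert.IH[OF this] that have "d \<mu> = 0" by blast
    moreover have "(2::complex) ^ Poly_Mapping.lookup \<mu> v \<noteq> 2 ^ Poly_Mapping.lookup \<nu> v"
    proof
      assume *: "(2::complex) ^ Poly_Mapping.lookup \<mu> v = 2 ^ Poly_Mapping.lookup \<nu> v"
      have "(2::real) ^ Poly_Mapping.lookup \<mu> v = 2 ^ Poly_Mapping.lookup \<nu> v"
        using arg_cong[OF *, of cmod] unfolding norm_power by simp
      with v show False by simp
    qed
    ultimately show ?thesis by (simp add: d_def)
  qed
  then have "(\<Sum>\<mu>\<in>A. c \<mu> * monom_eval (\<lambda>_. 1) \<mu>) = 0"
    by simp
  moreover have "monom_eval (\<lambda>_. 1) \<nu> = (1::complex)"
    by (simp add: monom_eval_def)
  ultimately have "c \<nu> = 0"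
    using insert.prems[of "\<lambda>_. 1"] insert.hyps by simp
  with zero show ?case by auto
qed auto

text \<open>Over an infinite field evaluation is faithful, so identities in the polynomial ring may
  be checked pointwise from here on.\<close>

lemma meval_eq_0_imp_eq_0:
  fixes p :: "('v, complex) mpoly"
  assumes "\<And>x. meval x p = 0"
  shows "p = 0"
proof -
  have "\<forall>\<mu>\<in>Poly_Mapping.keys p. Poly_Mapping.lookup p \<mu> = 0"
    by (rule monom_eval_independent) (use assms in \<open>auto simp flip: meval_superset\<close>)
  then show ?thesis
    by (metis in_keys_iff keys_eq_empty equals0I)
qed

lemma meval_inject:
  fixes p q :: "('v, complex) mpoly"
  assumes "\<And>x. meval x p = meval x q"
  shows "p = q"
  using meval_eq_0_imp_eq_0[of "p - q"] assms by (simp add: meval_minus)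


section \<open>Polynomial functions\<close>

text \<open>With functions in place of elements of the polynomial ring, a substitution such as that
  of roots for coefficients is plain composition, and closure rules show that the result is
  polynomial.\<close>

inductive polyfun :: "(('v \<Rightarrow> complex) \<Rightarrow> complex) \<Rightarrow> bool" where
  polyfun_const: "polyfun (\<lambda>_. c)"
| polyfun_var: "polyfun (\<lambda>x. x v)"
| polyfun_add: "polyfun p \<Longrightarrow> polyfun q \<Longrightarrow> polyfun (\<lambda>x. p x + q x)"
| polyfun_mult: "polyfun p \<Longrightarrow> polyfun q \<Longrightarrow> polyfun (\<lambda>x. p x * q x)"

named_theorems pf_intros
lemmas [pf_intros] = polyfun_const polyfun_var polyfun_add polyfun_mult

lemma polyfun_uminus [pf_intros]: "polyfun p \<Longrightarrow> polyfun (\<lambda>x. - p x)"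
  using polyfun_mult[OF polyfun_const[of "-1"]] by fastforce

lemma polyfun_diff [pf_intros]: "polyfun p \<Longrightarrow> polyfun q \<Longrightarrow> polyfun (\<lambda>x. p x - q x)"
  using polyfun_add[OF _ polyfun_uminus] by fastforce

lemma polyfun_sum [pf_intros]: "(\<And>a. a \<in> A \<Longrightarrow> polyfun (f a)) \<Longrightarrow> polyfun (\<lambda>x. \<Sum>a\<in>A. f a x)"
  by (induction A rule: infinite_finite_induct) (auto intro!: pf_intros)

lemma polyfun_if [pf_intros]: "polyfun p \<Longrightarrow> polyfun q \<Longrightarrow> polyfun (\<lambda>x. if b then p x else q x)"
  by (cases b) simp_all

lemma polyfun_prod [pf_intros]: "(\<And>a. a \<in> A \<Longrightarrow> polyfun (f a)) \<Longrightarrow> polyfun (\<lambda>x. \<Prod>a\<in>A. f a x)"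
  by (induction A rule: infinite_finite_induct) (auto intro!: pf_intros)

lemma polyfun_power [pf_intros]: "polyfun p \<Longrightarrow> polyfun (\<lambda>x. p x ^ n)"
  by (induction n) (auto intro!: pf_intros)

lemma polyfun_meval: "polyfun (\<lambda>x. meval x p)"
  unfolding meval_def by (intro pf_intros)

lemma polyfun_compose:
  assumes "polyfun p" "\<And>v. polyfun (\<lambda>x. \<phi> x v)"
  shows "polyfun (\<lambda>x. p (\<phi> x))"
  using assms(1) by induction (auto intro: pf_intros assms(2))

text \<open>Questions in many variables are settled by restriction to curves, where roots, orders
  and the fundamental theorem of algebra are at hand.\<close>

lemma polyfun_curve:
  assumes "polyfun p" "\<And>v. \<exists>u. \<forall>t. \<gamma> t v = poly u t"
  shows "\<exists>u. \<forall>t. p (\<gamma> t) = poly u t"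
  using assms(1)
proof induction
  case (polyfun_const c)
  show ?case by (rule exI[of _ "[:c:]"]) simp
next
  case (polyfun_add p q)
  then obtain u w where "\<forall>t. p (\<gamma> t) = poly u t" "\<forall>t. q (\<gamma> t) = poly w t" by blast
  then show ?case by (intro exI[of _ "u + w"]) simp
next
  case (polyfun_mult p q)
  then obtain u w where "\<forall>t. p (\<gamma> t) = poly u t" "\<forall>t. q (\<gamma> t) = poly w t" by blast
  then show ?case by (intro exI[of _ "u * w"]) simp
qed (use assms(2) in auto)

lemma polyfun_line:
  assumes "polyfun p"
  shows "\<exists>u. \<forall>t. p (\<lambda>v. x v + t * (y v - x v)) = poly u t"
proof (rule polyfun_curve[OF assms])
  fix v
  show "\<exists>u. \<forall>t. x v + t * (y v - x v) = poly u t"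
    by (rule exI[of _ "[:x v, y v - x v:]"]) simp
qed

lemma polyfun_upd_curve:
  assumes "polyfun p"
  shows "\<exists>u. \<forall>t. p (x(v := t)) = poly u t"
proof (rule polyfun_curve[OF assms])
  fix w
  show "\<exists>u. \<forall>t. (x(v := t)) w = poly u t"
    by (cases "w = v") (auto intro: exI[of _ "[:0, 1:]"] exI[of _ "[:x w:]"])
qed

lemma poly_eq_if_eventually_eq:
  fixes u w r :: "complex poly"
  assumes "r \<noteq> 0" "\<And>t. poly r t \<noteq> 0 \<Longrightarrow> poly u t = poly w t"
  shows "u = w"
proof -
  have "poly (r * (u - w)) t = 0" for t
    using assms(2)[of t] by auto
  then have "r * (u - w) = 0"
    using poly_all_0_iff_0 by blast
  with assms(1) show ?thesis by simp
qed

text \<open>Zariski density. On the line from \<open>x\<close> at t = 0 to \<open>y\<close> at t = 1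
  the function \<open>r\<close> becomes a nonzero univariate polynomial whose product with the
  difference of \<open>p\<close> and \<open>q\<close> vanishes identically; so the difference is
  zero on the whole line, in particular at t = 0.\<close>

lemma polyfun_density:
  assumes "polyfun p" "polyfun q" "polyfun r" "r y \<noteq> 0"
    and eq: "\<And>x. r x \<noteq> 0 \<Longrightarrow> p x = q x"
  shows "p x = q x"
proof -
  let ?l = "\<lambda>t v. x v + t * (y v - x v)"
  obtain u w s where u: "\<forall>t. p (?l t) = poly u t" and w: "\<forall>t. q (?l t) = poly w t"
    and s: "\<forall>t. r (?l t) = poly s t"
    using polyfun_line[OF assms(1), of x y] polyfun_line[OF assms(2), of x y]
      polyfun_line[OF assms(3), of x y] by blast
  from s[rule_format, of 1] assms(4) have "s \<noteq> 0" by auto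
  then have "u = w"
  proof (rule poly_eq_if_eventually_eq)
    fix t assume "poly s t \<noteq> 0"
    then have "r (?l t) \<noteq> 0" using s by simp
    from eq[OF this] show "poly u t = poly w t" using u w by simp
  qed
  with u[rule_format, of 0] w[rule_format, of 0] show ?thesis by simp
qed

lemma polyfun_mult_nonzero:
  assumes "polyfun p" "polyfun q" "\<exists>x. p x \<noteq> 0" "\<exists>x. q x \<noteq> 0"
  shows "\<exists>x. p x * q x \<noteq> 0"
  using polyfun_density[of q "\<lambda>_. 0" p] assms polyfun_const by (metis mult_eq_0_iff)

lemma polyfun_prod_nonzero:
  assumes "finite A" "\<And>a. a \<in> A \<Longrightarrow> polyfun (f a)" "\<And>a. a \<in> A \<Longrightarrow> \<exists>x. f a x \<noteq> 0"
  shows "\<exists>x. (\<Prod>a\<in>A. f a x) \<noteq> 0"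
  using assms
proof (induction A rule: finite_induct)
  case (insert a A)
  have "\<exists>x. f a x * (\<Prod>a\<in>A. f a x) \<noteq> 0"
    by (rule polyfun_mult_nonzero) (use insert in \<open>auto intro!: pf_intros\<close>)
  with insert show ?case by simp
qed auto

text \<open>A Taylor expansion in one variable about a centre that may move with \<open>x\<close>.
  Its coefficients are again polynomial functions and its length is uniform in \<open>x\<close>, so
  one can speak of the first coefficient that is not identically zero.\<close>

lemma polyfun_expand:
  assumes "polyfun p" "polyfun a"
  shows "\<exists>c n. (\<forall>i. polyfun (c i)) \<and> (\<forall>i>n. \<forall>x. c i x = 0) \<and>
    (\<forall>x t. p (x(v := a x + t)) = (\<Sum>i\<le>n. c i x * t ^ i))"
  using assms(1)
proof induction
  case (polyfun_const b)
  show ?case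
    by (rule exI[of _ "\<lambda>i x. if i = 0 then b else 0"], rule exI[of _ 0]) (auto intro: pf_intros)
next
  case (polyfun_var w)
  show ?case
  proof (cases "w = v")
    case True
    then show ?thesis
      by (intro exI[of _ "\<lambda>i x. if i = 0 then a x else if i = 1 then 1 else 0"] exI[of _ 1])
         (auto intro: pf_intros assms(2))
  next
    case False
    then show ?thesis
      by (intro exI[of _ "\<lambda>i x. if i = 0 then x w else 0"] exI[of _ 0])
         (auto intro: pf_intros)
  qed
next
  case (polyfun_add p q)
  then obtain c n d m where c: "\<forall>i. polyfun (c i)" "\<forall>i>n. \<forall>x. c i x = 0"
      "\<forall>x t. p (x(v := a x + t)) = (\<Sum>i\<le>n. c i x * t ^ i)"
    and d: "\<forall>i. polyfun (d i)" "\<forall>i>m. \<forall>x. d i x = 0"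
      "\<forall>x t. q (x(v := a x + t)) = (\<Sum>i\<le>m. d i x * t ^ i)"
    by blast
  have "(\<Sum>i\<le>n. c i x * t ^ i) = (\<Sum>i\<le>max n m. c i x * t ^ i)" for x t
    by (rule sum.mono_neutral_left) (simp_all add: c(2))
  moreover have "(\<Sum>i\<le>m. d i x * t ^ i) = (\<Sum>i\<le>max n m. d i x * t ^ i)" for x t
    by (rule sum.mono_neutral_left) (simp_all add: d(2))
  ultimately have "p (x(v := a x + t)) + q (x(v := a x + t)) =
      (\<Sum>i\<le>max n m. (c i x + d i x) * t ^ i)" for x t
    unfolding c(3)[rule_format] d(3)[rule_format] by (simp only: sum.distrib distrib_right)
  moreover have "polyfun (\<lambda>x. c i x + d i x)" for i
    using c(1) d(1) by (intro pf_intros) auto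
  moreover have "c i x + d i x = 0" if "i > max n m" for i x
    using that c(2) d(2) by simp
  ultimately show ?case
    by (intro exI[of _ "\<lambda>i x. c i x + d i x"] exI[of _ "max n m"]) blast
next
  case (polyfun_mult p q)
  then obtain c n d m where c: "\<forall>i. polyfun (c i)" "\<forall>i>n. \<forall>x. c i x = 0"
      "\<forall>x t. p (x(v := a x + t)) = (\<Sum>i\<le>n. c i x * t ^ i)"
    and d: "\<forall>i. polyfun (d i)" "\<forall>i>m. \<forall>x. d i x = 0"
      "\<forall>x t. q (x(v := a x + t)) = (\<Sum>i\<le>m. d i x * t ^ i)"
    by blast
  have "(\<Sum>k\<le>i. c k x * d (i - k) x) = 0" if "i > n + m" for i x
  proof (rule sum.neutral, intro ballI)
    fix k
    show "c k x * d (i - k) x = 0"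
      using that by (cases "k > n") (simp_all add: c(2) d(2))
  qed
  moreover have "p (x(v := a x + t)) * q (x(v := a x + t)) =
      (\<Sum>r\<le>n + m. (\<Sum>k\<le>r. c k x * d (r - k) x) * t ^ r)" for x t
    unfolding c(3)[rule_format] d(3)[rule_format]
    by (rule polynomial_product) (simp_all add: c(2) d(2))
  moreover have "polyfun (\<lambda>x. \<Sum>k\<le>i. c k x * d (i - k) x)" for i
    using c(1) d(1) by (intro pf_intros) auto
  ultimately show ?case
    by (intro exI[of _ "\<lambda>i x. \<Sum>k\<le>i. c k x * d (i - k) x"] exI[of _ "n + m"]) blast
qed

text \<open>The segment from the point with all other coordinates 0 to \<open>x\<close> stays in a
  hyperplane of constant nonzero \<open>x v\<close>. There \<open>p\<close> has no zero, so it is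
  constant along the line by the fundamental theorem of algebra. Hence \<open>p\<close> depends on
  \<open>x v\<close> alone, and a univariate polynomial with no root except possibly 0 is a
  monomial.\<close>

lemma polyfun_nonvanishing_off_hyperplane:
  assumes "polyfun p" "\<And>x. x v \<noteq> 0 \<Longrightarrow> p x \<noteq> 0"
  shows "\<exists>c N. c \<noteq> 0 \<and> (\<forall>x. x v \<noteq> 0 \<longrightarrow> p x = c * x v ^ N)"
proof -
  obtain u where u: "\<And>t. p ((\<lambda>_. 0)(v := t)) = poly u t"
    using polyfun_upd_curve[OF assms(1)] by blast
  have u0: "poly u t \<noteq> 0" if "t \<noteq> 0" for t
    using u[of t] assms(2)[of "(\<lambda>_. 0)(v := t)"] that by auto
  have eq: "p x = poly u (x v)" if "x v \<noteq> 0" for x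
  proof -
    let ?y = "(\<lambda>_. 0)(v := x v)"
    obtain w where w: "\<And>t. p (\<lambda>i. ?y i + t * (x i - ?y i)) = poly w t"
      using polyfun_line[OF assms(1), of ?y x] by blast
    have "poly w t \<noteq> 0" for t
      unfolding w[symmetric] by (rule assms(2)) (use that in auto)
    then have "constant (poly w)"
      using fundamental_theorem_of_algebra by blast
    then have "poly w 0 = poly w 1"
      by (simp add: constant_def)
    with w[of 0] w[of 1] u[of "x v"] show ?thesis by (simp add: fun_upd_def)
  qed
  have "u \<noteq> 0" using u0[of 1] by auto
  have "u = Polynomial.smult (lead_coeff u) (\<Prod>z | poly u z = 0. [:- z, 1:] ^ order z u)"
    by (simp add: complex_poly_decompose)
  also have "(\<Prod>z | poly u z = 0. [:- z, 1:] ^ order z u) = [:0, 1:] ^ order 0 u"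
  proof (cases "poly u 0 = 0")
    case True
    then have "poly u z = 0 \<longleftrightarrow> z = 0" for z
      using u0[of z] by (cases "z = 0") simp_all
    then have "{z. poly u z = 0} = {0}" by simp
    then show ?thesis by simp
  next
    case False
    then have "poly u z \<noteq> 0" for z
      using u0[of z] by (cases "z = 0") simp_all
    then have "{z. poly u z = 0} = {}" by simp
    moreover have "order 0 u = 0" using False by (rule order_0I)
    ultimately show ?thesis by simp
  qed
  finally have u_eq: "u = Polynomial.smult (lead_coeff u) ([:0, 1:] ^ order 0 u)" .
  have "poly u t = lead_coeff u * t ^ order 0 u" for t
    using arg_cong[OF u_eq, of "\<lambda>r. poly r t"] by (simp only: poly_smult poly_power) simp
  with eq \<open>u \<noteq> 0\<close> show ?thesis
    by (intro exI[of _ "lead_coeff u"] exI[of _ "order 0 u"]) simp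
qed


section \<open>The Bezout determinant of two binary forms\<close>

text \<open>
  For \<open>k = e - j\<close>, column \<open>j\<close> contains the coefficients of the polynomial
  \<open>(F\<^sub>k G - F G\<^sub>k) / X ^ k\<close>, where \<open>F\<^sub>k\<close> and \<open>G\<^sub>k\<close> are the truncations of \<open>F\<close> and \<open>G\<close> below
  degree \<open>k\<close>. Coefficients beyond degree \<open>e\<close> are assumed to vanish.
\<close>

definition bezout_mat :: "nat \<Rightarrow> (nat \<Rightarrow> 'a::comm_ring_1) \<Rightarrow> (nat \<Rightarrow> 'a) \<Rightarrow> 'a mat" where
  "bezout_mat e f g =
     Matrix.mat e e (\<lambda>(i, j). \<Sum>l<e - j. f l * g (i + (e - j - l)) - f (i + (e - j - l)) * g l)"

definition bezout_res :: "nat \<Rightarrow> (nat \<Rightarrow> 'a::comm_ring_1) \<Rightarrow> (nat \<Rightarrow> 'a) \<Rightarrow> 'a" where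
  "bezout_res e f g = det (bezout_mat e f g)"

lemma bezout_mat_carrier [simp]: "bezout_mat e f g \<in> carrier_mat e e"
  by (simp add: bezout_mat_def)

lemma bezout_mat_dim [simp]: "dim_row (bezout_mat e f g) = e" "dim_col (bezout_mat e f g) = e"
  by (simp_all add: bezout_mat_def)

lemma bezout_mat_index:
  "i < e \<Longrightarrow> j < e \<Longrightarrow> bezout_mat e f g $$ (i, j) =
    (\<Sum>l<e - j. f l * g (i + (e - j - l)) - f (i + (e - j - l)) * g l)"
  by (simp add: bezout_mat_def)

lemma bezout_res_swap: "bezout_res e g f = (- 1) ^ e * bezout_res e f g"
proof -
  have "bezout_mat e g f = (- 1) \<cdot>\<^sub>m bezout_mat e f g"
    by (rule eq_matI) (auto simp: bezout_mat_def sum_negf[symmetric] algebra_simps intro!: sum.cong)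
  then show ?thesis by (simp add: bezout_res_def)
qed

lemma bezout_res_scale:
  "bezout_res e (\<lambda>i. a * f i) (\<lambda>i. b * g i) = (a * b) ^ e * bezout_res e f g"
proof -
  have "bezout_mat e (\<lambda>i. a * f i) (\<lambda>i. b * g i) = (a * b) \<cdot>\<^sub>m bezout_mat e f g"
    by (rule eq_matI) (auto simp: bezout_mat_def sum_distrib_left algebra_simps intro!: sum.cong)
  then show ?thesis by (simp add: bezout_res_def)
qed

lemma (in comm_ring_hom) bezout_res_hom:
  "hom (bezout_res e f g) = bezout_res e (\<lambda>i. hom (f i)) (\<lambda>i. hom (g i))"
proof -
  have "map_mat hom (bezout_mat e f g) = bezout_mat e (\<lambda>i. hom (f i)) (\<lambda>i. hom (g i))"
    by (rule eq_matI) (auto simp: bezout_mat_def hom_sum hom_mult hom_minus)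
  then show ?thesis by (metis bezout_res_def hom_det)
qed

text \<open>For the constant polynomial 1 the matrix is upper triangular with \<open>g e\<close>
  along the diagonal. This is the reference case to which a general \<open>f\<close> is compared at
  the roots of \<open>g\<close>.\<close>

lemma bezout_res_1:
  fixes g :: "nat \<Rightarrow> 'a::idom"
  assumes "\<And>i. i > e \<Longrightarrow> g i = 0"
  shows "bezout_res e (\<lambda>i. if i = 0 then 1 else 0) g = g e ^ e"
proof -
  let ?f = "\<lambda>i. if i = 0 then (1::'a) else 0"
  have entry: "bezout_mat e ?f g $$ (i, j) = g (i + (e - j))" if "i < e" "j < e" for i j
  proof -
    have "bezout_mat e ?f g $$ (i, j) =
        (\<Sum>l<e - j. ?f l * g (i + (e - j - l)) - ?f (i + (e - j - l)) * g l)"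
      using that by (simp add: bezout_mat_def)
    also have "\<dots> = (\<Sum>l<e - j. if l = 0 then g (i + (e - j)) else 0)"
      by (rule sum.cong) auto
    finally show ?thesis using that by simp
  qed
  have "upper_triangular (bezout_mat e ?f g)"
    unfolding upper_triangular_def using entry assms by auto
  then have "bezout_res e ?f g = prod_list (diag_mat (bezout_mat e ?f g))"
    unfolding bezout_res_def by (rule det_upper_triangular[of _ e]) simp
  also have "diag_mat (bezout_mat e ?f g) = replicate e (g e)"
    by (rule nth_equalityI) (auto simp: diag_mat_def entry)
  finally show ?thesis by simp
qed

lemma sum_triangle_commute:
  fixes a b :: "nat \<Rightarrow> 'a::comm_semiring_0"
  shows "(\<Sum>l<k. a l * (\<Sum>n<k - l. b n)) = (\<Sum>l<k. b l * (\<Sum>n<k - l. a n))"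
proof -
  have "(\<Sum>l<k. a l * (\<Sum>n<k - l. b n)) = (\<Sum>(l, n)\<in>(SIGMA l:{..<k}. {..<k - l}). a l * b n)"
    by (simp add: sum.Sigma sum_distrib_left)
  also have "\<dots> = (\<Sum>(l, n)\<in>(SIGMA l:{..<k}. {..<k - l}). b l * a n)"
    by (rule sum.reindex_bij_witness[of _ prod.swap prod.swap]) (auto simp: mult.commute)
  also have "\<dots> = (\<Sum>l<k. b l * (\<Sum>n<k - l. a n))"
    by (simp add: sum.Sigma sum_distrib_left)
  finally show ?thesis .
qed

lemma bezout_mat_column:
  fixes f g :: "nat \<Rightarrow> 'a::comm_ring_1"
  assumes f0: "\<And>i. i > e \<Longrightarrow> f i = 0" and g0: "\<And>i. i > e \<Longrightarrow> g i = 0"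
    and "j < e"
  shows "q ^ (e - j) * (\<Sum>i<e. q ^ i * bezout_mat e f g $$ (i, j)) =
    (\<Sum>l<e - j. f l * q ^ l) * (\<Sum>i\<le>e. g i * q ^ i) -
    (\<Sum>i\<le>e. f i * q ^ i) * (\<Sum>l<e - j. g l * q ^ l)"
proof -
  define k where "k = e - j"
  \<comment> \<open>The products of index l and n with l + n < k: the shifted index i + (k - l)
    never reaches them, so each half of the difference lacks them. The sum is symmetric in its two
    arguments and cancels.\<close>
  define tri where "tri a b = (\<Sum>l<k. a l * q ^ l * (\<Sum>n<k - l. b n * q ^ n))" for a b :: "nat \<Rightarrow> 'a"
  have half: "(\<Sum>l<k. \<Sum>i<e. q ^ (k + i) * (a l * b (i + (k - l)))) =
      (\<Sum>l<k. a l * q ^ l) * (\<Sum>i\<le>e. b i * q ^ i) - tri a b"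
    if b0: "\<And>i. i > e \<Longrightarrow> b i = 0" for a b :: "nat \<Rightarrow> 'a"
  proof -
    have "(\<Sum>i<e. q ^ (k + i) * (a l * b (i + (k - l)))) =
        a l * q ^ l * ((\<Sum>i\<le>e. b i * q ^ i) - (\<Sum>n<k - l. b n * q ^ n))" if "l < k" for l
    proof -
      have "(\<Sum>i<e. q ^ (k + i) * (a l * b (i + (k - l)))) =
          a l * q ^ l * (\<Sum>i<e. b (i + (k - l)) * q ^ (i + (k - l)))"
        unfolding sum_distrib_left
      proof (rule sum.cong)
        fix i
        have "q ^ (k + i) = q ^ l * q ^ (i + (k - l))"
          using that by (simp add: add.commute flip: power_add)
        then show "q ^ (k + i) * (a l * b (i + (k - l))) =
            a l * q ^ l * (b (i + (k - l)) * q ^ (i + (k - l)))"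
          by (simp add: mult_ac)
      qed simp
      also have "(\<Sum>i<e. b (i + (k - l)) * q ^ (i + (k - l))) =
          (\<Sum>i=k - l..<e + (k - l). b i * q ^ i)"
        using sum.shift_bounds_nat_ivl[of "\<lambda>i. b i * q ^ i" 0 "k - l" e]
        by (simp add: atLeast0LessThan)
      also have "\<dots> = (\<Sum>i<e + (k - l). b i * q ^ i) - (\<Sum>n<k - l. b n * q ^ n)"
        by (simp add: sum_diff_nat_ivl[of 0, simplified] atLeast0LessThan[symmetric])
      also have "(\<Sum>i<e + (k - l). b i * q ^ i) = (\<Sum>i\<le>e. b i * q ^ i)"
        by (rule sum.mono_neutral_right) (use that b0 in auto)
      finally show ?thesis .
    qed
    then show ?thesis
      by (simp add: tri_def sum_distrib_right sum_subtractf right_diff_distrib)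
  qed
  have tri_commute: "tri f g = tri g f"
    unfolding tri_def by (rule sum_triangle_commute)
  have "q ^ k * (\<Sum>i<e. q ^ i * bezout_mat e f g $$ (i, j)) =
      (\<Sum>i<e. \<Sum>l<k. q ^ (k + i) * (f l * g (i + (k - l)))) -
      (\<Sum>i<e. \<Sum>l<k. q ^ (k + i) * (g l * f (i + (k - l))))"
  proof -
    have "bezout_mat e f g $$ (i, j) =
        (\<Sum>l<k. f l * g (i + (k - l)) - f (i + (k - l)) * g l)" if "i < e" for i
      using that \<open>j < e\<close> by (simp add: bezout_mat_def k_def)
    then show ?thesis
      unfolding sum_distrib_left sum_subtractf[symmetric]
      by (intro sum.cong refl)
         (simp add: sum_distrib_left sum_subtractf[symmetric] power_add algebra_simps)
  qed
  also have "(\<Sum>i<e. \<Sum>l<k. q ^ (k + i) * (f l * g (i + (k - l)))) =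
      (\<Sum>l<k. f l * q ^ l) * (\<Sum>i\<le>e. g i * q ^ i) - tri f g"
    by (subst sum.swap) (rule half[OF g0])
  also have "(\<Sum>i<e. \<Sum>l<k. q ^ (k + i) * (g l * f (i + (k - l)))) =
      (\<Sum>l<k. g l * q ^ l) * (\<Sum>i\<le>e. f i * q ^ i) - tri g f"
    by (subst sum.swap) (rule half[OF f0])
  finally show ?thesis
    unfolding k_def[symmetric] tri_commute by (simp add: mult.commute)
qed

text \<open>A kernel vector is the coefficient vector of a nonzero polynomial of degree below e with
  e distinct roots.\<close>

lemma vandermonde_nonzero:
  fixes q :: "nat \<Rightarrow> complex"
  assumes "inj_on q {..<e}"
  shows "det (Matrix.mat e e (\<lambda>(i, j). q i ^ j)) \<noteq> 0"
proof
  let ?V = "Matrix.mat e e (\<lambda>(i, j). q i ^ j)"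
  assume "det ?V = 0"
  then obtain v where v: "v \<in> carrier_vec e" "v \<noteq> 0\<^sub>v e" "?V *\<^sub>v v = 0\<^sub>v e"
    using det_0_iff_vec_prod_zero[of ?V e] by auto
  define p where "p = (\<Sum>j<e. Polynomial.monom (vec_index v j) j)"
  have coeff_p: "poly.coeff p j = (if j < e then vec_index v j else 0)" for j
    unfolding p_def by (simp add: coeff_sum if_distrib)
  have root: "poly p (q i) = 0" if "i < e" for i
  proof -
    have "poly p (q i) = vec_index (?V *\<^sub>v v) i"
      using that v(1) by (simp add: p_def poly_sum poly_monom scalar_prod_def atLeast0LessThan mult.commute)
    then show ?thesis using v(3) that by simp
  qed
  have "p \<noteq> 0"
  proof
    assume "p = 0"
    have "vec_index v j = 0" if "j < e" for j
      using coeff_p[of j] that \<open>p = 0\<close> by simp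
    then have "v = 0\<^sub>v e"
      using v(1) by (intro eq_vecI) auto
    with v(2) show False by simp
  qed
  have "e \<noteq> 0" using v by auto
  have "degree p < e"
    by (rule degree_lessI) (use coeff_p \<open>p \<noteq> 0\<close> in auto)
  moreover have "card (q ` {..<e}) \<le> card {z. poly p z = 0}"
    using root poly_roots_finite[OF \<open>p \<noteq> 0\<close>] by (intro card_mono) auto
  ultimately show False
    using card_poly_roots_bound[OF \<open>p \<noteq> 0\<close>] card_image[OF assms] by simp
qed

text \<open>At a root of \<open>g\<close> the column identity loses its term with the full sum of
  \<open>g\<close>, and what remains is linear in the value of \<open>f\<close>. So multiplying by
  the Vandermonde matrix of the roots turns the matrix of \<open>f\<close> into that of the constant
  1, with rows scaled by the values of \<open>f\<close>. Nonzero roots allow the power of the root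
  to be cancelled.\<close>

lemma bezout_res_distinct_roots:
  fixes f g q :: "nat \<Rightarrow> complex"
  assumes f0: "\<And>i. i > e \<Longrightarrow> f i = 0" and g0: "\<And>i. i > e \<Longrightarrow> g i = 0"
    and inj: "inj_on q {..<e}" and nz: "\<And>i. i < e \<Longrightarrow> q i \<noteq> 0"
    and root: "\<And>j. j < e \<Longrightarrow> (\<Sum>i\<le>e. g i * q j ^ i) = 0"
  shows "bezout_res e f g = g e ^ e * (\<Prod>j<e. \<Sum>i\<le>e. f i * q j ^ i)"
proof -
  let ?V = "Matrix.mat e e (\<lambda>(i, j). q i ^ j)"
  let ?u = "\<lambda>i. if i = 0 then (1::complex) else 0"
  let ?D = "Matrix.mat e e (\<lambda>(i, j). if i = j then \<Sum>l\<le>e. f l * q i ^ l else 0)"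
  have "?V * bezout_mat e f g = ?D * (?V * bezout_mat e ?u g)"
  proof (rule eq_matI)
    fix i j assume "i < dim_row (?D * (?V * bezout_mat e ?u g))"
      "j < dim_col (?D * (?V * bezout_mat e ?u g))"
    then have ij: "i < e" "j < e" by auto
    have VB: "(?V * bezout_mat e h g) $$ (i, j) = (\<Sum>l<e. q i ^ l * bezout_mat e h g $$ (l, j))" for h
      using ij by (simp add: scalar_prod_def atLeast0LessThan)
    have "q i ^ (e - j) * (\<Sum>l<e. q i ^ l * bezout_mat e h g $$ (l, j)) =
        - (\<Sum>l\<le>e. h l * q i ^ l) * (\<Sum>l<e - j. g l * q i ^ l)"
      if "\<And>i. i > e \<Longrightarrow> h i = 0" for h
      using bezout_mat_column[of e h g j "q i"] that g0 ij root[of i] by simp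
    note col = this
    have u1: "(\<Sum>l\<le>e. ?u l * q i ^ l) = 1"
    proof -
      have "(\<Sum>l\<le>e. ?u l * q i ^ l) = (\<Sum>l\<le>e. if l = 0 then 1 else 0)"
        by (rule sum.cong) auto
      then show ?thesis by simp
    qed
    have "q i ^ (e - j) * (\<Sum>l<e. q i ^ l * bezout_mat e f g $$ (l, j)) =
        (\<Sum>l\<le>e. f l * q i ^ l) * (- (\<Sum>l\<le>e. ?u l * q i ^ l) * (\<Sum>l<e - j. g l * q i ^ l))"
      using col[of f] f0 by (simp add: u1)
    also have "\<dots> = (\<Sum>l\<le>e. f l * q i ^ l) *
        (q i ^ (e - j) * (\<Sum>l<e. q i ^ l * bezout_mat e ?u g $$ (l, j)))"
      by (subst col[of ?u]) simp_all
    finally have "q i ^ (e - j) * (\<Sum>l<e. q i ^ l * bezout_mat e f g $$ (l, j)) =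
        q i ^ (e - j) * ((\<Sum>l\<le>e. f l * q i ^ l) * (\<Sum>l<e. q i ^ l * bezout_mat e ?u g $$ (l, j)))"
      by (simp only: mult.left_commute)
    with nz[OF ij(1)]
    have *: "(?V * bezout_mat e f g) $$ (i, j) = (\<Sum>l\<le>e. f l * q i ^ l) * (?V * bezout_mat e ?u g) $$ (i, j)"
      unfolding VB by simp
    have "(?D * (?V * bezout_mat e ?u g)) $$ (i, j) =
        (\<Sum>k<e. (if i = k then \<Sum>l\<le>e. f l * q i ^ l else 0) * (?V * bezout_mat e ?u g) $$ (k, j))"
      using ij by (subst index_mult_mat) (simp_all add: scalar_prod_def atLeast0LessThan)
    also have "\<dots> = (\<Sum>l\<le>e. f l * q i ^ l) * (?V * bezout_mat e ?u g) $$ (i, j)"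
      using ij by (simp add: if_distribR[symmetric] if_distrib[of "\<lambda>z. z * _"] cong: if_cong)
    finally show "(?V * bezout_mat e f g) $$ (i, j) = (?D * (?V * bezout_mat e ?u g)) $$ (i, j)"
      using * by simp
  qed auto
  then have "det (?V * bezout_mat e f g) = det (?D * (?V * bezout_mat e ?u g))"
    by simp
  also have "det (?V * bezout_mat e f g) = det ?V * bezout_res e f g"
    unfolding bezout_res_def by (rule det_mult[of _ e]) simp_all
  also have "det (?D * (?V * bezout_mat e ?u g)) = det ?D * det (?V * bezout_mat e ?u g)"
    by (rule det_mult[of _ e]) (simp_all add: mult_carrier_mat[of _ e e])
  also have "det (?V * bezout_mat e ?u g) = det ?V * bezout_res e ?u g"
    unfolding bezout_res_def by (rule det_mult[of _ e]) simp_all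
  finally have "det ?V * bezout_res e f g = det ?D * (det ?V * bezout_res e ?u g)" .
  moreover have "det ?D = (\<Prod>j<e. \<Sum>i\<le>e. f i * q j ^ i)"
  proof -
    have "det ?D = prod_list (diag_mat ?D)"
      by (rule det_upper_triangular[of _ e]) (auto simp: upper_triangular_def)
    also have "diag_mat ?D = map (\<lambda>j. \<Sum>i\<le>e. f i * q j ^ i) [0..<e]"
      by (auto simp: diag_mat_def)
    finally show ?thesis
      by (simp add: interv_sum_list_conv_sum_set_nat prod.distinct_set_conv_list[symmetric] atLeast0LessThan)
  qed
  ultimately show ?thesis
    using vandermonde_nonzero[OF inj] bezout_res_1[of e g] g0 by (simp add: mult_ac)
qed

lemma polyfun_bezout_res [pf_intros]:
  assumes "\<And>i. polyfun (\<lambda>x. f x i)" "\<And>i. polyfun (\<lambda>x. g x i)"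
  shows "polyfun (\<lambda>x. bezout_res e (f x) (g x))"
proof -
  have "bezout_res e (f x) (g x) = (\<Sum>p | p permutes {0..<e}. signof p * (\<Prod>i = 0..<e.
      if i < e \<and> p i < e then \<Sum>l<e - p i. f x l * g x (i + (e - p i - l)) - f x (i + (e - p i - l)) * g x l
      else 1))" for x
    unfolding bezout_res_def det_def'[OF bezout_mat_carrier]
  proof (intro sum.cong prod.cong arg_cong2[of _ _ _ _ "(*)"] refl)
    fix p i assume "p \<in> {p. p permutes {0..<e}}" "i \<in> {0..<e}"
    then have "i < e" "p i < e" by (auto simp: permutes_in_image[of p "{0..<e}"])
    then show "bezout_mat e (f x) (g x) $$ (i, p i) = (if i < e \<and> p i < e then
        \<Sum>l<e - p i. f x l * g x (i + (e - p i - l)) - f x (i + (e - p i - l)) * g x l else 1)"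
      by (simp add: bezout_mat_def)
  qed
  then show ?thesis
    by (simp only:) (intro pf_intros assms)
qed

lemma polyfun_coeff_prod [pf_intros]:
  assumes "\<And>j. j \<in> A \<Longrightarrow> polyfun (\<lambda>x. q x j)"
  shows "polyfun (\<lambda>x. poly.coeff (\<Prod>j\<in>A. [:- q x j, 1:]) i)"
  using assms
proof (induction A arbitrary: i rule: infinite_finite_induct)
  case (insert a A)
  have "poly.coeff (\<Prod>j\<in>insert a A. [:- q x j, 1:]) i =
      - q x a * poly.coeff (\<Prod>j\<in>A. [:- q x j, 1:]) i +
      (if i = 0 then 0 else poly.coeff (\<Prod>j\<in>A. [:- q x j, 1:]) (i - 1))" for x
    using insert.hyps by (cases i) (auto simp: coeff_pCons)
  moreover have "polyfun (\<lambda>x. \<dots> x)"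
    by (intro pf_intros insert.IH insert.prems) auto
  ultimately show ?case by simp
qed (auto intro: pf_intros)

lemma degree_prod_linear: "degree (\<Prod>j<n. [:- q j, 1::complex:]) = n"
  by (subst degree_prod_eq_sum_degree) auto

lemma lead_coeff_prod_linear: "poly.coeff (\<Prod>j<n. [:- q j, 1::complex:]) n = 1"
proof -
  have "lead_coeff (\<Prod>j<n. [:- q j, 1::complex:]) = 1" by (simp add: lead_coeff_prod)
  then show ?thesis by (simp only: degree_prod_linear)
qed

text \<open>Both sides are polynomial in the roots and agree where the roots are nonzero and
  distinct, that is, where \<open>r\<close> does not vanish. The roots 1, 2, 3, ... show that this
  set is not empty.\<close>

theorem bezout_res_roots:
  fixes f q :: "nat \<Rightarrow> complex"
  assumes f0: "\<And>i. i > e \<Longrightarrow> f i = 0"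
  shows "bezout_res e f (\<lambda>i. b * poly.coeff (\<Prod>j<e. [:- q j, 1:]) i) =
    b ^ e * (\<Prod>j<e. \<Sum>i\<le>e. f i * q j ^ i)"
proof (rule polyfun_density[where x = q and y = "\<lambda>i. of_nat (Suc i)"
      and r = "\<lambda>x. \<Prod>j<e. x j * (\<Prod>i<j. x j - x i)"
      and p = "\<lambda>q. bezout_res e f (\<lambda>i. b * poly.coeff (\<Prod>j<e. [:- q j, 1:]) i)"
      and q = "\<lambda>q. b ^ e * (\<Prod>j<e. \<Sum>i\<le>e. f i * q j ^ i)"])
  let ?r = "\<lambda>x::nat \<Rightarrow> complex. \<Prod>j<e. x j * (\<Prod>i<j. x j - x i)"
  show "polyfun (\<lambda>q. bezout_res e f (\<lambda>i. b * poly.coeff (\<Prod>j<e. [:- q j, 1:]) i))"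
    "polyfun (\<lambda>q. b ^ e * (\<Prod>j<e. \<Sum>i\<le>e. f i * q j ^ i))"
    "polyfun ?r"
    by (intro pf_intros)+
  show "?r (\<lambda>i. of_nat (Suc i)) \<noteq> 0"
    by (auto simp: of_nat_eq_iff simp del: of_nat_Suc)
  fix q :: "nat \<Rightarrow> complex"
  assume r: "?r q \<noteq> 0"
  let ?g = "\<lambda>i. b * poly.coeff (\<Prod>j<e. [:- q j, 1:]) i"
  have nz: "q j \<noteq> 0" if "j < e" for j using r that by auto
  have "q i \<noteq> q j" if "i < j" "j < e" for i j
  proof -
    have "(\<Prod>i<j. q j - q i) \<noteq> 0" using r that(2) by auto
    then have "q j - q i \<noteq> 0" using that(1) by simp
    then show ?thesis by auto
  qed
  then have "inj_on q {..<e}"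
    by (intro linorder_inj_onI) auto
  moreover have "(\<Sum>i\<le>e. ?g i * q j ^ i) = 0" if "j < e" for j
  proof -
    have "(\<Sum>i\<le>e. ?g i * q j ^ i) = b * poly (\<Prod>j<e. [:- q j, 1:]) (q j)"
      unfolding poly_altdef degree_prod_linear by (simp add: sum_distrib_left mult_ac)
    also have "poly (\<Prod>j<e. [:- q j, 1:]) (q j) = 0"
      using that by (auto simp: poly_prod)
    finally show ?thesis by simp
  qed
  ultimately have "bezout_res e f ?g = ?g e ^ e * (\<Prod>j<e. \<Sum>i\<le>e. f i * q j ^ i)"
    using f0 nz by (intro bezout_res_distinct_roots) (auto simp: coeff_eq_0 degree_prod_linear)
  then show "bezout_res e f ?g = b ^ e * (\<Prod>j<e. \<Sum>i\<le>e. f i * q j ^ i)"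
    by (simp add: lead_coeff_prod_linear)
qed

lemma coeffs_from_roots:
  fixes g :: "nat \<Rightarrow> complex"
  assumes "\<And>i. i > e \<Longrightarrow> g i = 0" "g e \<noteq> 0"
  obtains q where "\<And>i. g i = g e * poly.coeff (\<Prod>j<e. [:- q j, 1:]) i"
proof -
  define p where "p = (\<Sum>i\<le>e. Polynomial.monom (g i) i)"
  have coeff_p: "poly.coeff p i = g i" for i
    unfolding p_def using assms(1)[of i] by (cases "i \<le> e") (auto simp: coeff_sum)
  have deg: "degree p = e"
    by (rule antisym) (use coeff_p assms in \<open>auto intro: degree_le le_degree\<close>)
  have "p \<noteq> 0" using coeff_p assms(2) by auto
  then obtain A where A: "size A = degree p" "p = Polynomial.smult (lead_coeff p) (\<Prod>x\<in>#A. [:- x, 1:])"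
    using alg_closed_imp_factorization by blast
  obtain xs where xs: "mset xs = A" using ex_mset by blast
  have len: "length xs = e" using A(1) xs deg by auto
  have "(\<Prod>x\<in>#A. [:- x, 1:]) = prod_list (map (\<lambda>x. [:- x, 1:]) xs)"
    unfolding xs[symmetric] by (simp flip: prod_mset_prod_list)
  also have "\<dots> = (\<Prod>j<e. [:- (xs ! j), 1:])"
    using len by (simp add: prod.list_conv_set_nth atLeast0LessThan)
  finally have "p = Polynomial.smult (g e) (\<Prod>j<e. [:- (xs ! j), 1:])"
    using A(2) deg coeff_p by simp
  then have "g i = g e * poly.coeff (\<Prod>j<e. [:- (xs ! j), 1:]) i" for i
    using coeff_p[of i] by simp
  then show ?thesis by (rule that)
qed

lemma bezout_res_eq_0_iff_root:
  fixes f g :: "nat \<Rightarrow> complex"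
  assumes f0: "\<And>i. i > e \<Longrightarrow> f i = 0" and g0: "\<And>i. i > e \<Longrightarrow> g i = 0" and "g e \<noteq> 0"
  shows "bezout_res e f g = 0 \<longleftrightarrow> (\<exists>t. (\<Sum>i\<le>e. f i * t ^ i) = 0 \<and> (\<Sum>i\<le>e. g i * t ^ i) = 0)"
proof -
  obtain q where q: "\<And>i. g i = g e * poly.coeff (\<Prod>j<e. [:- q j, 1:]) i"
    using coeffs_from_roots[of e g, OF g0 \<open>g e \<noteq> 0\<close>] by blast
  have eq: "(\<lambda>i. g e * poly.coeff (\<Prod>j<e. [:- q j, 1:]) i) = g"
    using q by (intro ext) (rule sym)
  have "bezout_res e f (\<lambda>i. g e * poly.coeff (\<Prod>j<e. [:- q j, 1:]) i) =
      g e ^ e * (\<Prod>j<e. \<Sum>i\<le>e. f i * q j ^ i)"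
    by (rule bezout_res_roots) (rule f0)
  then have "bezout_res e f g = g e ^ e * (\<Prod>j<e. \<Sum>i\<le>e. f i * q j ^ i)"
    unfolding eq .
  moreover have "(\<Sum>i\<le>e. g i * t ^ i) = g e * (\<Prod>j<e. t - q j)" for t
  proof -
    have "(\<Sum>i\<le>e. g i * t ^ i) = g e * poly (\<Prod>j<e. [:- q j, 1:]) t"
      unfolding poly_altdef degree_prod_linear sum_distrib_left
      by (subst q) (simp add: mult_ac)
    then show ?thesis by (simp add: poly_prod)
  qed
  ultimately show ?thesis using \<open>g e \<noteq> 0\<close> by auto
qed

text \<open>As soon as one leading coefficient is nonzero, a common zero has x nonzero and y/x is a
  common root; the symmetry of the determinant up to sign lets either form provide that coefficient.
  The remaining case is a common zero at infinity.\<close>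

theorem bezout_res_eq_0_iff:
  fixes f g :: "nat \<Rightarrow> complex"
  assumes f0: "\<And>i. i > e \<Longrightarrow> f i = 0" and g0: "\<And>i. i > e \<Longrightarrow> g i = 0" and "e > 0"
  shows "bezout_res e f g = 0 \<longleftrightarrow> (\<exists>x y. (x \<noteq> 0 \<or> y \<noteq> 0) \<and>
    (\<Sum>i\<le>e. f i * x ^ (e - i) * y ^ i) = 0 \<and> (\<Sum>i\<le>e. g i * x ^ (e - i) * y ^ i) = 0)"
    (is "_ \<longleftrightarrow> (\<exists>x y. ?Z x y)")
proof -
  have at_0: "(\<Sum>i\<le>e. h i * 0 ^ (e - i) * y ^ i) = h e * y ^ e" for h :: "nat \<Rightarrow> complex" and y
  proof -
    have "(\<Sum>i\<le>e. h i * 0 ^ (e - i) * y ^ i) = (\<Sum>i\<le>e. if i = e then h e * y ^ e else 0)"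
      by (rule sum.cong) (auto simp: power_0_left)
    then show ?thesis by simp
  qed
  have dehom: "(\<Sum>i\<le>e. h i * x ^ (e - i) * y ^ i) = x ^ e * (\<Sum>i\<le>e. h i * (y / x) ^ i)"
    if "x \<noteq> 0" for h :: "nat \<Rightarrow> complex" and x y
    unfolding sum_distrib_left
    by (rule sum.cong) (use that in \<open>auto simp: power_diff power_divide\<close>)
  have *: "(\<exists>x y. ?Z x y) \<longleftrightarrow> (\<exists>t. (\<Sum>i\<le>e. f i * t ^ i) = 0 \<and> (\<Sum>i\<le>e. g i * t ^ i) = 0)"
    if nz: "f e \<noteq> 0 \<or> g e \<noteq> 0"
  proof
    assume "\<exists>x y. ?Z x y"
    then obtain x y where Z: "?Z x y" by blast
    show "\<exists>t. (\<Sum>i\<le>e. f i * t ^ i) = 0 \<and> (\<Sum>i\<le>e. g i * t ^ i) = 0"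
    proof (cases "x = 0")
      case True
      with Z nz show ?thesis by (auto simp: at_0)
    next
      case False
      with Z dehom[OF False] show ?thesis by (intro exI[of _ "y / x"]) auto
    qed
  next
    assume "\<exists>t. (\<Sum>i\<le>e. f i * t ^ i) = 0 \<and> (\<Sum>i\<le>e. g i * t ^ i) = 0"
    then obtain t where "(\<Sum>i\<le>e. f i * t ^ i) = 0" "(\<Sum>i\<le>e. g i * t ^ i) = 0" by blast
    then have "?Z 1 t" by simp
    then show "\<exists>x y. ?Z x y" by blast
  qed
  consider "g e \<noteq> 0" | "f e \<noteq> 0" | "f e = 0" "g e = 0" by blast
  then show ?thesis
  proof cases
    case 1
    then show ?thesis using * bezout_res_eq_0_iff_root[OF f0 g0] by simp
  next
    case 2
    then show ?thesis
      using * bezout_res_eq_0_iff_root[OF g0 f0] bezout_res_swap[of e f g] by auto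
  next
    \<comment> \<open>The common zero is (0, 1). Every product in the last row of the matrix
      contains a coefficient of index at least e, so the row vanishes.\<close>
    case 3
    then have zero: "f i = 0" "g i = 0" if "i \<ge> e" for i
      using that f0[of i] g0[of i] by (cases "i = e"; simp)+
    have row: "bezout_mat e f g $$ (e - 1, j) = 0" if "j < e" for j
    proof -
      have "f (e - 1 + (e - j - l)) = 0" "g (e - 1 + (e - j - l)) = 0" if "l < e - j" for l
        using that by (auto intro!: zero)
      then show ?thesis using that \<open>e > 0\<close> by (simp add: bezout_mat_def)
    qed
    have "bezout_res e f g = 0"
      unfolding bezout_res_def
      by (subst laplace_expansion_row[OF bezout_mat_carrier, of "e - 1"])
         (use \<open>e > 0\<close> row in \<open>auto intro!: sum.neutral\<close>)
    moreover have "?Z 0 1" using at_0[of f 1] at_0[of g 1] 3 by simp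
    ultimately show ?thesis by blast
  qed
qed


section \<open>Polynomials vanishing only where the resultant vanishes\<close>

text \<open>The variable type may contain more than the coefficients of the two forms. This matters
  for irreducibility, where a factor of the resultant could a priori involve any variable.\<close>

locale binary_form_vars =
  fixes e :: nat and fv gv :: "nat \<Rightarrow> 'v"
  assumes e_pos: "e > 0"
    and inj_fv: "inj_on fv {..e}" and inj_gv: "inj_on gv {..e}"
    and disjoint: "fv ` {..e} \<inter> gv ` {..e} = {}"
begin

definition fc :: "('v \<Rightarrow> complex) \<Rightarrow> nat \<Rightarrow> complex" where
  "fc x i = (if i \<le> e then x (fv i) else 0)"

definition gc :: "('v \<Rightarrow> complex) \<Rightarrow> nat \<Rightarrow> complex" where
  "gc x i = (if i \<le> e then x (gv i) else 0)"

definition res :: "('v \<Rightarrow> complex) \<Rightarrow> complex" where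
  "res x = bezout_res e (fc x) (gc x)"

text \<open>
  In \<open>from_roots x\<close> the second form has leading coefficient \<open>x (gv e)\<close> and the roots
  \<open>x (gv 0), \<dots>, x (gv (e - 1))\<close>: the variables of its lower coefficients are reused for the roots.
\<close>

definition from_roots :: "('v \<Rightarrow> complex) \<Rightarrow> 'v \<Rightarrow> complex" where
  "from_roots x v = (if v \<in> gv ` {..e}
     then x (gv e) * poly.coeff (\<Prod>j<e. [:- x (gv j), 1:]) (the_inv_into {..e} gv v) else x v)"

definition root_val :: "('v \<Rightarrow> complex) \<Rightarrow> nat \<Rightarrow> complex" where
  "root_val x j = (\<Sum>i\<le>e. fc x i * x (gv j) ^ i)"

text \<open>Changing the constant coefficient moves the values of the first form at all roots of the
  second by the same amount, so along this line the resultant splits into linear factors in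
  t.\<close>

definition shift :: "complex \<Rightarrow> ('v \<Rightarrow> complex) \<Rightarrow> 'v \<Rightarrow> complex" where
  "shift t x = x(fv 0 := x (fv 0) + t)"

definition swap :: "nat \<Rightarrow> ('v \<Rightarrow> complex) \<Rightarrow> 'v \<Rightarrow> complex" where
  "swap j x = x \<circ> Transposition.transpose (gv 0) (gv j)"

lemma fv_neq_gv: "i \<le> e \<Longrightarrow> j \<le> e \<Longrightarrow> fv i \<noteq> gv j"
  using disjoint by blast

lemma fv_eq_iff: "i \<le> e \<Longrightarrow> j \<le> e \<Longrightarrow> fv i = fv j \<longleftrightarrow> i = j"
  using inj_fv by (auto dest: inj_onD)

lemma gv_eq_iff: "i \<le> e \<Longrightarrow> j \<le> e \<Longrightarrow> gv i = gv j \<longleftrightarrow> i = j"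
  using inj_gv by (auto dest: inj_onD)

lemma polyfun_fc [pf_intros]: "polyfun (\<lambda>x. fc x i)"
  unfolding fc_def by (intro pf_intros)

lemma polyfun_gc [pf_intros]: "polyfun (\<lambda>x. gc x i)"
  unfolding gc_def by (intro pf_intros)

lemma polyfun_res [pf_intros]: "polyfun res"
  unfolding res_def[abs_def] by (intro pf_intros)

lemma polyfun_root_val [pf_intros]: "polyfun (\<lambda>x. root_val x j)"
  unfolding root_val_def by (intro pf_intros)

lemma polyfun_from_roots: "polyfun (\<lambda>x. from_roots x v)"
  unfolding from_roots_def by (intro pf_intros)

lemma polyfun_swap: "polyfun (\<lambda>x. swap j x v)"
  unfolding swap_def by (auto intro: pf_intros)

lemma polyfun_shift: "polyfun (\<lambda>x. shift t x v)"
  unfolding shift_def fun_upd_apply by (intro pf_intros)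

lemma fc_from_roots [simp]: "fc (from_roots x) = fc x"
  using fv_neq_gv by (fastforce simp: fc_def from_roots_def fun_eq_iff)

lemma gc_from_roots: "gc (from_roots x) = (\<lambda>i. x (gv e) * poly.coeff (\<Prod>j<e. [:- x (gv j), 1:]) i)"
  by (rule ext)
     (auto simp: gc_def from_roots_def the_inv_into_f_f[OF inj_gv] coeff_eq_0 degree_prod_linear)

lemma res_from_roots: "res (from_roots x) = x (gv e) ^ e * (\<Prod>j<e. root_val x j)"
  unfolding res_def gc_from_roots root_val_def fc_from_roots
  by (rule bezout_res_roots) (simp add: fc_def)

lemma from_roots_surj:
  assumes "y (gv e) \<noteq> 0"
  obtains x where "from_roots x = y" "x (gv e) = y (gv e)"
proof -
  have "gc y e \<noteq> 0" using assms by (simp add: gc_def)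
  then obtain q where q: "\<And>i. gc y i = gc y e * poly.coeff (\<Prod>j<e. [:- q j, 1:]) i"
    using coeffs_from_roots[of e "gc y"] by (auto simp: gc_def)
  define x where "x v = (if v \<in> gv ` {..<e} then q (the_inv_into {..e} gv v) else y v)" for v
  have x_gv: "x (gv j) = q j" if "j < e" for j
    using that by (auto simp: x_def the_inv_into_f_f[OF inj_gv])
  have x_e: "x (gv e) = y (gv e)"
    using gv_eq_iff by (force simp: x_def)
  have x_other: "x v = y v" if "v \<notin> gv ` {..e}" for v
    using that by (auto simp: x_def)
  have "from_roots x v = y v" for v
  proof (cases "v \<in> gv ` {..e}")
    case True
    then obtain i where i: "i \<le> e" "v = gv i" by auto
    have "gc (from_roots x) i = gc y i"
      unfolding gc_from_roots x_e using q[of i] by (simp add: x_gv gc_def cong: prod.cong_simp)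
    with i show ?thesis by (simp add: gc_def)
  next
    case False
    then show ?thesis by (simp add: from_roots_def x_other)
  qed
  then show ?thesis using that[of x] x_e by blast
qed

lemma shift_gv [simp]: "i \<le> e \<Longrightarrow> shift t x (gv i) = x (gv i)"
  using fv_neq_gv[of 0 i] by (simp add: shift_def)

lemma root_val_shift [simp]: "j \<le> e \<Longrightarrow> root_val (shift t x) j = root_val x j + t"
proof -
  assume "j \<le> e"
  have "root_val (shift t x) j = (\<Sum>i\<le>e. fc x i * x (gv j) ^ i + (if i = 0 then t else 0))"
    unfolding root_val_def using fv_eq_iff[of _ 0] \<open>j \<le> e\<close>
    by (intro sum.cong) (auto simp: fc_def shift_gv, auto simp: shift_def)
  then show ?thesis by (simp add: root_val_def sum.distrib)
qed

lemma swap_fv [simp]: "i \<le> e \<Longrightarrow> j \<le> e \<Longrightarrow> swap j x (fv i) = x (fv i)"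
  using fv_neq_gv[of i 0] fv_neq_gv[of i j] by (simp add: swap_def Transposition.transpose_def)

lemma swap_gv: "i \<le> e \<Longrightarrow> j \<le> e \<Longrightarrow> swap j x (gv i) = x (gv (Transposition.transpose 0 j i))"
  using gv_eq_iff[of i 0] gv_eq_iff[of i j] by (auto simp: swap_def Transposition.transpose_def)

lemma swap_swap [simp]: "swap j (swap j x) = x"
  by (simp add: swap_def fun_eq_iff)

lemma root_val_swap: "j \<le> e \<Longrightarrow> root_val (swap j x) 0 = root_val x j"
  by (auto simp: root_val_def swap_gv fc_def intro!: sum.cong)

lemma shift_swap: "j \<le> e \<Longrightarrow> shift t (swap j x) = swap j (shift t x)"
  using fv_neq_gv[of 0 0] fv_neq_gv[of 0 j]
  by (auto simp: shift_def swap_def fun_eq_iff Transposition.transpose_def)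

text \<open>The coefficients are symmetric in the roots, so an exchange of roots is invisible to any
  function of the coefficients. This carries what is known at root 0 to every other root.\<close>

lemma from_roots_swap:
  assumes "j < e"
  shows "from_roots (swap j x) = from_roots x"
proof
  fix v
  have "(\<Prod>i<e. [:- swap j x (gv i), 1:]) = (\<Prod>i<e. [:- x (gv (Transposition.transpose 0 j i)), 1:])"
    using assms by (intro prod.cong) (auto simp: swap_gv)
  also have "\<dots> = (\<Prod>i<e. [:- x (gv i), 1:])"
    by (rule prod.reindex_bij_witness[of _ "Transposition.transpose 0 j" "Transposition.transpose 0 j"])
       (use assms in \<open>auto simp: Transposition.transpose_def\<close>)
  finally have prod_eq: "(\<Prod>i<e. [:- swap j x (gv i), 1:]) = (\<Prod>i<e. [:- x (gv i), 1:])" .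
  have "swap j x (gv e) = x (gv e)"
    using assms by (simp add: swap_gv Transposition.transpose_def)
  moreover have "swap j x v = x v" if "v \<notin> gv ` {..e}"
  proof -
    have "v \<noteq> gv 0" "v \<noteq> gv j" using that assms by auto
    then show ?thesis by (simp add: swap_def Transposition.transpose_def)
  qed
  ultimately show "from_roots (swap j x) v = from_roots x v"
    unfolding from_roots_def prod_eq by auto
qed

lemma root_val_separated: "i < j \<Longrightarrow> j < e \<Longrightarrow> \<exists>x. root_val x j - root_val x i \<noteq> 0"
proof -
  assume ij: "i < j" "j < e"
  define x where "x v = (if v = fv 1 then 1 else if v \<in> gv ` {..e}
    then of_nat (the_inv_into {..e} gv v) else (0::complex))" for v
  have gv: "x (gv l) = of_nat l" if "l \<le> e" for l
    using that fv_neq_gv[of 1 l] ij by (auto simp: x_def the_inv_into_f_f[OF inj_gv])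
  have fv: "fc x l = (if l = 1 then 1 else 0)" for l
    using ij fv_eq_iff[of l 1] fv_neq_gv[of l] by (auto simp: x_def fc_def)
  have "root_val x l = of_nat l" if "l \<le> e" for l
  proof -
    have "root_val x l = (\<Sum>i\<le>e. if i = 1 then of_nat l else 0)"
      unfolding root_val_def by (rule sum.cong) (auto simp: fv gv that)
    also have "\<dots> = of_nat l" using ij by simp
    finally show ?thesis .
  qed
  with ij have "root_val x j - root_val x i \<noteq> 0" by simp
  then show ?thesis by blast
qed

text \<open>The pair X^e and 1 shows that the resultant does not vanish on the hyperplane where the
  leading coefficient of the second form is 0. It later excludes spurious powers of that
  coefficient.\<close>

lemma res_nonzero_lead_0:
  obtains y where "y (gv e) = 0" "res y \<noteq> 0"
proof -
  define y where "y v = (if v = fv e \<or> v = gv 0 then 1 else (0::complex))" for v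
  have fc: "fc y l = (if l = e then 1 else 0)" for l
    using fv_eq_iff[of l e] fv_neq_gv[of l 0] by (auto simp: y_def fc_def)
  have gc: "gc y = (\<lambda>l. if l = 0 then 1 else 0)"
    using gv_eq_iff[of _ 0] fv_neq_gv[of e] by (fastforce simp: y_def gc_def fun_eq_iff)
  have "res y = (- 1) ^ e * bezout_res e (gc y) (fc y)"
    unfolding res_def by (rule bezout_res_swap)
  also have "bezout_res e (gc y) (fc y) = 1"
    unfolding gc by (subst bezout_res_1) (auto simp: fc)
  finally have "res y \<noteq> 0" by simp
  moreover have "y (gv e) = 0"
    using gc e_pos by (metis gc_def le_refl less_numeral_extra(3))
  ultimately show ?thesis using that by blast
qed

lemma res_from_roots_nonzero:
  obtains x where "res (from_roots x) \<noteq> 0" "x (gv e) \<noteq> 0"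
proof -
  define x where "x v = (if v = fv 0 \<or> v = gv e then 1 else (0::complex))" for v
  have fc: "fc x l = (if l = 0 then 1 else 0)" for l
    using fv_eq_iff[of l 0] fv_neq_gv[of l e] by (auto simp: x_def fc_def)
  have "root_val x j = 1" for j
  proof -
    have "root_val x j = (\<Sum>i\<le>e. if i = 0 then 1 else 0)"
      unfolding root_val_def by (rule sum.cong) (auto simp: fc)
    then show ?thesis by simp
  qed
  moreover have "x (gv e) = 1" by (simp add: x_def)
  ultimately show ?thesis using that[of x] by (simp add: res_from_roots)
qed

text \<open>
  By symmetry in the roots of the second form, all values \<open>root_val x j\<close> divide such a polynomial
  to the same order \<open>k\<close>.
\<close>

lemma factor_from_roots:
  assumes P: "polyfun P" and nz: "\<And>x. res x \<noteq> 0 \<Longrightarrow> P x \<noteq> 0"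
  shows "\<exists>C k. polyfun C \<and>
    (\<forall>x s. P (from_roots (shift s x)) = C x * (\<Prod>j<e. (root_val x j + s) ^ k))"
proof -
  define P' where "P' x = P (from_roots x)" for x
  have P': "polyfun P'"
    unfolding P'_def by (rule polyfun_compose[OF P polyfun_from_roots])
  have P'_swap: "P' (swap j x) = P' x" if "j < e" for j x
    using that by (simp add: P'_def from_roots_swap)
  \<comment> \<open>This value of the constant coefficient makes the first form vanish at root 0.
    Expanding about it gives the powers of \<open>root_val x 0\<close> in \<open>P'\<close>.\<close>
  have "polyfun (\<lambda>x. x (fv 0) - root_val x 0)"
    by (intro pf_intros)
  from polyfun_expand[OF P' this, of "fv 0"] obtain h n where
    h: "\<And>i. polyfun (h i)" "\<And>i x. i > n \<Longrightarrow> h i x = 0"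
    and h_exp: "\<And>x t. P' (x(fv 0 := x (fv 0) - root_val x 0 + t)) = (\<Sum>i\<le>n. h i x * t ^ i)"
    by blast
  \<comment> \<open>A second expansion, in the shift itself; one of its coefficients will be the
    cofactor \<open>C\<close>.\<close>
  from polyfun_expand[OF P' polyfun_var, of "fv 0" "fv 0"] obtain c m where
    c: "\<And>i. polyfun (c i)" "\<And>i x. i > m \<Longrightarrow> c i x = 0"
    and "\<And>x t. P' (x(fv 0 := x (fv 0) + t)) = (\<Sum>i\<le>m. c i x * t ^ i)"
    by blast
  then have c_exp: "P' (shift t x) = (\<Sum>i\<le>m. c i x * t ^ i)" for x t
    by (simp add: shift_def)
  \<comment> \<open>The exchange of roots 0 and j leaves \<open>P'\<close> unchanged, so the
    expansion at root 0 serves at root j as well. This is why all exponents coincide.\<close>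
  have P'_shift: "P' (shift s x) = (\<Sum>i\<le>n. h i (swap j x) * (root_val x j + s) ^ i)" if "j < e" for j s x
  proof -
    have "P' (shift s x) = P' (shift s (swap j x))"
      using that by (simp add: P'_swap shift_swap)
    also have "shift s (swap j x) =
        (swap j x)(fv 0 := swap j x (fv 0) - root_val (swap j x) 0 + (root_val x j + s))"
      using that by (simp add: shift_def root_val_swap)
    finally show ?thesis by (simp only: h_exp)
  qed
  have "\<exists>i x. h i x \<noteq> 0"
  proof (rule ccontr)
    assume "\<not> ?thesis"
    then have "P' (shift 0 x) = 0" for x
      using P'_shift[of 0 0 x] e_pos by simp
    moreover have "shift 0 x = x" for x by (simp add: shift_def)
    moreover obtain x where "res (from_roots x) \<noteq> 0" by (rule res_from_roots_nonzero)
    ultimately show False using nz by (metis P'_def)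
  qed
  \<comment> \<open>The generic order to which \<open>P'\<close> vanishes where the first form
    vanishes at root 0.\<close>
  define k where "k = (LEAST i. \<exists>x. h i x \<noteq> 0)"
  have k: "\<exists>x. h k x \<noteq> 0"
    unfolding k_def by (rule LeastI_ex) fact
  have below_k: "h i x = 0" if "i < k" for i x
    using not_less_Least[of i "\<lambda>i. \<exists>x. h i x \<noteq> 0"] that by (auto simp: k_def)
  have "k \<le> n" using k h(2) by (meson not_le)
  \<comment> \<open>The generic locus: nonzero leading coefficient, order exactly k at every root,
    and distinct values of the first form at the roots, so that linear factors of different roots do
    not merge.\<close>
  define G where "G x = (x (gv e) * (\<Prod>j<e. h k (swap j x))) *
    (\<Prod>j<e. \<Prod>i<j. root_val x j - root_val x i)" for x
  have h_swap: "polyfun (\<lambda>x. h k (swap j x))" for j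
    by (rule polyfun_compose[OF h(1) polyfun_swap])
  have G: "polyfun G"
    unfolding G_def by (intro pf_intros h_swap)
  have "\<exists>x. G x \<noteq> 0"
    unfolding G_def
  proof (intro polyfun_mult_nonzero)
    show "\<exists>x. (\<Prod>j<e. h k (swap j x)) \<noteq> 0"
    proof (rule polyfun_prod_nonzero)
      fix j
      from k obtain x where "h k x \<noteq> 0" ..
      then have "h k (swap j (swap j x)) \<noteq> 0" by simp
      then show "\<exists>x. h k (swap j x) \<noteq> 0" by blast
    qed (auto intro: h_swap)
    show "\<exists>x. (\<Prod>j<e. \<Prod>i<j. root_val x j - root_val x i) \<noteq> 0"
      by (intro polyfun_prod_nonzero pf_intros) (auto intro: root_val_separated[simplified])
    show "\<exists>x. x (gv e) \<noteq> (0::complex)"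
      by (rule exI[of _ "\<lambda>_. 1"]) simp
  qed (intro pf_intros h_swap)+
  then obtain y where y: "G y \<noteq> 0" ..
  have generic: "P' (shift s x) = c (e * k) x * (\<Prod>j<e. (root_val x j + s) ^ k)"
    if "G x \<noteq> 0" for x s
  proof -
    have lead: "x (gv e) \<noteq> 0" using that by (auto simp: G_def)
    have hk: "h k (swap j x) \<noteq> 0" if "j < e" for j
      using \<open>G x \<noteq> 0\<close> that by (auto simp: G_def)
    have "root_val x j \<noteq> root_val x i" if "i < j" "j < e" for i j
    proof -
      have "(\<Prod>i<j. root_val x j - root_val x i) \<noteq> 0"
        using \<open>G x \<noteq> 0\<close> that by (auto simp: G_def)
      then have "root_val x j - root_val x i \<noteq> 0" using that by simp
      then show ?thesis by auto
    qed
    then have inj: "inj_on (\<lambda>j. - root_val x j) {..<e}"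
      by (intro linorder_inj_onI) force+
    define U where "U = (\<Sum>i\<le>m. Polynomial.monom (c i x) i)"
    have U: "poly U t = P' (shift t x)" for t
      by (simp add: U_def poly_sum poly_monom c_exp)
    have coeff_U: "poly.coeff U i = c i x" for i
      using c(2)[of i x] by (cases "i \<le> m") (auto simp: U_def coeff_sum)
    have order: "order (- root_val x j) U = k" and U_nz: "U \<noteq> 0" if "j < e" for j
    proof -
      let ?l = "[:- (- root_val x j), 1:]"
      define R where "R = (\<Sum>i = k..n. Polynomial.smult (h i (swap j x)) (?l ^ (i - k)))"
      have R: "poly R (- root_val x j) \<noteq> 0"
      proof -
        have "poly R (- root_val x j) = (\<Sum>i = k..n. if i = k then h i (swap j x) else 0)"
          unfolding R_def poly_sum by (rule sum.cong) auto
        also have "\<dots> = h k (swap j x)" using \<open>k \<le> n\<close> by simp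
        finally show ?thesis using hk[OF that] by simp
      qed
      have U_eq: "U = ?l ^ k * R"
      proof (rule poly_eq_poly_eq_iff[THEN iffD1], rule ext)
        fix t
        have "poly U t = (\<Sum>i\<le>n. h i (swap j x) * (root_val x j + t) ^ i)"
          using that by (simp add: U P'_shift)
        also have "\<dots> = (\<Sum>i = k..n. h i (swap j x) * (root_val x j + t) ^ i)"
          by (rule sum.mono_neutral_right) (auto simp: below_k)
        also have "\<dots> = poly (?l ^ k * R) t"
          unfolding R_def poly_mult poly_sum sum_distrib_left
          by (rule sum.cong) (auto simp flip: power_add)
        finally show "poly U t = poly (?l ^ k * R) t" .
      qed
      from R have "R \<noteq> 0" by auto
      then show "U \<noteq> 0" unfolding U_eq by simp
      then show "order (- root_val x j) U = k"
        unfolding U_eq using R order_power_n_n[of "- root_val x j" k] by (simp add: order_mult order_0I)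
    qed
    \<comment> \<open>A zero of \<open>U\<close> forces a zero of the resultant, and with nonzero
      leading coefficient this means that a shifted root value is 0. So \<open>U\<close> has no
      further linear factors.\<close>
    have U_root: "\<exists>j<e. t = - root_val x j" if "poly U t = 0" for t
    proof -
      have "res (from_roots (shift t x)) = 0"
        using that nz by (auto simp: U P'_def)
      then have "(\<Prod>j<e. root_val x j + t) = 0"
        using lead by (simp add: res_from_roots)
      then show ?thesis by (auto simp: add_eq_0_iff)
    qed
    have "U = Polynomial.smult (lead_coeff U) (\<Prod>z | poly U z = 0. [:- z, 1:] ^ order z U)"
      by (simp add: complex_poly_decompose)
    also have "(\<Prod>z | poly U z = 0. [:- z, 1:] ^ order z U) =
        (\<Prod>z\<in>(\<lambda>j. - root_val x j) ` {..<e}. [:- z, 1:] ^ order z U)"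
      by (rule prod.mono_neutral_left) (auto simp: order_0I dest: U_root)
    also have "\<dots> = (\<Prod>j<e. [:root_val x j, 1:] ^ k)"
      by (subst prod.reindex[OF inj]) (auto simp: order intro!: prod.cong)
    finally have U_eq: "U = Polynomial.smult (lead_coeff U) (\<Prod>j<e. [:root_val x j, 1:] ^ k)" .
    \<comment> \<open>The degree is the same at every generic point, so the leading coefficient,
      chosen point by point so far, is the single polynomial function \<open>c (e * k)\<close>. That
      makes the density argument applicable.\<close>
    have "degree U = degree (\<Prod>j<e. [:root_val x j, 1:] ^ k)"
      using U_nz[OF e_pos] by (subst U_eq) simp
    also have "\<dots> = e * k"
      by (subst degree_prod_eq_sum_degree) (auto simp: degree_linear_power)
    finally have "lead_coeff U = c (e * k) x"
      by (simp add: coeff_U)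
    then have "poly U s = c (e * k) x * (\<Prod>j<e. (root_val x j + s) ^ k)"
      using arg_cong[OF U_eq, of "\<lambda>p. poly p s"] by (simp only: poly_smult poly_prod poly_power) simp
    then show ?thesis by (simp add: U)
  qed
  have "P' (shift s x) = c (e * k) x * (\<Prod>j<e. (root_val x j + s) ^ k)" for x s
  proof (rule polyfun_density[where r = G and y = y and p = "\<lambda>x. P' (shift s x)"
        and q = "\<lambda>x. c (e * k) x * (\<Prod>j<e. (root_val x j + s) ^ k)"])
    show "polyfun (\<lambda>x. P' (shift s x))"
      by (rule polyfun_compose[OF P' polyfun_shift])
    show "polyfun (\<lambda>x. c (e * k) x * (\<Prod>j<e. (root_val x j + s) ^ k))"
      by (intro pf_intros c)
  qed (fact G y generic)+
  with c(1) show ?thesis unfolding P'_def by blast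
qed

theorem nonvanishing_imp_power_of_res:
  assumes P: "polyfun P" and nz: "\<And>x. res x \<noteq> 0 \<Longrightarrow> P x \<noteq> 0"
  shows "\<exists>c k. c \<noteq> 0 \<and> (\<forall>x. P x = c * res x ^ k)"
proof -
  obtain C k where C: "polyfun C"
    and P_roots: "\<And>x s. P (from_roots (shift s x)) = C x * (\<Prod>j<e. (root_val x j + s) ^ k)"
    using factor_from_roots[OF P nz] by blast
  have "C x \<noteq> 0" if "x (gv e) \<noteq> 0" for x
  proof -
    \<comment> \<open>\<open>C\<close> does not depend on the shift, so any shift that keeps all
      root values away from 0 may be used to see that \<open>C x\<close> is nonzero.\<close>
    have "\<exists>s. s \<notin> (\<lambda>j. - root_val x j) ` {..<e}"
      by (rule ex_new_if_finite) (simp_all add: infinite_UNIV_char_0)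
    then obtain s where s: "\<And>j. j < e \<Longrightarrow> root_val x j + s \<noteq> 0"
      by (force simp: add_eq_0_iff)
    then have "res (from_roots (shift s x)) \<noteq> 0"
      using that by (simp add: res_from_roots)
    then have "P (from_roots (shift s x)) \<noteq> 0" by (rule nz)
    then show ?thesis by (simp add: P_roots)
  qed
  from polyfun_nonvanishing_off_hyperplane[OF C this] obtain c N where
    "c \<noteq> 0" and C_eq: "\<And>x. x (gv e) \<noteq> 0 \<Longrightarrow> C x = c * x (gv e) ^ N"
    by blast
  \<comment> \<open>The extra power of the leading coefficient completes the product of the root
    values to a power of the resultant.\<close>
  have off: "P y * y (gv e) ^ (e * k) = c * y (gv e) ^ N * res y ^ k" if "y (gv e) \<noteq> 0" for y
  proof -
    obtain x where x: "from_roots x = y" "x (gv e) = y (gv e)"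
      using from_roots_surj[of y, OF \<open>y (gv e) \<noteq> 0\<close>] by blast
    have "shift 0 x = x" by (simp add: shift_def)
    then have "P y = c * y (gv e) ^ N * (\<Prod>j<e. root_val x j) ^ k"
      using P_roots[of 0 x] C_eq[of x] x that by (simp add: prod_power_distrib)
    moreover have "res y = y (gv e) ^ e * (\<Prod>j<e. root_val x j)"
      using res_from_roots[of x] x by simp
    ultimately show ?thesis by (simp add: power_mult_distrib power_mult)
  qed
  \<comment> \<open>Moving only the leading coefficient through 0, start from a point where the
    resultant, and hence \<open>P\<close>, is nonzero at t = 0. The identity \<open>off\<close> then
    leaves no room for different powers of t on its two sides.\<close>
  have "N = e * k"
  proof -
    obtain y where y: "y (gv e) = 0" "res y \<noteq> 0" by (rule res_nonzero_lead_0)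
    obtain u where u: "\<And>t. P (y(gv e := t)) = poly u t"
      using polyfun_upd_curve[OF P] by blast
    obtain w where w: "\<And>t. res (y(gv e := t)) = poly w t"
      using polyfun_upd_curve[OF polyfun_res] by blast
    have y0: "y(gv e := 0) = y" using y by auto
    have uw: "poly u 0 \<noteq> 0" "poly w 0 \<noteq> 0"
      using u[of 0] w[of 0] y nz[of y] y0 by auto
    have eq: "poly u t * t ^ (e * k) = c * t ^ N * poly w t ^ k" if "t \<noteq> 0" for t
      using off[of "y(gv e := t)"] that by (simp add: u w)
    consider "N < e * k" | "N = e * k" | "e * k < N" by linarith
    then show ?thesis
    proof cases
      case 1
      have "u * Polynomial.monom 1 (e * k - N) = Polynomial.smult c (w ^ k)"
      proof (rule poly_eq_if_eventually_eq[of "[:0, 1:]"])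
        fix t :: complex assume "poly [:0, 1:] t \<noteq> 0"
        then have "t \<noteq> 0" by simp
        moreover have "t ^ (e * k) = t ^ N * t ^ (e * k - N)"
          using 1 by (simp flip: power_add)
        ultimately show "poly (u * Polynomial.monom 1 (e * k - N)) t = poly (Polynomial.smult c (w ^ k)) t"
          using eq[of t] by (simp add: poly_monom)
      qed simp
      from arg_cong[OF this, of "\<lambda>p. poly p 0"] show ?thesis
        using 1 uw \<open>c \<noteq> 0\<close> by (simp add: poly_monom power_0_left)
    next
      case 3
      have "u = Polynomial.smult c (Polynomial.monom 1 (N - e * k) * w ^ k)"
      proof (rule poly_eq_if_eventually_eq[of "[:0, 1:]"])
        fix t :: complex assume "poly [:0, 1:] t \<noteq> 0"
        then have "t \<noteq> 0" by simp
        moreover have "t ^ N = t ^ (e * k) * t ^ (N - e * k)"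
          using 3 by (simp flip: power_add)
        ultimately show "poly u t = poly (Polynomial.smult c (Polynomial.monom 1 (N - e * k) * w ^ k)) t"
          using eq[of t] by (simp add: poly_monom)
      qed simp
      from arg_cong[OF this, of "\<lambda>p. poly p 0"] show ?thesis
        using 3 uw by (simp add: poly_monom)
    qed
  qed
  have "P x = c * res x ^ k" for x
  proof (rule polyfun_density[where r = "\<lambda>x. x (gv e)" and y = "\<lambda>_. 1" and p = P
        and q = "\<lambda>x. c * res x ^ k"])
    fix x assume "x (gv e) \<noteq> (0::complex)"
    then show "P x = c * res x ^ k"
      using off[of x] \<open>N = e * k\<close> by simp
  qed (use P in \<open>auto intro!: pf_intros\<close>)
  with \<open>c \<noteq> 0\<close> show ?thesis by blast
qed

end


section \<open>The resultant of two binary forms\<close>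

declare One_nat_def [simp del]

section \<open>Variables occurring in a Bezout determinant\<close>

lemma mvars_add: "mvars (p + q) \<subseteq> mvars p \<union> mvars (q :: ('v, 'a::comm_ring_1) mpoly)"
  using Poly_Mapping.keys_add[of p q] by (auto simp: mvars_def)

lemma mvars_uminus [simp]: "mvars (- p) = mvars (p :: ('v, 'a::comm_ring_1) mpoly)"
  by (simp add: mvars_def)

lemma mvars_diff: "mvars (p - q) \<subseteq> mvars p \<union> mvars (q :: ('v, 'a::comm_ring_1) mpoly)"
  using mvars_add[of p "- q"] by simp

lemma mvars_mult: "mvars (p * q) \<subseteq> mvars p \<union> mvars (q :: ('v, 'a::comm_ring_1) mpoly)"
proof
  fix v assume "v \<in> mvars (p * q)"
  then obtain \<kappa> where "\<kappa> \<in> Poly_Mapping.keys (p * q)" "v \<in> Poly_Mapping.keys \<kappa>"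
    by (auto simp: mvars_def)
  moreover from this obtain \<mu> \<nu> where "\<kappa> = \<mu> + \<nu>" "\<mu> \<in> Poly_Mapping.keys p" "\<nu> \<in> Poly_Mapping.keys q"
    using keys_mult[of p q] by blast
  ultimately show "v \<in> mvars p \<union> mvars q"
    using Poly_Mapping.keys_add[of \<mu> \<nu>] by (auto simp: mvars_def)
qed

lemma mvars_0 [simp]: "mvars 0 = {}"
  by (simp add: mvars_def)

lemma mvars_1 [simp]: "mvars (1 :: ('v, 'a::comm_ring_1) mpoly) = {}"
  by (simp add: mvars_def)

lemma mvars_mvar [simp]: "mvars (mvar v :: ('v, 'a::comm_ring_1) mpoly) = {v}"
  by (simp add: mvars_def mvar_def)

lemma mvars_sum:
  "(\<And>a. a \<in> A \<Longrightarrow> mvars (f a) \<subseteq> V) \<Longrightarrow> mvars (sum f A :: ('v, 'a::comm_ring_1) mpoly) \<subseteq> V"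
proof (induction A rule: infinite_finite_induct)
  case (insert a A)
  then show ?case using mvars_add[of "f a" "sum f A"] by simp blast
qed auto

lemma mvars_prod:
  "(\<And>a. a \<in> A \<Longrightarrow> mvars (f a) \<subseteq> V) \<Longrightarrow> mvars (prod f A :: ('v, 'a::comm_ring_1) mpoly) \<subseteq> V"
proof (induction A rule: infinite_finite_induct)
  case (insert a A)
  then show ?case using mvars_mult[of "f a" "prod f A"] by simp blast
qed auto

lemma mvars_bezout_res:
  assumes "\<And>i. mvars (f i) \<subseteq> V" "\<And>i. mvars (g i :: ('v, 'a::comm_ring_1) mpoly) \<subseteq> V"
  shows "mvars (bezout_res e f g) \<subseteq> V"
  unfolding bezout_res_def det_def'[OF bezout_mat_carrier]
proof (intro mvars_sum)
  fix p assume "p \<in> {p. p permutes {0..<e}}"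
  have mult: "mvars (a * b) \<subseteq> V" if "mvars a \<subseteq> V" "mvars b \<subseteq> V" for a b :: "('v, 'a) mpoly"
    using mvars_mult[of a b] that by blast
  have diff: "mvars (a - b) \<subseteq> V" if "mvars a \<subseteq> V" "mvars b \<subseteq> V" for a b :: "('v, 'a) mpoly"
    using mvars_diff[of a b] that by blast
  have "mvars (\<Prod>i = 0..<e. bezout_mat e f g $$ (i, p i)) \<subseteq> V"
  proof (rule mvars_prod)
    fix i assume "i \<in> {0..<e}"
    moreover from this \<open>p \<in> _\<close> have "p i < e"
      by (auto simp: permutes_in_image[of p "{0..<e}"])
    ultimately have "bezout_mat e f g $$ (i, p i) = (\<Sum>l<e - p i.
        f l * g (i + (e - p i - l)) - f (i + (e - p i - l)) * g l)"
      by (simp add: bezout_mat_def)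
    also have "mvars \<dots> \<subseteq> V"
      by (intro mvars_sum diff mult assms)
    finally show "mvars (bezout_mat e f g $$ (i, p i)) \<subseteq> V" .
  qed
  moreover have "mvars (signof p :: ('v, 'a) mpoly) \<subseteq> V"
    by (simp add: sign_def)
  ultimately show "mvars (signof p * (\<Prod>i = 0..<e. bezout_mat e f g $$ (i, p i))) \<subseteq> V"
    by (intro mult)
qed

section \<open>Binary forms and their coefficients\<close>

definition binary_monom :: "nat \<Rightarrow> nat \<Rightarrow> nat \<Rightarrow>\<^sub>0 nat" where
  "binary_monom e i = Poly_Mapping.single 1 (e - i) + Poly_Mapping.single 2 i"

lemma lookup_binary_monom:
  "Poly_Mapping.lookup (binary_monom e i) v = (if v = 1 then e - i else if v = 2 then i else 0)"
  by (auto simp: binary_monom_def lookup_add lookup_single)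

lemma inj_binary_monom: "inj (binary_monom e)"
  by (rule injI) (metis lookup_binary_monom numeral_eq_one_iff semiring_norm(85))

lemma monomials_2: "monomials 2 e = binary_monom e ` {..e}"
proof (intro equalityI subsetI)
  have two: "{1..2::nat} = {1, 2}" by auto
  {
    fix \<mu> assume "\<mu> \<in> monomials 2 e"
    then have keys: "Poly_Mapping.keys \<mu> \<subseteq> {1, 2}"
      and deg: "(\<Sum>i\<in>Poly_Mapping.keys \<mu>. Poly_Mapping.lookup \<mu> i) = e"
      by (auto simp: monomials_def two)
    have "(\<Sum>i\<in>Poly_Mapping.keys \<mu>. Poly_Mapping.lookup \<mu> i) = (\<Sum>i\<in>{1, 2}. Poly_Mapping.lookup \<mu> i)"
      by (rule sum.mono_neutral_left) (use keys in \<open>auto simp: in_keys_iff\<close>)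
    with deg have sum: "Poly_Mapping.lookup \<mu> 1 + Poly_Mapping.lookup \<mu> 2 = e" by simp
    have "\<mu> = binary_monom e (Poly_Mapping.lookup \<mu> 2)"
    proof (rule poly_mapping_eqI)
      fix v
      show "Poly_Mapping.lookup \<mu> v = Poly_Mapping.lookup (binary_monom e (Poly_Mapping.lookup \<mu> 2)) v"
        using keys sum by (auto simp: lookup_binary_monom in_keys_iff)
    qed
    then show "\<mu> \<in> binary_monom e ` {..e}" using sum by auto
  next
    fix \<mu> assume "\<mu> \<in> binary_monom e ` {..e}"
    then obtain i where i: "i \<le> e" "\<mu> = binary_monom e i" by auto
    have keys: "Poly_Mapping.keys \<mu> \<subseteq> {1, 2}"
      by (auto simp: i in_keys_iff lookup_binary_monom split: if_splits)
    have "(\<Sum>i\<in>Poly_Mapping.keys \<mu>. Poly_Mapping.lookup \<mu> i) = (\<Sum>i\<in>{1, 2}. Poly_Mapping.lookup \<mu> i)"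
      by (rule sum.mono_neutral_left) (use keys in \<open>auto simp: in_keys_iff\<close>)
    with keys i show "\<mu> \<in> monomials 2 e"
      by (simp add: monomials_def two lookup_binary_monom)
  }
qed

lemma monom_eval_binary: "monom_eval x (binary_monom e i) = x 1 ^ (e - i) * x 2 ^ i"
proof -
  have "monom_eval x (binary_monom e i) = (\<Prod>v\<in>{1, 2}. x v ^ Poly_Mapping.lookup (binary_monom e i) v)"
    by (rule monom_eval_superset) (auto simp: in_keys_iff lookup_binary_monom split: if_splits)
  then show ?thesis by (simp add: lookup_binary_monom)
qed

lemma meval_binary_form:
  assumes "f \<in> forms 2 e"
  shows "meval x f = (\<Sum>i\<le>e. Poly_Mapping.lookup f (binary_monom e i) * x 1 ^ (e - i) * x 2 ^ i)"
proof -
  have "meval x f = (\<Sum>\<mu>\<in>binary_monom e ` {..e}. Poly_Mapping.lookup f \<mu> * monom_eval x \<mu>)"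
    by (rule meval_superset) (use assms in \<open>auto simp: forms_def monomials_2\<close>)
  also have "\<dots> = (\<Sum>i\<le>e. Poly_Mapping.lookup f (binary_monom e i) * monom_eval x (binary_monom e i))"
    by (subst sum.reindex) (auto intro: inj_on_subset[OF inj_binary_monom])
  finally show ?thesis by (simp add: monom_eval_binary mult.assoc)
qed

lemma mvar_power: "mvar v ^ n = (Poly_Mapping.single (Poly_Mapping.single v n) 1 :: ('v, 'a::comm_semiring_1) mpoly)"
  by (induction n) (auto simp: mvar_def mult_single single_add[symmetric] plus_1_eq_Suc)

lemma dvd_1_if_meval_const:
  fixes a :: "('v, complex) mpoly"
  assumes "c \<noteq> 0" "\<And>x. meval x a = c"
  shows "a dvd 1"
proof
  show "1 = a * mconst (1 / c)"
    by (rule meval_inject) (use assms in \<open>simp add: meval_mult\<close>)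
qed

lemma binary_form_vars_monom:
  assumes "e > 0"
  shows "binary_form_vars e (\<lambda>i. (1 :: nat, binary_monom e i)) (\<lambda>i. (2, binary_monom e i))"
  using assms inj_binary_monom[of e] by unfold_locales (auto simp: inj_on_def)

section \<open>Existence and uniqueness of the resultant in two variables\<close>

definition res_mpoly :: "nat \<Rightarrow> (nat \<times> (nat \<Rightarrow>\<^sub>0 nat), complex) mpoly" where
  "res_mpoly e = bezout_res e (\<lambda>i. if i \<le> e then mvar (1, binary_monom e i) else 0)
                              (\<lambda>i. if i \<le> e then mvar (2, binary_monom e i) else 0)"

context
  fixes e :: nat
  assumes e: "e > 0"
begin

interpretation binary_form_vars e "\<lambda>i. (1 :: nat, binary_monom e i)" "\<lambda>i. (2, binary_monom e i)"
  by (rule binary_form_vars_monom) (rule e)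

lemma meval_res_mpoly: "meval x (res_mpoly e) = res x"
proof -
  interpret hom: comm_ring_hom "meval x :: (nat \<times> (nat \<Rightarrow>\<^sub>0 nat), complex) mpoly \<Rightarrow> complex"
    by (rule comm_ring_hom_meval)
  show ?thesis
    unfolding res_mpoly_def hom.bezout_res_hom res_def
    by (intro arg_cong2[of _ _ _ _ "bezout_res e"]) (auto simp: fc_def gc_def)
qed

lemma res_form_coeffs_eq_0_iff:
  assumes "\<And>i. i \<in> {1..2} \<Longrightarrow> F i \<in> forms 2 e"
  shows "res (form_coeffs F) = 0 \<longleftrightarrow> common_zero 2 F"
proof -
  have two: "{1..2::nat} = {1, 2}" by auto
  have F: "F 1 \<in> forms 2 e" "F 2 \<in> forms 2 e" using assms by auto
  have ev: "meval x (F 1) = (\<Sum>i\<le>e. fc (form_coeffs F) i * x 1 ^ (e - i) * x 2 ^ i)"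
      "meval x (F 2) = (\<Sum>i\<le>e. gc (form_coeffs F) i * x 1 ^ (e - i) * x 2 ^ i)" for x
    by (simp_all add: meval_binary_form[OF F(1)] meval_binary_form[OF F(2)] fc_def gc_def form_coeffs_def)
  have "res (form_coeffs F) = 0 \<longleftrightarrow> (\<exists>x y. (x \<noteq> 0 \<or> y \<noteq> 0) \<and>
      (\<Sum>i\<le>e. fc (form_coeffs F) i * x ^ (e - i) * y ^ i) = 0 \<and>
      (\<Sum>i\<le>e. gc (form_coeffs F) i * x ^ (e - i) * y ^ i) = 0)"
    unfolding res_def by (rule bezout_res_eq_0_iff) (auto simp: fc_def gc_def e)
  also have "\<dots> \<longleftrightarrow> common_zero 2 F"
    unfolding common_zero_def two
  proof
    assume "\<exists>x y. (x \<noteq> 0 \<or> y \<noteq> 0) \<and>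
      (\<Sum>i\<le>e. fc (form_coeffs F) i * x ^ (e - i) * y ^ i) = 0 \<and>
      (\<Sum>i\<le>e. gc (form_coeffs F) i * x ^ (e - i) * y ^ i) = 0"
    then obtain x y where "x \<noteq> 0 \<or> y \<noteq> 0"
      "(\<Sum>i\<le>e. fc (form_coeffs F) i * x ^ (e - i) * y ^ i) = 0"
      "(\<Sum>i\<le>e. gc (form_coeffs F) i * x ^ (e - i) * y ^ i) = 0"
      by blast
    then show "\<exists>x. (\<exists>i\<in>{1, 2}. x i \<noteq> 0) \<and> (\<forall>i\<in>{1, 2}. meval x (F i) = 0)"
      by (intro exI[of _ "\<lambda>v. if v = 1 then x else y"]) (simp add: ev)
  next
    assume "\<exists>x. (\<exists>i\<in>{1, 2}. x i \<noteq> 0) \<and> (\<forall>i\<in>{1, 2}. meval x (F i) = 0)"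
    then obtain x where "x 1 \<noteq> 0 \<or> x 2 \<noteq> 0" "meval x (F 1) = 0" "meval x (F 2) = 0"
      by auto
    then show "\<exists>x y. (x \<noteq> 0 \<or> y \<noteq> 0) \<and>
      (\<Sum>i\<le>e. fc (form_coeffs F) i * x ^ (e - i) * y ^ i) = 0 \<and>
      (\<Sum>i\<le>e. gc (form_coeffs F) i * x ^ (e - i) * y ^ i) = 0"
      unfolding ev by (intro exI[of _ "x 1"] exI[of _ "x 2"]) simp
  qed
  finally show ?thesis .
qed

lemma res_normalized: "res (form_coeffs (\<lambda>i. mvar i ^ e)) = 1"
proof -
  have s1: "Poly_Mapping.single 1 e = binary_monom e 0" and s2: "Poly_Mapping.single 2 e = binary_monom e e"
    by (simp_all add: binary_monom_def)
  have "fc (form_coeffs (\<lambda>i. mvar i ^ e)) = (\<lambda>i. if i = 0 then 1 else 0)"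
    using inj_binary_monom[of e]
    by (auto simp: fc_def form_coeffs_def mvar_power s1[simplified] lookup_single when_def inj_eq fun_eq_iff)
  moreover have "gc (form_coeffs (\<lambda>i. mvar i ^ e)) i = (if i = e then 1 else 0)" for i
    using inj_binary_monom[of e]
    by (auto simp: gc_def form_coeffs_def mvar_power s2 lookup_single when_def inj_eq)
  ultimately show ?thesis
    by (simp add: res_def bezout_res_1)
qed

text \<open>A value that is not a root of unity, taken at 2 x_1^e and x_2^e; its powers are
  distinct, which allows exponents of the resultant to be compared.\<close>

lemma res_eq_2_power: "\<exists>x. res x = 2 ^ e"
proof -
  define x where "x v = (if v = (1::nat, binary_monom e 0) then 2 else if v = (2, binary_monom e e) then 1 else (0::complex))" for v
  have "fc x = (\<lambda>i. 2 * (if i = 0 then 1 else 0))"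
    using inj_binary_monom[of e] by (auto simp: fc_def x_def fun_eq_iff inj_eq)
  moreover have "gc x = (\<lambda>i. 1 * (if i = e then 1 else 0))"
    using inj_binary_monom[of e] by (auto simp: gc_def x_def fun_eq_iff inj_eq)
  ultimately have "res x = (2 * 1) ^ e * bezout_res e (\<lambda>i. if i = 0 then 1 else 0) (\<lambda>i. if i = e then 1 else 0)"
    unfolding res_def by (simp only: bezout_res_scale)
  then show ?thesis by (auto simp: bezout_res_1)
qed

lemma res_eq_0_ex: "\<exists>x. res x = 0"
proof -
  have "fc (\<lambda>_. 0) = (\<lambda>_. 0)" "gc (\<lambda>_. 0) = (\<lambda>_. 0)"
    by (auto simp: fc_def gc_def)
  then have "res (\<lambda>_. 0) = 0"
    using bezout_res_eq_0_iff[of e "\<lambda>_. 0" "\<lambda>_. 0"] e by (auto simp: res_def)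
  then show ?thesis by (rule exI[of _ "\<lambda>_. 0"])
qed

lemma res_mpoly_not_unit: "\<not> res_mpoly e dvd 1"
proof
  assume "res_mpoly e dvd 1"
  then obtain q where "1 = res_mpoly e * q" ..
  then have "1 = res x * meval x q" for x
    by (metis meval_1 meval_mult meval_res_mpoly)
  with res_eq_0_ex show False by (metis mult_zero_left zero_neq_one)
qed

text \<open>Both factors are nonzero wherever the resultant is, so each is a constant times a power
  of it. The exponents add up to 1, hence one of the factors is constant.\<close>

lemma irreducible_res_mpoly: "irreducible (res_mpoly e)"
proof (rule irreducibleI)
  show "res_mpoly e \<noteq> 0"
    using meval_res_mpoly res_normalized by (metis meval_0 zero_neq_one)
  show "\<not> res_mpoly e dvd 1" by (rule res_mpoly_not_unit)
  fix a b assume ab: "res_mpoly e = a * b"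
  then have res_ab: "res x = meval x a * meval x b" for x
    by (metis meval_mult meval_res_mpoly)
  obtain c k where c: "c \<noteq> 0" "\<And>x. meval x a = c * res x ^ k"
    using nonvanishing_imp_power_of_res[OF polyfun_meval, of a] res_ab by (metis mult_zero_left)
  obtain d l where d: "d \<noteq> 0" "\<And>x. meval x b = d * res x ^ l"
    using nonvanishing_imp_power_of_res[OF polyfun_meval, of b] res_ab by (metis mult_zero_right)
  have res_pow: "res x = c * d * res x ^ (k + l)" for x
    using res_ab[of x] c d by (simp add: power_add mult_ac)
  from res_pow[of "form_coeffs (\<lambda>i. mvar i ^ e)"] have "c * d = 1"
    by (simp add: res_normalized)
  obtain x where "res x = 2 ^ e" using res_eq_2_power ..
  with res_pow[of x] have "(2::complex) ^ e = (2 ^ e) ^ (k + l)"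
    by (simp add: \<open>c * d = 1\<close>)
  from arg_cong[OF this, of cmod] have "(2::real) ^ e = 2 ^ (e * (k + l))"
    by (simp only: norm_power norm_numeral power_mult)
  then have "e = e * (k + l)" by (subst (asm) power_inject_exp) auto
  then have "k = 0 \<or> l = 0" using e by auto
  then show "a dvd 1 \<or> b dvd 1"
    using c d dvd_1_if_meval_const[of c a] dvd_1_if_meval_const[of d b] by auto
qed

lemma is_resultant_res_mpoly: "is_resultant 2 e (res_mpoly e)"
  unfolding is_resultant_def
proof (intro conjI allI impI)
  show "mvars (res_mpoly e) \<subseteq> {1..2} \<times> monomials 2 e"
    unfolding res_mpoly_def by (rule mvars_bezout_res) (auto simp: monomials_2)
  fix F :: "nat \<Rightarrow> (nat, complex) mpoly"
  assume "\<forall>i\<in>{1..2}. F i \<in> forms 2 e"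
  then show "meval (form_coeffs F) (res_mpoly e) = 0 \<longleftrightarrow> common_zero 2 F"
    unfolding meval_res_mpoly by (intro res_form_coeffs_eq_0_iff) auto
qed (simp_all add: irreducible_res_mpoly meval_res_mpoly res_normalized)

lemma is_resultant_unique:
  assumes "is_resultant 2 e R"
  shows "R = res_mpoly e"
proof -
  have vars: "mvars R \<subseteq> {1..2} \<times> monomials 2 e" and irr: "irreducible R"
    and zero: "\<And>F. (\<forall>i\<in>{1..2}. F i \<in> forms 2 e) \<Longrightarrow> meval (form_coeffs F) R = 0 \<longleftrightarrow> common_zero 2 F"
    and norm: "meval (form_coeffs (\<lambda>i. mvar i ^ e)) R = 1"
    using assms by (auto simp: is_resultant_def)
  have R_nz: "meval x R \<noteq> 0" if "res x \<noteq> 0" for x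
  proof -
    define F where "F i = (\<Sum>\<mu>\<in>monomials 2 e. Poly_Mapping.single \<mu> (x (i, \<mu>)))" for i
    have fin: "finite (monomials 2 e)" by (simp add: monomials_2)
    have coeff: "Poly_Mapping.lookup (F i) \<mu> = (if \<mu> \<in> monomials 2 e then x (i, \<mu>) else 0)" for i \<mu>
      unfolding F_def lookup_sum lookup_single when_def using fin by (simp add: sum.delta')
    have F: "F i \<in> forms 2 e" for i
      by (auto simp: forms_def in_keys_iff coeff split: if_splits)
    have "fc (form_coeffs F) = fc x" "gc (form_coeffs F) = gc x"
      by (auto simp: fc_def gc_def form_coeffs_def coeff monomials_2)
    then have "res (form_coeffs F) = res x"
      by (simp add: res_def)
    with that have "\<not> common_zero 2 F"
      using res_form_coeffs_eq_0_iff[of F] F by simp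
    then have "meval (form_coeffs F) R \<noteq> 0" using zero F by blast
    also have "meval (form_coeffs F) R = meval x R"
      by (rule meval_cong) (use vars in \<open>auto simp: form_coeffs_def coeff\<close>)
    finally show ?thesis .
  qed
  obtain c k where c: "c \<noteq> 0" "\<And>x. meval x R = c * res x ^ k"
    using nonvanishing_imp_power_of_res[OF polyfun_meval R_nz] by blast
  have "k \<noteq> 0"
  proof
    assume "k = 0"
    then have "R dvd 1" using c by (intro dvd_1_if_meval_const[of c]) auto
    with irr show False by (simp add: irreducible_def)
  qed
  then obtain l where k: "k = Suc l" by (cases k) auto
  \<comment> \<open>The determinant is not a unit, so irreducibility of \<open>R\<close> makes the
    cofactor a unit. The determinant has zeros, so no power of it is left in the cofactor; the
    normalization then fixes the constant.\<close>
  have R_eq: "R = mconst c * res_mpoly e ^ l * res_mpoly e"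
    by (rule meval_inject) (simp add: c k meval_mult meval_power meval_res_mpoly mult_ac)
  with irr have "mconst c * res_mpoly e ^ l dvd 1"
    using res_mpoly_not_unit irreducibleD by blast
  then obtain q where q: "1 = mconst c * res_mpoly e ^ l * q" ..
  have "l = 0"
  proof (rule ccontr)
    assume "l \<noteq> 0"
    obtain x where "res x = 0" using res_eq_0_ex ..
    with arg_cong[OF q, of "meval x"] \<open>l \<noteq> 0\<close> show False
      by (simp add: meval_mult meval_power meval_res_mpoly power_0_left)
  qed
  moreover have "c = 1"
    using norm c(2) by (simp add: res_normalized[simplified])
  ultimately show ?thesis using R_eq by (simp add: mconst_def)
qed

lemma resultant_poly_2: "resultant_poly 2 e = res_mpoly e"
  unfolding resultant_poly_def using is_resultant_res_mpoly is_resultant_unique by blast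

theorem Res_2:
  "Res 2 e F = bezout_res e
     (\<lambda>i. if i \<le> e then Poly_Mapping.lookup (F 1) (binary_monom e i) else 0)
     (\<lambda>i. if i \<le> e then Poly_Mapping.lookup (F 2) (binary_monom e i) else 0)"
  unfolding Res_def resultant_poly_2 meval_res_mpoly res_def fc_def[abs_def] gc_def[abs_def]
  by (simp add: form_coeffs_def cong: if_cong)

end

section \<open>Traces of two-dimensional tensors\<close>

lemma lookup_mconst_mult [simp]:
  "Poly_Mapping.lookup (mconst c * p) \<mu> = c * Poly_Mapping.lookup p (\<mu> :: 'v \<Rightarrow>\<^sub>0 nat)"
proof -
  have "mconst c * p = mconst c *
      (\<Sum>\<nu>\<in>Poly_Mapping.keys p. Poly_Mapping.single \<nu> (Poly_Mapping.lookup p \<nu>))"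
    by (simp add: poly_mapping_sum_monomials)
  also have "\<dots> = (\<Sum>\<nu>\<in>Poly_Mapping.keys p. Poly_Mapping.single \<nu> (c * Poly_Mapping.lookup p \<nu>))"
    by (simp add: mconst_def sum_distrib_left mult_single)
  finally show ?thesis
    by (simp add: lookup_sum lookup_single when_def in_keys_iff)
qed

lemma mconst_mult: "mconst a * mconst b = (mconst (a * b) :: ('v, 'a::comm_semiring_1) mpoly)"
  by (simp add: mconst_def mult_single)

lemma mconst_sum: "mconst (sum f A) = (\<Sum>a\<in>A. mconst (f a) :: ('v, 'a::comm_semiring_1) mpoly)"
  by (induction A rule: infinite_finite_induct) (auto simp: mconst_def single_add)

lemma lookup_mult_mvar:
  fixes p :: "('v, 'a::comm_semiring_1) mpoly"
  shows "Poly_Mapping.lookup (p * mvar v) \<mu> =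
    (if Poly_Mapping.lookup \<mu> v = 0 then 0
     else Poly_Mapping.lookup p (\<mu> - Poly_Mapping.single v 1))"
proof -
  have "p * mvar v =
      (\<Sum>\<nu>\<in>Poly_Mapping.keys p. Poly_Mapping.single \<nu> (Poly_Mapping.lookup p \<nu>)) * mvar v"
    by (simp add: poly_mapping_sum_monomials)
  also have "\<dots> = (\<Sum>\<nu>\<in>Poly_Mapping.keys p.
      Poly_Mapping.single (\<nu> + Poly_Mapping.single v 1) (Poly_Mapping.lookup p \<nu>))"
    by (simp add: mvar_def sum_distrib_right mult_single)
  finally have *: "Poly_Mapping.lookup (p * mvar v) \<mu> = (\<Sum>\<nu>\<in>Poly_Mapping.keys p.
      if \<nu> + Poly_Mapping.single v 1 = \<mu> then Poly_Mapping.lookup p \<nu> else 0)"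
    by (simp add: lookup_sum lookup_single when_def)
  show ?thesis
  proof (cases "Poly_Mapping.lookup \<mu> v = 0")
    case True
    then have "\<nu> + Poly_Mapping.single v 1 \<noteq> \<mu>" for \<nu>
      by (auto simp: lookup_add)
    with True * show ?thesis by simp
  next
    case False
    have "\<mu> - Poly_Mapping.single v 1 + Poly_Mapping.single v 1 = \<mu>"
      by (rule poly_mapping_eqI)
         (use False in \<open>auto simp: lookup_add lookup_minus lookup_single when_def One_nat_def\<close>)
    then have "\<nu> + Poly_Mapping.single v 1 = \<mu> \<longleftrightarrow> \<nu> = \<mu> - Poly_Mapping.single v 1" for \<nu>
      by (metis add_diff_cancel_right')
    with False * show ?thesis by (simp add: in_keys_iff)
  qed
qed

lemma lookup_mpderiv:
  "Poly_Mapping.lookup (mpderiv v p) \<mu> =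
    of_nat (Suc (Poly_Mapping.lookup \<mu> v)) * Poly_Mapping.lookup p (\<mu> + Poly_Mapping.single v 1)"
proof -
  have "Poly_Mapping.lookup (mpderiv v p) \<mu> = (\<Sum>\<nu>\<in>Poly_Mapping.keys p.
      if \<nu> - Poly_Mapping.single v 1 = \<mu> then of_nat (Poly_Mapping.lookup \<nu> v) * Poly_Mapping.lookup p \<nu> else 0)"
    by (simp add: mpderiv_def lookup_sum lookup_single when_def)
  also have "\<dots> = (\<Sum>\<nu>\<in>Poly_Mapping.keys p. if \<nu> = \<mu> + Poly_Mapping.single v 1
      then of_nat (Poly_Mapping.lookup \<nu> v) * Poly_Mapping.lookup p \<nu> else 0)"
  proof (rule sum.cong)
    fix \<nu>
    have "\<nu> = \<mu> + Poly_Mapping.single v 1" if "\<nu> - Poly_Mapping.single v 1 = \<mu>" "Poly_Mapping.lookup \<nu> v \<noteq> 0"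
      unfolding that(1)[symmetric]
      by (rule poly_mapping_eqI)
         (use that(2) in \<open>auto simp: lookup_add lookup_minus lookup_single when_def One_nat_def\<close>)
    note * = this
    show "(if \<nu> - Poly_Mapping.single v 1 = \<mu> then of_nat (Poly_Mapping.lookup \<nu> v) * Poly_Mapping.lookup p \<nu> else 0) =
        (if \<nu> = \<mu> + Poly_Mapping.single v 1 then of_nat (Poly_Mapping.lookup \<nu> v) * Poly_Mapping.lookup p \<nu> else 0)"
    proof (cases "\<nu> = \<mu> + Poly_Mapping.single v 1")
      case True
      then show ?thesis by (simp only: add_diff_cancel_right' refl if_True)
    next
      case False
      with * have "\<nu> - Poly_Mapping.single v 1 \<noteq> \<mu> \<or> Poly_Mapping.lookup \<nu> v = 0" by blast
      with False show ?thesis by (elim disjE) (simp_all only: of_nat_0 mult_zero_left if_False if_cancel)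
    qed
  qed simp
  also have "\<dots> = of_nat (Suc (Poly_Mapping.lookup \<mu> v)) * Poly_Mapping.lookup p (\<mu> + Poly_Mapping.single v 1)"
    by (simp add: in_keys_iff lookup_add add.commute)
  finally show ?thesis .
qed

lemma mpderiv_sum: "mpderiv v (sum f A) = (\<Sum>a\<in>A. mpderiv v (f a))"
  by (rule poly_mapping_eqI) (simp add: lookup_mpderiv lookup_sum sum_distrib_left)

lemma mpderiv_mconst_mult: "mpderiv v (mconst c * p) = mconst c * mpderiv v p"
  by (rule poly_mapping_eqI) (simp add: lookup_mpderiv mult.left_commute)

lemma mpderiv_commute: "mpderiv v (mpderiv w p) = mpderiv w (mpderiv v p)"
  by (cases "v = w")
     (auto intro!: poly_mapping_eqI simp: lookup_mpderiv lookup_add lookup_single mult_ac add_ac)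

lemma mpderiv_funpow_sum: "(mpderiv v ^^ n) (sum f A) = (\<Sum>a\<in>A. (mpderiv v ^^ n) (f a))"
  by (induction n) (auto simp: mpderiv_sum)

lemma mpderiv_funpow_mconst_mult: "(mpderiv v ^^ n) (mconst c * p) = mconst c * (mpderiv v ^^ n) p"
  by (induction n) (auto simp: mpderiv_mconst_mult)

lemma mpderiv_funpow_commute1: "(mpderiv v ^^ n) (mpderiv w p) = mpderiv w ((mpderiv v ^^ n) p)"
  by (induction n) (auto simp: mpderiv_commute[of v w])

lemma mpderiv_funpow_commute:
  "(mpderiv v ^^ n) ((mpderiv w ^^ k) p) = (mpderiv w ^^ k) ((mpderiv v ^^ n) p)"
  by (induction k) (auto simp: mpderiv_funpow_commute1)

text \<open>The factorial on the left stands in for a falling factorial on the right. At an exponent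
  0, the only case needed later, it disappears.\<close>

lemma lookup_mpderiv_funpow:
  fixes p :: "('v, complex) mpoly"
  shows "fact (Poly_Mapping.lookup \<mu> v) * Poly_Mapping.lookup ((mpderiv v ^^ n) p) \<mu> =
    fact (Poly_Mapping.lookup \<mu> v + n) * Poly_Mapping.lookup p (\<mu> + Poly_Mapping.single v n)"
proof (induction n arbitrary: \<mu>)
  case (Suc n)
  have "fact (Poly_Mapping.lookup \<mu> v) * Poly_Mapping.lookup ((mpderiv v ^^ Suc n) p) \<mu> =
      fact (Suc (Poly_Mapping.lookup \<mu> v)) *
      Poly_Mapping.lookup ((mpderiv v ^^ n) p) (\<mu> + Poly_Mapping.single v 1)"
    by (simp add: lookup_mpderiv fact_Suc mult_ac)
  also have "\<dots> = fact (Suc (Poly_Mapping.lookup \<mu> v + n)) *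
      Poly_Mapping.lookup p (\<mu> + Poly_Mapping.single v (Suc n))"
    using Suc.IH[of "\<mu> + Poly_Mapping.single v 1"]
    by (simp add: lookup_add add.assoc single_add[symmetric] plus_1_eq_Suc
        Suc_eq_plus1[symmetric] del: fact_Suc)
  finally show ?case by (simp only: add_Suc_right)
qed auto

lemma sum_antidiagonal:
  fixes a b F :: "nat \<Rightarrow> 'a::comm_ring_1"
  assumes "\<And>i. i > m \<Longrightarrow> a i = 0" "\<And>j. j > n \<Longrightarrow> b j = 0"
  shows "(\<Sum>i\<le>m. \<Sum>j\<le>n. a i * b j * F (i + j)) = (\<Sum>r\<le>m + n. (\<Sum>i\<le>r. a i * b (r - i)) * F r)"
proof -
  have "(\<Sum>i\<le>m. \<Sum>j\<le>n. a i * b j * F (i + j)) = (\<Sum>(i, j)\<in>{..m} \<times> {..n}. a i * b j * F (i + j))"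
    by (simp add: sum.cartesian_product)
  also have "\<dots> = (\<Sum>(i, j)\<in>{(i, j). i + j \<le> m + n}. a i * b j * F (i + j))"
  proof (rule sum.mono_neutral_left)
    have "{(i, j). i + j \<le> m + n} \<subseteq> {..m + n} \<times> {..m + n}" by auto
    then show "finite {(i, j). i + j \<le> m + n}"
      by (rule finite_subset) simp
    show "\<forall>x\<in>{(i, j). i + j \<le> m + n} - {..m} \<times> {..n}. (case x of (i, j) \<Rightarrow> a i * b j * F (i + j)) = 0"
    proof
      fix x assume "x \<in> {(i, j). i + j \<le> m + n} - {..m} \<times> {..n}"
      then obtain i j where "x = (i, j)" "i > m \<or> j > n" by (cases x) auto
      then show "(case x of (i, j) \<Rightarrow> a i * b j * F (i + j)) = 0"
        using assms by auto
    qed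
  qed auto
  also have "\<dots> = (\<Sum>r\<le>m + n. \<Sum>i\<le>r. a i * b (r - i) * F (i + (r - i)))"
    by (rule sum.triangle_reindex_eq)
  also have "\<dots> = (\<Sum>r\<le>m + n. (\<Sum>i\<le>r. a i * b (r - i)) * F r)"
    by (auto simp: sum_distrib_right intro!: sum.cong)
  finally show ?thesis .
qed

text \<open>\<open>G\<close> is the homogenization of \<Gamma> to degree e with the two commuting
  derivatives in place of the variables, so composing operators multiplies polynomials.\<close>

lemma differential_operator_power:
  fixes \<Gamma> :: "complex poly" and G :: "('v, complex) mpoly \<Rightarrow> ('v, complex) mpoly"
  assumes deg: "degree \<Gamma> \<le> e"
    and G: "\<And>p. G p = (\<Sum>c\<le>e. mconst (poly.coeff \<Gamma> c) * (mpderiv v ^^ (e - c)) ((mpderiv w ^^ c) p))"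
  shows "(G ^^ k) p = (\<Sum>s\<le>e * k. mconst (poly.coeff (\<Gamma> ^ k) s) *
    (mpderiv v ^^ (e * k - s)) ((mpderiv w ^^ s) p))"
proof (induction k)
  case 0
  show ?case by (simp add: mconst_def)
next
  case (Suc k)
  have deg_k: "degree (\<Gamma> ^ k) \<le> e * k"
    using order_trans[OF degree_power_le mult_le_mono1[OF deg]] .
  define F where "F r = (mpderiv v ^^ (e + e * k - r)) ((mpderiv w ^^ r) p)" for r
  have F: "(mpderiv v ^^ (e - c)) ((mpderiv w ^^ c) ((mpderiv v ^^ (e * k - s)) ((mpderiv w ^^ s) p))) = F (c + s)"
    if "c \<le> e" "s \<le> e * k" for c s
  proof -
    have "(mpderiv w ^^ c) ((mpderiv v ^^ (e * k - s)) ((mpderiv w ^^ s) p)) =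
        (mpderiv v ^^ (e * k - s)) ((mpderiv w ^^ (c + s)) p)"
      by (simp add: mpderiv_funpow_commute[where v = w and n = c and w = v] funpow_add)
    moreover have "(e - c) + (e * k - s) = e + e * k - (c + s)" using that by simp
    ultimately show ?thesis
      unfolding F_def by (metis comp_apply funpow_add)
  qed
  have "(G ^^ Suc k) p = (\<Sum>c\<le>e. \<Sum>s\<le>e * k.
      mconst (poly.coeff \<Gamma> c) * mconst (poly.coeff (\<Gamma> ^ k) s) * F (c + s))"
    using F by (simp add: G Suc.IH mpderiv_funpow_sum mpderiv_funpow_mconst_mult sum_distrib_left mult.assoc)
  also have "\<dots> = (\<Sum>r\<le>e + e * k.
      (\<Sum>c\<le>r. mconst (poly.coeff \<Gamma> c) * mconst (poly.coeff (\<Gamma> ^ k) (r - c))) * F r)"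
  proof (rule sum_antidiagonal)
    show "mconst (poly.coeff \<Gamma> i) = 0" if "i > e" for i
      using that deg by (simp add: coeff_eq_0 mconst_def)
    show "mconst (poly.coeff (\<Gamma> ^ k) i) = 0" if "i > e * k" for i
      using that deg_k by (simp add: coeff_eq_0 mconst_def)
  qed
  also have "\<dots> = (\<Sum>r\<le>e + e * k. mconst (poly.coeff (\<Gamma> ^ Suc k) r) * F r)"
    by (simp add: mconst_mult mconst_sum[symmetric] coeff_mult)
  finally show ?case by (simp add: F_def)
qed

section \<open>Powers of the generic matrix and walks on two vertices\<close>

definition mono4 :: "nat \<Rightarrow> nat \<Rightarrow> nat \<Rightarrow> nat \<Rightarrow> (nat \<times> nat) \<Rightarrow>\<^sub>0 nat" where
  "mono4 p s t q = Poly_Mapping.single (1, 1) p + Poly_Mapping.single (1, 2) s +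
     Poly_Mapping.single (2, 1) t + Poly_Mapping.single (2, 2) q"

lemma lookup_mono4 [simp]:
  "Poly_Mapping.lookup (mono4 p s t q) (1, 1) = p"
  "Poly_Mapping.lookup (mono4 p s t q) (1, 2) = s"
  "Poly_Mapping.lookup (mono4 p s t q) (2, 1) = t"
  "Poly_Mapping.lookup (mono4 p s t q) (2, 2) = q"
  by (simp_all add: mono4_def lookup_add lookup_single)

lemma mono4_diff [simp]:
  "mono4 p s t q - Poly_Mapping.single (1, 1) 1 = mono4 (p - 1) s t q"
  "mono4 p s t q - Poly_Mapping.single (1, 2) 1 = mono4 p (s - 1) t q"
  "mono4 p s t q - Poly_Mapping.single (2, 1) 1 = mono4 p s (t - 1) q"
  "mono4 p s t q - Poly_Mapping.single (2, 2) 1 = mono4 p s t (q - 1)"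
  by (auto intro!: poly_mapping_eqI simp: mono4_def lookup_add lookup_minus lookup_single when_def)

lemma mono4_eq_0: "mono4 p s t q = 0 \<longleftrightarrow> p = 0 \<and> s = 0 \<and> t = 0 \<and> q = 0"
  by (metis lookup_mono4 lookup_zero mono4_def add_0 single_zero)

text \<open>
  The coefficients of the entries of a power of the generic 2 x 2 matrix count the closed and
  open walks on two vertices by the numbers of steps of each of the four types.
\<close>

definition walks_closed :: "nat \<Rightarrow> nat \<Rightarrow> nat \<Rightarrow> nat \<Rightarrow> nat \<Rightarrow> nat" where
  "walks_closed N p s t q = (if s = t \<and> p + s + t + q = N
     then (p + s choose s) * (if s = 0 then (if q = 0 then 1 else 0) else (q + s - 1 choose (s - 1)))
     else 0)"

text \<open>The binomials distribute the p loops at vertex 1 and the q loops at vertex 2 over the t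
  + 1 stays at each. A closed walk with s excursions has s + 1 stays at its base but only s at the
  other vertex, whence the separate case s = 0 in \<open>walks_closed\<close>.\<close>

definition walks_open :: "nat \<Rightarrow> nat \<Rightarrow> nat \<Rightarrow> nat \<Rightarrow> nat \<Rightarrow> nat" where
  "walks_open N p s t q = (if s = Suc t \<and> p + s + t + q = N
     then (p + t choose t) * (q + t choose t) else 0)"

text \<open>Removing the last step, which is a loop at vertex 1 or a step from 2 to 1, leaves a
  closed or an open walk. On the formulas this is Pascal's rule.\<close>

lemma walks_closed_Suc:
  "walks_closed (Suc N) p s t q = (if p = 0 then 0 else walks_closed N (p - 1) s t q) +
    (if t = 0 then 0 else walks_open N p s (t - 1) q)"
proof (cases "s = t \<and> p + s + t + q = Suc N")
  case True
  then have st: "s = t" by simp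
  show ?thesis
  proof (cases s)
    case 0
    with True show ?thesis by (auto simp: walks_closed_def walks_open_def)
  next
    case (Suc r)
    have s: "s = Suc r" and t: "t = Suc r" using Suc st by simp_all
    have "walks_closed (Suc N) p s t q = (p + s choose s) * (q + r choose r)"
      "walks_open N p s (t - 1) q = (p + r choose r) * (q + r choose r)"
      using True by (simp_all add: walks_closed_def walks_open_def s t One_nat_def)
    moreover have "walks_closed N (p - 1) s t q = (p - 1 + s choose s) * (q + r choose r)"
      "(p + s choose s) = (p - 1 + s choose s) + (p + r choose r)" if "p \<noteq> 0"
      using True that by (cases p; simp add: walks_closed_def s t One_nat_def)+
    ultimately show ?thesis using st Suc by (cases "p = 0") (simp_all add: distrib_right)
  qed
next
  case False
  then have "walks_closed (Suc N) p s t q = 0"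
    unfolding walks_closed_def by (rule if_not_P)
  moreover have "walks_closed N (p - 1) s t q = 0" if "p \<noteq> 0"
    unfolding walks_closed_def by (rule if_not_P) (use False that in presburger)
  moreover have "walks_open N p s (t - 1) q = 0" if "t \<noteq> 0"
  proof -
    have "Suc (t - 1) = t" "Suc (p + s + (t - 1) + q) = p + s + t + q" using that by simp_all
    then have "\<not> (s = Suc (t - 1) \<and> p + s + (t - 1) + q = N)" using False by metis
    then show ?thesis unfolding walks_open_def by (rule if_not_P)
  qed
  ultimately show ?thesis by (cases "p = 0"; cases "t = 0") simp_all
qed

lemma walks_open_Suc:
  "walks_open (Suc N) p s t q = (if s = 0 then 0 else walks_closed N p (s - 1) t q) +
    (if q = 0 then 0 else walks_open N p s t (q - 1))"
proof (cases "s = Suc t \<and> p + s + t + q = Suc N")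
  case True
  then have st: "s = Suc t" by simp
  show ?thesis
  proof (cases t)
    case 0
    with True show ?thesis by (auto simp: walks_closed_def walks_open_def)
  next
    case (Suc r)
    have "walks_open (Suc N) p s t q = (p + t choose t) * (q + t choose t)"
      "walks_closed N p (s - 1) t q = (p + t choose t) * (q + r choose r)"
      using True Suc by (simp_all add: walks_closed_def walks_open_def)
    moreover have "walks_open N p s t (q - 1) = (p + t choose t) * (q - 1 + t choose t)"
      "(q + t choose t) = (q + r choose r) + (q - 1 + t choose t)" if "q \<noteq> 0"
      using True Suc that by (cases q; simp add: walks_open_def)+
    ultimately show ?thesis using st Suc by (cases "q = 0") (simp_all add: distrib_left)
  qed
next
  case False
  then have "walks_open (Suc N) p s t q = 0"
    unfolding walks_open_def by (rule if_not_P)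
  moreover have "walks_closed N p (s - 1) t q = 0" if "s \<noteq> 0"
    unfolding walks_closed_def by (rule if_not_P) (use False that in presburger)
  moreover have "walks_open N p s t (q - 1) = 0" if "q \<noteq> 0"
    unfolding walks_open_def by (rule if_not_P) (use False that in presburger)
  ultimately show ?thesis by (cases "s = 0"; cases "q = 0") simp_all
qed

lemma generic_matrix_carrier [simp]: "generic_matrix n \<in> carrier_mat n n"
  by (simp add: generic_matrix_def)

text \<open>Walks from vertex 2 are walks from vertex 1 after exchange of the vertices, which swaps
  p with q and s with t. The four entries need a joint induction because the recursion mixes closed
  and open walks.\<close>

lemma lookup_generic_matrix_pow:
  fixes N
  defines "M \<equiv> generic_matrix 2 ^\<^sub>m N"
  shows "Poly_Mapping.lookup (M $$ (0, 0)) (mono4 p s t q) = of_nat (walks_closed N p s t q)"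
    "Poly_Mapping.lookup (M $$ (0, 1)) (mono4 p s t q) = of_nat (walks_open N p s t q)"
    "Poly_Mapping.lookup (M $$ (1, 0)) (mono4 p s t q) = of_nat (walks_open N q t s p)"
    "Poly_Mapping.lookup (M $$ (1, 1)) (mono4 p s t q) = of_nat (walks_closed N q t s p)"
proof -
  let ?M = "\<lambda>N. generic_matrix 2 ^\<^sub>m N"
  have step: "?M (Suc N) $$ (i, j) = ?M N $$ (i, 0) * mvar (1, j + 1) + ?M N $$ (i, 1) * mvar (2, j + 1)"
    if "i < 2" "j < 2" for i j N
  proof -
    have car: "?M N \<in> carrier_mat 2 2" by (rule pow_carrier_mat) simp
    have "?M (Suc N) $$ (i, j) = (\<Sum>k\<in>{0..<2}. ?M N $$ (i, k) * generic_matrix 2 $$ (k, j))"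
      using that car by (simp add: scalar_prod_def generic_matrix_def)
    also have "{0..<2::nat} = {0, 1}" by auto
    finally show ?thesis using that by (simp add: generic_matrix_def)
  qed
  have "(\<forall>p s t q. Poly_Mapping.lookup (?M N $$ (0, 0)) (mono4 p s t q) = of_nat (walks_closed N p s t q)) \<and>
    (\<forall>p s t q. Poly_Mapping.lookup (?M N $$ (0, 1)) (mono4 p s t q) = of_nat (walks_open N p s t q)) \<and>
    (\<forall>p s t q. Poly_Mapping.lookup (?M N $$ (1, 0)) (mono4 p s t q) = of_nat (walks_open N q t s p)) \<and>
    (\<forall>p s t q. Poly_Mapping.lookup (?M N $$ (1, 1)) (mono4 p s t q) = of_nat (walks_closed N q t s p))"
  proof (induction N)
    case 0
    have "?M 0 $$ (i, j) = (if i = j then 1 else 0)" if "i < 2" "j < 2" for i j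
      using that by (simp add: generic_matrix_def)
    moreover have "Poly_Mapping.lookup 1 (mono4 p s t q) =
        (if p = 0 \<and> s = 0 \<and> t = 0 \<and> q = 0 then 1 else (0::complex))" for p s t q
      by (simp add: lookup_one when_def mono4_eq_0)
    ultimately show ?case
      by (auto simp: walks_closed_def walks_open_def)
  next
    case (Suc N)
    then show ?case
      by (simp add: step lookup_add lookup_mult_mvar walks_closed_Suc walks_open_Suc add_ac del: pow_mat.simps)
  qed
  then show "Poly_Mapping.lookup (M $$ (0, 0)) (mono4 p s t q) = of_nat (walks_closed N p s t q)"
    "Poly_Mapping.lookup (M $$ (0, 1)) (mono4 p s t q) = of_nat (walks_open N p s t q)"
    "Poly_Mapping.lookup (M $$ (1, 0)) (mono4 p s t q) = of_nat (walks_open N q t s p)"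
    "Poly_Mapping.lookup (M $$ (1, 1)) (mono4 p s t q) = of_nat (walks_closed N q t s p)"
    unfolding M_def by blast+
qed

lemma lookup_trace_generic_pow:
  "Poly_Mapping.lookup (mat_trace (generic_matrix 2 ^\<^sub>m N)) (mono4 p s t q) =
    of_nat (walks_closed N p s t q + walks_closed N q t s p)"
proof -
  have "dim_row (generic_matrix 2 ^\<^sub>m N) = 2"
    by (rule carrier_matD(1)[OF pow_carrier_mat]) simp
  moreover have "{..<2::nat} = {0, 1}" by auto
  ultimately show ?thesis
    by (simp add: mat_trace_def lookup_add lookup_generic_matrix_pow)
qed

text \<open>After multiplication by the factorials, the walks based at vertex 1 contribute s a! b!/b
  and those based at vertex 2 contribute s a! b!/a.\<close>

lemma walk_weight:
  assumes "1 \<le> s" "s \<le> a" "s \<le> b"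
  shows "fact (a - s) * fact s * fact s * fact (b - s) *
      of_nat (walks_closed (a + b) (a - s) s s (b - s) + walks_closed (a + b) (b - s) s s (a - s)) /
      (fact a * fact b) = (of_nat (s * (a + b)) / of_nat (a * b) :: complex)"
proof -
  have half: "fact (c - s) * fact s * (of_nat (c - s + s choose s) :: complex) = fact c"
    "fact s * fact (c - s) * (of_nat (c - s + s - 1 choose (s - 1)) :: complex) = of_nat s * fact c / of_nat c"
    if "s \<le> c" for c
  proof -
    show "fact (c - s) * fact s * (of_nat (c - s + s choose s) :: complex) = fact c"
      using that binomial_fact[of s c, where ?'a = complex] by simp
    have "s - 1 \<le> c - 1" "c - 1 - (s - 1) = c - s" using that assms by auto
    moreover have "fact s = of_nat s * (fact (s - 1) :: complex)" "fact c = of_nat c * (fact (c - 1) :: complex)"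
      using assms that by (auto simp: fact_reduce)
    ultimately show "fact s * fact (c - s) * (of_nat (c - s + s - 1 choose (s - 1)) :: complex) = of_nat s * fact c / of_nat c"
      using that assms binomial_fact[of "s - 1" "c - 1", where ?'a = complex] by simp
  qed
  have w: "walks_closed (a + b) (a - s) s s (b - s) = (a - s + s choose s) * (b - s + s - 1 choose (s - 1))"
    "walks_closed (a + b) (b - s) s s (a - s) = (b - s + s choose s) * (a - s + s - 1 choose (s - 1))"
    using assms by (auto simp: walks_closed_def)
  have "fact (a - s) * fact s * fact s * fact (b - s) *
      (of_nat (walks_closed (a + b) (a - s) s s (b - s) + walks_closed (a + b) (b - s) s s (a - s)) :: complex) =
      (fact (a - s) * fact s * of_nat (a - s + s choose s)) *
      (fact s * fact (b - s) * of_nat (b - s + s - 1 choose (s - 1))) +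
      (fact (b - s) * fact s * of_nat (b - s + s choose s)) *
      (fact s * fact (a - s) * of_nat (a - s + s - 1 choose (s - 1)))"
    unfolding w of_nat_add of_nat_mult by (simp only: algebra_simps)
  also have "\<dots> = fact a * (of_nat s * fact b / of_nat b) + fact b * (of_nat s * fact a / of_nat a)"
    using assms by (simp only: half)
  also have "\<dots> / (fact a * fact b) = of_nat (s * (a + b)) / of_nat (a * b)"
    using assms by (simp add: field_simps)
  finally show ?thesis .
qed

section \<open>The operators \<open>g_hat\<close> in dimension two\<close>

lemma multi_indices_finite [simp]: "finite (multi_indices n k)"
  unfolding multi_indices_def
  using finite_lists_length_eq[of "{1..n}" k] by (simp add: conj_commute)

lemma foldr_mpderiv_2:
  fixes i :: nat and p :: "(nat \<times> nat, complex) mpoly"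
  assumes "set is \<subseteq> {1..2}"
  shows "foldr (\<lambda>j. mpderiv (i, j)) is p =
    (mpderiv (i, 1) ^^ count_list is 1) ((mpderiv (i, 2) ^^ count_list is 2) p)"
  using assms
proof (induction "is")
  case (Cons j "is")
  then have "j = 1 \<or> j = 2" by auto
  with Cons show ?case by (auto simp: mpderiv_funpow_commute1 simp flip: Suc_eq_plus1)
qed auto

lemma count_list_1_2: "set is \<subseteq> {1..2::nat} \<Longrightarrow> count_list is 1 + count_list is 2 = length is"
proof (induction "is")
  case (Cons j "is")
  then have "j = 1 \<or> j = 2" by auto
  with Cons show ?case by auto
qed auto

text \<open>This is the first component of T x^(m-1) at x = (1, X), and \<open>beta_poly\<close> is
  the second at (X, 1). The sums over tuples become coefficients of powers of these
  polynomials.\<close>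

definition alpha_poly :: "nat \<Rightarrow> tensor \<Rightarrow> complex poly" where
  "alpha_poly m T = (\<Sum>a\<le>m - 1. Polynomial.monom (alpha m T a) a)"

definition beta_poly :: "nat \<Rightarrow> tensor \<Rightarrow> complex poly" where
  "beta_poly m T = (\<Sum>b\<le>m - 1. Polynomial.monom (beta m T b) b)"

lemma count_le: "is \<in> multi_indices n k \<Longrightarrow> count_list is x \<le> k"
  using count_le_length[of "is" x] by (auto simp: multi_indices_def)

lemma alpha_eq_0: "a > m - 1 \<Longrightarrow> alpha m T a = 0"
  unfolding alpha_def by (rule sum.neutral) (auto dest!: count_le[where x = 2])

lemma beta_eq_0: "b > m - 1 \<Longrightarrow> beta m T b = 0"
  unfolding beta_def by (rule sum.neutral) (auto dest!: count_le[where x = 1])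

lemma coeff_alpha_poly: "poly.coeff (alpha_poly m T) a = alpha m T a"
  using alpha_eq_0[of m a T] by (cases "a \<le> m - 1") (auto simp: alpha_poly_def coeff_sum)

lemma coeff_beta_poly: "poly.coeff (beta_poly m T) b = beta m T b"
  using beta_eq_0[of m b T] by (cases "b \<le> m - 1") (auto simp: beta_poly_def coeff_sum)

lemma degree_alpha_poly: "degree (alpha_poly m T) \<le> m - 1"
  by (rule degree_le) (auto simp: coeff_alpha_poly alpha_eq_0)

lemma degree_beta_poly: "degree (beta_poly m T) \<le> m - 1"
  by (rule degree_le) (auto simp: coeff_beta_poly beta_eq_0)


lemma sum_by_count:
  fixes D :: "nat \<Rightarrow> ('v, complex) mpoly"
  shows "(\<Sum>is\<in>multi_indices n k. mconst (T is) * D (count_list is x)) =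
    (\<Sum>c\<le>k. mconst (\<Sum>is | is \<in> multi_indices n k \<and> count_list is x = c. T is) * D c)"
proof -
  have "(\<Sum>is\<in>multi_indices n k. mconst (T is) * D (count_list is x)) =
      (\<Sum>c\<le>k. \<Sum>is | is \<in> multi_indices n k \<and> count_list is x = c. mconst (T is) * D (count_list is x))"
    by (rule sum.group[symmetric]) (auto simp: count_le)
  also have "\<dots> = (\<Sum>c\<le>k. mconst (\<Sum>is | is \<in> multi_indices n k \<and> count_list is x = c. T is) * D c)"
    by (auto simp: mconst_sum sum_distrib_right intro!: sum.cong)
  finally show ?thesis .
qed

lemma g_hat_1: "g_hat 2 m T 1 p = (\<Sum>c\<le>m - 1. mconst (poly.coeff (alpha_poly m T) c) *
    (mpderiv (1, 1) ^^ (m - 1 - c)) ((mpderiv (1, 2) ^^ c) p))"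
proof -
  have "foldr (\<lambda>j. mpderiv (1, j)) is p =
      (mpderiv (1, 1) ^^ (m - 1 - count_list is 2)) ((mpderiv (1, 2) ^^ count_list is 2) p)"
    if "is \<in> multi_indices 2 (m - 1)" for "is"
  proof -
    have "set is \<subseteq> {1..2}" "count_list is 1 = m - 1 - count_list is 2"
      using that count_list_1_2[of "is"] by (auto simp: multi_indices_def)
    then show ?thesis by (simp add: foldr_mpderiv_2)
  qed
  then have "g_hat 2 m T 1 p = (\<Sum>is\<in>multi_indices 2 (m - 1). mconst (T (1 # is)) *
      (\<lambda>c. (mpderiv (1, 1) ^^ (m - 1 - c)) ((mpderiv (1, 2) ^^ c) p)) (count_list is 2))"
    by (simp add: g_hat_def)
  also note sum_by_count
  finally show ?thesis by (simp add: coeff_alpha_poly alpha_def)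
qed

lemma g_hat_2: "g_hat 2 m T 2 p = (\<Sum>c\<le>m - 1. mconst (poly.coeff (beta_poly m T) c) *
    (mpderiv (2, 2) ^^ (m - 1 - c)) ((mpderiv (2, 1) ^^ c) p))"
proof -
  have "foldr (\<lambda>j. mpderiv (2, j)) is p =
      (mpderiv (2, 2) ^^ (m - 1 - count_list is 1)) ((mpderiv (2, 1) ^^ count_list is 1) p)"
    if "is \<in> multi_indices 2 (m - 1)" for "is"
  proof -
    have "set is \<subseteq> {1..2}" "count_list is 2 = m - 1 - count_list is 1"
      using that count_list_1_2[of "is"] by (auto simp: multi_indices_def)
    then show ?thesis by (simp add: foldr_mpderiv_2 mpderiv_funpow_commute[where v = "(2, 1)" and w = "(2, 2)"])
  qed
  then have "g_hat 2 m T 2 p = (\<Sum>is\<in>multi_indices 2 (m - 1). mconst (T (2 # is)) *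
      (\<lambda>c. (mpderiv (2, 2) ^^ (m - 1 - c)) ((mpderiv (2, 1) ^^ c) p)) (count_list is 1))"
    by (simp add: g_hat_def)
  also note sum_by_count
  finally show ?thesis by (simp add: coeff_beta_poly beta_def)
qed

lemma g_hat_mconst_mult:
  "(g_hat 2 m T 1 ^^ k) (mconst c * p) = mconst c * (g_hat 2 m T 1 ^^ k) p"
  by (induction k)
     (simp_all add: g_hat_1 mpderiv_funpow_mconst_mult sum_distrib_left mult.left_commute)

lemma lookup_mpderiv_funpow_4:
  fixes p :: "(nat \<times> nat, complex) mpoly"
  shows "Poly_Mapping.lookup ((mpderiv (1, 1) ^^ a) ((mpderiv (1, 2) ^^ b)
      ((mpderiv (2, 2) ^^ d) ((mpderiv (2, 1) ^^ c) p)))) 0 =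
    fact a * fact b * fact c * fact d * Poly_Mapping.lookup p (mono4 a b c d)"
proof -
  have "Poly_Mapping.lookup ((mpderiv v ^^ n) q) \<mu> =
      fact n * Poly_Mapping.lookup q (\<mu> + Poly_Mapping.single v n)"
    if "Poly_Mapping.lookup \<mu> v = 0" for v :: "nat \<times> nat" and n \<mu> and q :: "(nat \<times> nat, complex) mpoly"
    using lookup_mpderiv_funpow[of \<mu> v n q] that by simp
  then show ?thesis
    by (simp add: lookup_add lookup_single mono4_def add_ac mult_ac)
qed

text \<open>The constant coefficient after all derivatives picks out one monomial of the trace for
  each pair of exponents s, t. A closed walk crosses equally often in both directions, so only s = t
  survives and the double sum collapses.\<close>

lemma lookup_g_hat_trace:
  assumes "m \<ge> 2" "h + k = d"
  defines "e \<equiv> m - 1"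
  shows "Poly_Mapping.lookup ((g_hat 2 m T 1 ^^ h) ((g_hat 2 m T 2 ^^ k)
      (mat_trace (generic_matrix 2 ^\<^sub>m (e * d))))) 0 =
    (\<Sum>s\<le>min (e * h) (e * k). poly.coeff (alpha_poly m T ^ h) s * poly.coeff (beta_poly m T ^ k) s *
      (fact (e * h - s) * fact s * fact s * fact (e * k - s) *
       of_nat (walks_closed (e * h + e * k) (e * h - s) s s (e * k - s) +
               walks_closed (e * h + e * k) (e * k - s) s s (e * h - s))))"
proof -
  let ?A = "\<lambda>s. poly.coeff (alpha_poly m T ^ h) s" and ?B = "\<lambda>s. poly.coeff (beta_poly m T ^ k) s"
  let ?M = "mat_trace (generic_matrix 2 ^\<^sub>m (e * d))"
  let ?W = "\<lambda>s t. fact (e * h - s) * fact s * fact t * fact (e * k - t) *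
       of_nat (walks_closed (e * h + e * k) (e * h - s) s t (e * k - t) +
               walks_closed (e * h + e * k) (e * k - t) t s (e * h - s)) :: complex"
  have "(g_hat 2 m T 1 ^^ h) ((g_hat 2 m T 2 ^^ k) ?M) =
      (\<Sum>s\<le>e * h. \<Sum>t\<le>e * k. mconst (?A s) * (mconst (?B t) *
        (mpderiv (1, 1) ^^ (e * h - s)) ((mpderiv (1, 2) ^^ s)
          ((mpderiv (2, 2) ^^ (e * k - t)) ((mpderiv (2, 1) ^^ t) ?M)))))"
    unfolding e_def
    by (subst differential_operator_power[OF degree_alpha_poly g_hat_1],
        subst differential_operator_power[OF degree_beta_poly g_hat_2])
       (simp add: mpderiv_funpow_sum mpderiv_funpow_mconst_mult sum_distrib_left)
  then have "Poly_Mapping.lookup ((g_hat 2 m T 1 ^^ h) ((g_hat 2 m T 2 ^^ k) ?M)) 0 =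
      (\<Sum>s\<le>e * h. \<Sum>t\<le>e * k. ?A s * ?B t * ?W s t)"
    using assms(2)
    by (simp add: lookup_sum lookup_mpderiv_funpow_4 lookup_trace_generic_pow mult.assoc
        distrib_left[symmetric])
  also have "\<dots> = (\<Sum>s\<le>e * h. if s \<le> e * k then ?A s * ?B s * ?W s s else 0)"
  proof (rule sum.cong)
    fix s
    have "(\<Sum>t\<le>e * k. ?A s * ?B t * ?W s t) = (\<Sum>t\<le>e * k. if t = s then ?A s * ?B s * ?W s s else 0)"
      by (rule sum.cong) (auto simp: walks_closed_def)
    then show "(\<Sum>t\<le>e * k. ?A s * ?B t * ?W s t) = (if s \<le> e * k then ?A s * ?B s * ?W s s else 0)"
      by simp
  qed simp
  also have "\<dots> = (\<Sum>s\<le>min (e * h) (e * k). ?A s * ?B s * ?W s s)"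
    by (subst sum.inter_filter[symmetric]) (auto intro!: sum.cong)
  finally show ?thesis .
qed

section \<open>The trace formula\<close>

lemma sum_pairs: "(\<Sum>ks | length ks = 2 \<and> sum_list ks = d. f (ks ! 0) (ks ! 1)) = (\<Sum>h\<le>d. f h (d - h :: nat))"
  by (rule sum.reindex_bij_witness[of _ "\<lambda>h. [h, d - h]" "\<lambda>ks. ks ! 0"])
     (auto simp: length_Suc_conv numeral_2_eq_2 One_nat_def)

theorem Tr_2:
  assumes "m \<ge> 2" "d \<ge> 1"
  shows "Tr 2 m T d = of_nat (m - 1) * (alpha m T 0 ^ d + beta m T 0 ^ d +
    (\<Sum>h = 1..<d. \<Sum>s = 1..min h (d - h) * (m - 1).
      of_nat (s * d) / of_nat (h * (d - h) * (m - 1)) *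
      (poly.coeff (alpha_poly m T ^ h) s * poly.coeff (beta_poly m T ^ (d - h)) s)))"
proof -
  define e where "e = m - 1"
  have e: "e \<ge> 1" using assms by (simp add: e_def)
  let ?M = "mat_trace (generic_matrix 2 ^\<^sub>m (e * d))"
  define t where "t h k = 1 / fact (e * h) * (1 / fact (e * k)) *
    Poly_Mapping.lookup ((g_hat 2 m T 1 ^^ h) ((g_hat 2 m T 2 ^^ k) ?M)) 0" for h k
  have foldr_eq: "Poly_Mapping.lookup (foldr (\<lambda>i p. mconst (1 / fact (e * ks ! (i - 1))) *
        (g_hat 2 m T i ^^ (ks ! (i - 1))) p) [1..<3] ?M) 0 = t (ks ! 0) (ks ! 1)" for ks
  proof -
    have "[1..<3] = [1, 2]" by (simp add: upt_rec)
    then show ?thesis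
      by (simp add: t_def e_def g_hat_mconst_mult mult.assoc, simp add: One_nat_def)
  qed
  have "Tr 2 m T d = of_nat e * (\<Sum>h\<le>d. t h (d - h))"
    unfolding Tr_def trace_mpoly_def e_def[symmetric]
    by (simp add: lookup_sum foldr_eq sum_pairs del: upt_Suc)
  also have "(\<Sum>h\<le>d. t h (d - h)) = t 0 d + t d 0 + (\<Sum>h = 1..<d. t h (d - h))"
  proof -
    have "{..d} = insert 0 (insert d {1..<d})" using assms(2) by auto
    then show ?thesis using assms(2) by simp
  qed
  \<comment> \<open>With one exponent zero the only walk consists of loops at a single vertex; its
    derivative (ed)! cancels the denominator.\<close>
  also have "t 0 d = beta m T 0 ^ d"
    unfolding t_def e_def
    by (subst lookup_g_hat_trace)
       (use assms e in \<open>auto simp: walks_closed_def e_def coeff_beta_poly coeff_0_power\<close>)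
  also have "t d 0 = alpha m T 0 ^ d"
    unfolding t_def e_def
    by (subst lookup_g_hat_trace)
       (use assms e in \<open>auto simp: walks_closed_def e_def coeff_alpha_poly coeff_0_power\<close>)
  also have "(\<Sum>h = 1..<d. t h (d - h)) = (\<Sum>h = 1..<d. \<Sum>s = 1..min h (d - h) * e.
      of_nat (s * d) / of_nat (h * (d - h) * e) *
      (poly.coeff (alpha_poly m T ^ h) s * poly.coeff (beta_poly m T ^ (d - h)) s))"
  proof (rule sum.cong)
    fix h assume "h \<in> {1..<d}"
    then obtain k where k: "d = h + k" "h \<ge> 1" "k \<ge> 1"
      by (metis atLeastLessThan_iff le_add_diff_inverse less_imp_le_nat zero_less_diff less_one linorder_not_less)
    let ?AB = "\<lambda>s. poly.coeff (alpha_poly m T ^ h) s * poly.coeff (beta_poly m T ^ k) s"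
    let ?w = "\<lambda>s. fact (e * h - s) * fact s * fact s * fact (e * k - s) *
       of_nat (walks_closed (e * h + e * k) (e * h - s) s s (e * k - s) +
               walks_closed (e * h + e * k) (e * k - s) s s (e * h - s)) :: complex"
    have "t h k = (\<Sum>s\<le>min (e * h) (e * k). ?AB s * (?w s / (fact (e * h) * fact (e * k))))"
      unfolding t_def e_def
      by (subst lookup_g_hat_trace[OF assms(1) k(1)[symmetric]])
         (simp add: sum_distrib_left mult_ac)
    \<comment> \<open>A closed walk without crossings cannot use loops at both vertices, so s = 0
      contributes nothing when h and k are positive.\<close>
    also have "\<dots> = (\<Sum>s = 1..min (e * h) (e * k). ?AB s * (?w s / (fact (e * h) * fact (e * k))))"
    proof (rule sum.mono_neutral_right)
      show "\<forall>i\<in>{..min (e * h) (e * k)} - {1..min (e * h) (e * k)}.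
          ?AB i * (?w i / (fact (e * h) * fact (e * k))) = 0"
        using k e by (auto simp: walks_closed_def)
    qed auto
    also have "\<dots> = (\<Sum>s = 1..min h k * e. of_nat (s * d) / of_nat (h * k * e) * ?AB s)"
    proof (rule sum.cong)
      show "{1..min (e * h) (e * k)} = {1..min h k * e}"
        using e by (auto simp: min_def mult.commute)
      fix s assume "s \<in> {1..min h k * e}"
      then have s: "1 \<le> s" "s \<le> e * h" "s \<le> e * k"
        by (auto simp: mult.commute intro: order_trans)
      have "?w s / (fact (e * h) * fact (e * k)) = of_nat (s * (e * h + e * k)) / of_nat (e * h * (e * k))"
        by (rule walk_weight[OF s])
      \<comment> \<open>The vertices carry eh and ek steps; one of the two factors e in the
        denominator cancels and the other remains.\<close>
      also have "\<dots> = of_nat (s * d) / of_nat (h * k * e)"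
        using e k by (simp add: field_simps)
      finally show "?AB s * (?w s / (fact (e * h) * fact (e * k))) = of_nat (s * d) / of_nat (h * k * e) * ?AB s"
        by simp
    qed
    finally show "t h (d - h) = (\<Sum>s = 1..min h (d - h) * e. of_nat (s * d) / of_nat (h * (d - h) * e) *
      (poly.coeff (alpha_poly m T ^ h) s * poly.coeff (beta_poly m T ^ (d - h)) s))"
      using k by simp
  qed simp
  finally show ?thesis by (simp add: e_def add_ac)
qed

declare One_nat_def [simp]

lemma sum_bounded_tuples:
  fixes p :: "complex poly"
  assumes "degree p \<le> m - 1"
  shows "(\<Sum>as\<in>bounded_tuples m h s. \<Prod>i<h. poly.coeff p (as ! i)) = poly.coeff (p ^ h) s"
proof (induction h arbitrary: s)
  case 0
  have "bounded_tuples m 0 s = (if s = 0 then {[]} else {})"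
    by (auto simp: bounded_tuples_def)
  then show ?case by simp
next
  case (Suc h)
  have fin: "finite (bounded_tuples m h s)" for h s
    using finite_lists_length_eq[of "{0..m - 1}" h]
    by (rule finite_subset[rotated]) (auto simp: bounded_tuples_def)
  have "(\<Sum>as\<in>bounded_tuples m (Suc h) s. \<Prod>i<Suc h. poly.coeff p (as ! i)) =
      (\<Sum>(a, as)\<in>(SIGMA a:{a. a \<le> s \<and> a \<le> m - 1}. bounded_tuples m h (s - a)).
        poly.coeff p a * (\<Prod>i<h. poly.coeff p (as ! i)))"
    by (rule sum.reindex_bij_witness[of _ "\<lambda>(a, as). a # as" "\<lambda>as. (hd as, tl as)"])
       (auto simp: bounded_tuples_def length_Suc_conv prod.lessThan_Suc_shift simp del: prod.lessThan_Suc)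
  also have "\<dots> = (\<Sum>a | a \<le> s \<and> a \<le> m - 1. poly.coeff p a * poly.coeff (p ^ h) (s - a))"
    by (subst sum.Sigma[symmetric]) (auto simp: fin Suc.IH[symmetric] sum_distrib_left)
  also have "\<dots> = (\<Sum>a\<le>s. poly.coeff p a * poly.coeff (p ^ h) (s - a))"
  proof (rule sum.mono_neutral_left)
    show "\<forall>a\<in>{..s} - {a. a \<le> s \<and> a \<le> m - 1}. poly.coeff p a * poly.coeff (p ^ h) (s - a) = 0"
    proof
      fix a assume "a \<in> {..s} - {a. a \<le> s \<and> a \<le> m - 1}"
      then have "degree p < a" using assms by auto
      then show "poly.coeff p a * poly.coeff (p ^ h) (s - a) = 0"
        by (simp add: coeff_eq_0)
    qed
  qed auto
  finally show ?case by (simp add: coeff_mult)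
qed

lemma alpha_0: "m \<ge> 1 \<Longrightarrow> alpha m T 0 = T (replicate m 1)"
proof -
  assume m: "m \<ge> 1"
  have "{is. is \<in> multi_indices 2 (m - 1) \<and> count_list is 2 = 0} = {replicate (m - 1) 1}"
  proof (intro equalityI subsetI)
    fix "is" assume "is \<in> {is. is \<in> multi_indices 2 (m - 1) \<and> count_list is 2 = 0}"
    then have len: "length is = m - 1" and "set is \<subseteq> {1..2}" "2 \<notin> set is"
      by (auto simp: multi_indices_def count_list_0_iff)
    have "x = 1" if "x \<in> set is" for x
    proof -
      have "x \<in> {1..2}" "x \<noteq> 2" using that \<open>set is \<subseteq> {1..2}\<close> \<open>2 \<notin> set is\<close> by blast+
      then show ?thesis by auto
    qed
    with len show "is \<in> {replicate (m - 1) 1}" by (metis replicate_eqI singletonI)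
  qed (auto simp: multi_indices_def count_list_0_iff set_replicate_conv_if)
  then show ?thesis using m by (cases m) (auto simp: alpha_def)
qed

lemma beta_0: "m \<ge> 1 \<Longrightarrow> beta m T 0 = T (replicate m 2)"
proof -
  assume m: "m \<ge> 1"
  have "{is. is \<in> multi_indices 2 (m - 1) \<and> count_list is 1 = 0} = {replicate (m - 1) 2}"
  proof (intro equalityI subsetI)
    fix "is" assume "is \<in> {is. is \<in> multi_indices 2 (m - 1) \<and> count_list is 1 = 0}"
    then have len: "length is = m - 1" and "set is \<subseteq> {1..2}" "1 \<notin> set is"
      by (auto simp: multi_indices_def count_list_0_iff)
    have "x = 2" if "x \<in> set is" for x
    proof -
      have "x \<in> {1..2}" "x \<noteq> 1" using that \<open>set is \<subseteq> {1..2}\<close> \<open>1 \<notin> set is\<close> by blast+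
      then show ?thesis by auto
    qed
    with len show "is \<in> {replicate (m - 1) 2}" by (metis replicate_eqI singletonI)
  qed (auto simp: multi_indices_def count_list_0_iff set_replicate_conv_if)
  then show ?thesis using m by (cases m) (auto simp: beta_def)
qed


section \<open>Expansion of the resultant near the identity\<close>

text \<open>Submultiplicativity of the l^1 norm of the coefficients. In terms of partial sums it
  gives bounds for all powers without regard to degrees.\<close>

lemma sum_norm_coeff_mult:
  fixes p r :: "complex poly"
  assumes "\<And>n. (\<Sum>i\<le>n. norm (poly.coeff p i)) \<le> K" "\<And>n. (\<Sum>i\<le>n. norm (poly.coeff r i)) \<le> L"
  shows "(\<Sum>i\<le>n. norm (poly.coeff (p * r) i)) \<le> K * L"
proof -
  have "0 \<le> (\<Sum>i\<le>0. norm (poly.coeff p i))" by simp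
  also have "\<dots> \<le> K" by (rule assms)
  finally have "K \<ge> 0" .
  have "(\<Sum>s\<le>n. norm (poly.coeff (p * r) s)) \<le>
      (\<Sum>s\<le>n. \<Sum>i\<le>s. norm (poly.coeff p i) * norm (poly.coeff r (s - i)))"
    unfolding coeff_mult by (intro sum_mono sum_norm_le) (simp add: norm_mult)
  also have "\<dots> = (\<Sum>(i, j)\<in>{(i, j). i + j \<le> n}. norm (poly.coeff p i) * norm (poly.coeff r j))"
    by (rule sum.triangle_reindex_eq[symmetric])
  also have "\<dots> \<le> (\<Sum>(i, j)\<in>{..n} \<times> {..n}. norm (poly.coeff p i) * norm (poly.coeff r j))"
    by (rule sum_mono2) auto
  also have "\<dots> = (\<Sum>i\<le>n. norm (poly.coeff p i)) * (\<Sum>j\<le>n. norm (poly.coeff r j))"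
    by (simp add: sum_product sum.cartesian_product)
  also have "\<dots> \<le> K * L"
    using \<open>K \<ge> 0\<close> by (intro mult_mono assms) (auto intro: sum_nonneg)
  finally show ?thesis .
qed

lemma sum_norm_coeff_power:
  fixes p :: "complex poly"
  assumes "\<And>n. (\<Sum>i\<le>n. norm (poly.coeff p i)) \<le> K"
  shows "(\<Sum>i\<le>n. norm (poly.coeff (p ^ h) i)) \<le> K ^ h"
proof (induction h arbitrary: n)
  case 0
  have "(\<Sum>i\<le>n. norm (poly.coeff (1::complex poly) i)) = (\<Sum>i\<le>n. if i = 0 then 1 else 0)"
    by (intro sum.cong) auto
  then show ?case by simp
next
  case (Suc h)
  then show ?case using sum_norm_coeff_mult[OF assms Suc.IH] by simp
qed

lemma norm_coeff_power_le:
  fixes p :: "complex poly"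
  assumes "\<And>n. (\<Sum>i\<le>n. norm (poly.coeff p i)) \<le> K"
  shows "norm (poly.coeff (p ^ h) s) \<le> K ^ h"
proof -
  have "norm (poly.coeff (p ^ h) s) \<le> (\<Sum>i\<le>s. norm (poly.coeff (p ^ h) i))"
    by (rule member_le_sum) auto
  also have "\<dots> \<le> K ^ h" by (rule sum_norm_coeff_power[OF assms])
  finally show ?thesis .
qed

lemma norm_poly_le:
  fixes p :: "complex poly"
  assumes "\<And>n. (\<Sum>i\<le>n. norm (poly.coeff p i)) \<le> K" "norm u \<le> 1"
  shows "norm (poly p u) \<le> K"
proof -
  have "norm (poly p u) \<le> (\<Sum>i\<le>degree p. norm (poly.coeff p i))"
    unfolding poly_altdef
    by (intro sum_norm_le) (auto simp: norm_mult norm_power assms(2) power_le_one mult_left_le)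
  also have "\<dots> \<le> K" by (rule assms)
  finally show ?thesis .
qed

text \<open>Newton's identities: the power sums are generated by -X G'/G for G the product of the 1
  - q_j X. This logarithmic derivative has no constant term, hence the value 0 at s = 0. Each new
  factor adds one geometric series.\<close>

lemma power_sums_generating:
  fixes q :: "nat \<Rightarrow> complex"
  shows "Abs_fps (\<lambda>s. if s = 0 then 0 else \<Sum>j<n. q j ^ s) * (\<Prod>j<n. 1 - fps_const (q j) * fps_X) =
    - fps_X * fps_deriv (\<Prod>j<n. 1 - fps_const (q j) * fps_X)"
proof (induction n)
  case 0
  show ?case by (simp add: fps_eq_iff)
next
  case (Suc n)
  let ?P = "\<lambda>n. Abs_fps (\<lambda>s. if s = 0 then 0 else \<Sum>j<n. q j ^ s)"
  let ?G = "\<lambda>n. \<Prod>j<n. 1 - fps_const (q j) * fps_X"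
  let ?l = "1 - fps_const (q n) * fps_X"
  define E where "E = Abs_fps (\<lambda>s. if s = 0 then 0 else q n ^ s)"
  have "E = fps_X * fps_const (q n) * Abs_fps (\<lambda>s. q n ^ s)"
    by (auto simp: E_def fps_eq_iff fps_mult_left_const_nth mult.assoc power_eq_if)
  moreover have "Abs_fps (\<lambda>s. q n ^ s) * ?l = 1"
  proof (rule fps_ext)
    fix m
    have "Abs_fps (\<lambda>s. q n ^ s) * ?l =
        Abs_fps (\<lambda>s. q n ^ s) - fps_const (q n) * (fps_X * Abs_fps (\<lambda>s. q n ^ s))"
      by (simp add: right_diff_distrib mult_ac)
    then show "fps_nth (Abs_fps (\<lambda>s. q n ^ s) * ?l) m = fps_nth 1 m"
      by (cases m) simp_all
  qed
  ultimately have E: "E * ?l = fps_X * fps_const (q n)"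
    by (simp add: mult.assoc)
  have "?P (Suc n) = ?P n + E"
    by (simp add: fps_eq_iff E_def)
  then have "?P (Suc n) * ?G (Suc n) = ?P n * ?G n * ?l + ?G n * (E * ?l)"
    by (simp add: algebra_simps)
  also have "\<dots> = - fps_X * fps_deriv (?G n) * ?l + ?G n * (fps_X * fps_const (q n))"
    by (simp only: Suc.IH E)
  also have "\<dots> = - fps_X * fps_deriv (?G (Suc n))"
    by (simp add: algebra_simps)
  finally show ?case .
qed

locale char_poly_expansion =
  fixes e :: nat and A B :: "complex poly"
  assumes e_pos: "e > 0" and deg_A: "degree A \<le> e" and deg_B: "degree B \<le> e"
begin

text \<open>For w = 1/z this is \<psi>(z)/z^(2e). The coefficients of B are reversed because they
  are indexed by the exponent of x_1, while both forms are dehomogenized at x_1 = 1.\<close>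

definition char_res :: "complex \<Rightarrow> complex" where
  "char_res w = bezout_res e (\<lambda>i. (if i = 0 then 1 else 0) - w * poly.coeff A i)
     (\<lambda>i. if i \<le> e then (if i = e then 1 else 0) - w * poly.coeff B (e - i) else 0)"

text \<open>This will be Tr_d / d, written as the logarithm delivers it. Division by zero makes
  \<open>tau 0\<close> equal to 0, as the composition with the exponential series requires.\<close>

definition tau :: "nat \<Rightarrow> complex" where
  "tau d = of_nat e / of_nat d * (poly.coeff A 0 ^ d + poly.coeff B 0 ^ d) +
    (\<Sum>h = 1..<d. \<Sum>s = 1..min h (d - h) * e. of_nat s / of_nat (h * (d - h)) *
      (poly.coeff (A ^ h) s * poly.coeff (B ^ (d - h)) s))"

text \<open>A common bound for the l^1 norms of A and B; all series below converge when |w| K <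
  1.\<close>

definition K :: real where
  "K = 1 + (\<Sum>i\<le>e. norm (poly.coeff A i)) + (\<Sum>i\<le>e. norm (poly.coeff B i))"

lemma K_ge_1: "K \<ge> 1"
  by (simp add: K_def sum_nonneg)

lemma sum_norm_le_K:
  "(\<Sum>i\<le>n. norm (poly.coeff A i)) \<le> K" "(\<Sum>i\<le>n. norm (poly.coeff B i)) \<le> K"
proof -
  have le: "(\<Sum>i\<le>n. norm (poly.coeff p i)) \<le> (\<Sum>i\<le>e. norm (poly.coeff p i))"
    if "degree p \<le> e" for p :: "complex poly"
  proof -
    have "(\<Sum>i\<le>n. norm (poly.coeff p i)) \<le> (\<Sum>i\<le>max n e. norm (poly.coeff p i))"
      by (rule sum_mono2) auto
    also have "\<dots> = (\<Sum>i\<le>e. norm (poly.coeff p i))"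
      by (rule sum.mono_neutral_right) (use that in \<open>auto simp: coeff_eq_0\<close>)
    finally show ?thesis .
  qed
  show "(\<Sum>i\<le>n. norm (poly.coeff A i)) \<le> K" "(\<Sum>i\<le>n. norm (poly.coeff B i)) \<le> K"
    using le[OF deg_A] le[OF deg_B] unfolding K_def by (smt (verit) norm_ge_zero sum_nonneg)+
qed

context
  fixes w :: complex
  assumes w: "norm w * K < 1"
begin

lemma norm_w_coeff_0: "norm (w * poly.coeff A 0) < 1" "norm (w * poly.coeff B 0) < 1"
  using w mult_left_mono[OF sum_norm_le_K(1)[of 0], of "norm w"]
    mult_left_mono[OF sum_norm_le_K(2)[of 0], of "norm w"] by (simp_all add: norm_mult)

text \<open>A root satisfies q^e = w times the sum of B_(e-i) q^i. If |q| were at least 1, the right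
  side would be at most |w| K |q|^e < |q|^e. Roots in the unit disc give |A(q_j)| at most K, so the
  logarithms of 1 - w A(q_j) have convergent series.\<close>

lemma roots_exist:
  obtains q where "\<And>i. i \<le> e \<Longrightarrow> (if i = e then 1 else 0) - w * poly.coeff B (e - i) =
      (1 - w * poly.coeff B 0) * poly.coeff (\<Prod>j<e. [:- q j, 1:]) i"
    "\<And>j. j < e \<Longrightarrow> norm (q j) < 1"
    "char_res w = (1 - w * poly.coeff B 0) ^ e * (\<Prod>j<e. 1 - w * poly A (q j))"
proof -
  let ?g = "\<lambda>i. if i \<le> e then (if i = e then 1 else 0) - w * poly.coeff B (e - i) else 0"
  let ?f = "\<lambda>i. (if i = 0 then 1 else 0) - w * poly.coeff A i"
  have ge: "?g e = 1 - w * poly.coeff B 0" by simp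
  have nz: "?g e \<noteq> 0" using norm_w_coeff_0(2) by (auto simp: right_minus_eq)
  have zero: "?g i = 0" if "i > e" for i using that by simp
  obtain q where q: "\<And>i. ?g i = ?g e * poly.coeff (\<Prod>j<e. [:- q j, 1:]) i"
    using coeffs_from_roots[of e ?g, OF zero nz] by blast
  have eq: "(\<lambda>i. ?g e * poly.coeff (\<Prod>j<e. [:- q j, 1:]) i) = ?g"
    by (rule ext) (rule q[symmetric])
  have "bezout_res e ?f (\<lambda>i. ?g e * poly.coeff (\<Prod>j<e. [:- q j, 1:]) i) =
      ?g e ^ e * (\<Prod>j<e. \<Sum>i\<le>e. ?f i * q j ^ i)"
    by (rule bezout_res_roots) (use deg_A in \<open>auto simp: coeff_eq_0\<close>)
  then have "bezout_res e ?f ?g = ?g e ^ e * (\<Prod>j<e. \<Sum>i\<le>e. ?f i * q j ^ i)"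
    by (simp only: eq)
  then have "char_res w = (1 - w * poly.coeff B 0) ^ e * (\<Prod>j<e. \<Sum>i\<le>e. ?f i * q j ^ i)"
    by (simp only: char_res_def ge)
  moreover have "(\<Sum>i\<le>e. ?f i * u ^ i) = 1 - w * poly A u" for u
  proof -
    have "poly A u = (\<Sum>i\<le>e. poly.coeff A i * u ^ i)"
      unfolding poly_altdef by (rule sum.mono_neutral_left) (use deg_A in \<open>auto simp: coeff_eq_0\<close>)
    moreover have "(\<Sum>i\<le>e. (if i = 0 then 1 else 0) * u ^ i) = 1"
      by (simp add: if_distribR[symmetric] if_distrib[of "\<lambda>z. z * _"] cong: if_cong)
    ultimately show ?thesis
      by (simp add: left_diff_distrib sum_subtractf sum_distrib_left mult.assoc)
  qed
  ultimately have res: "char_res w = (1 - w * poly.coeff B 0) ^ e * (\<Prod>j<e. 1 - w * poly A (q j))"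
    by simp
  have "norm (q j) < 1" if "j < e" for j
  proof (rule ccontr)
    assume "\<not> norm (q j) < 1"
    then have ge1: "norm (q j) \<ge> 1" by simp
    have "(\<Sum>i\<le>e. ?g i * q j ^ i) = ?g e * poly (\<Prod>j<e. [:- q j, 1:]) (q j)"
      unfolding poly_altdef degree_prod_linear sum_distrib_left
      by (rule sum.cong) (simp_all only: q[symmetric] mult.assoc[symmetric])
    also have "poly (\<Prod>j<e. [:- q j, 1:]) (q j) = 0"
      using that by (auto simp: poly_prod)
    finally have "0 = (\<Sum>i\<le>e. ?g i * q j ^ i)" by simp
    also have "\<dots> = (\<Sum>i\<le>e. (if i = e then q j ^ e else 0) - w * (poly.coeff B (e - i) * q j ^ i))"
      by (rule sum.cong) (auto simp: algebra_simps)
    also have "\<dots> = q j ^ e - w * (\<Sum>i\<le>e. poly.coeff B (e - i) * q j ^ i)"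
      by (simp add: sum_subtractf sum_distrib_left)
    finally have "q j ^ e = w * (\<Sum>i\<le>e. poly.coeff B (e - i) * q j ^ i)" by simp
    then have norm_eq: "norm (q j) ^ e = norm w * norm (\<Sum>i\<le>e. poly.coeff B (e - i) * q j ^ i)"
      by (metis norm_mult norm_power)
    have "norm (\<Sum>i\<le>e. poly.coeff B (e - i) * q j ^ i) \<le>
        (\<Sum>i\<le>e. norm (poly.coeff B (e - i)) * norm (q j) ^ e)"
      using ge1 by (intro sum_norm_le) (auto simp: norm_mult norm_power intro!: mult_left_mono power_increasing)
    also have "\<dots> = (\<Sum>i\<le>e. norm (poly.coeff B i)) * norm (q j) ^ e"
      unfolding sum_distrib_right
      by (rule sum.reindex_bij_witness[of _ "\<lambda>i. e - i" "\<lambda>i. e - i"]) auto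
    also have "\<dots> \<le> K * norm (q j) ^ e"
      by (intro mult_right_mono sum_norm_le_K) auto
    finally have "norm (q j) ^ e \<le> (norm w * K) * norm (q j) ^ e"
      unfolding norm_eq mult.assoc by (rule mult_left_mono) auto
    moreover have "norm (q j) ^ e > 0" using ge1 by (intro zero_less_power) linarith
    ultimately show False using w by simp
  qed
  then show ?thesis
    using that[of q] res q ge by (simp only: if_True) (metis (no_types, lifting))
qed

text \<open>The sum of w^k B^k / k is -ln(1 - wB), and X d/dX turns it into w X B'/(1 - wB). The
  same series is the generating function of the power sums, since 1 - wB is a constant times the
  product of the 1 - q_j X. No logarithm of a formal series occurs: both series are multiplied by 1
  - wB and compared.\<close>

lemma power_sum_series:
  assumes q: "\<And>i. i \<le> e \<Longrightarrow> (if i = e then 1 else 0) - w * poly.coeff B (e - i) =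
      (1 - w * poly.coeff B 0) * poly.coeff (\<Prod>j<e. [:- q j, 1:]) i"
    and "s \<ge> 1"
  shows "(\<lambda>k. of_nat s / of_nat k * (w ^ k * poly.coeff (B ^ k) s)) sums (\<Sum>j<e. q j ^ s)"
proof -
  let ?b = "fps_of_poly B"
  \<comment> \<open>X d/dX applied to B^k / k; it is 0 for k = 0.\<close>
  define D where "D k = fps_X * fps_deriv (?b ^ k) * fps_const (1 / of_nat k)" for k
  have D_nth: "fps_nth (D k) n = of_nat n / of_nat k * poly.coeff (B ^ k) n" for k n
    by (cases n) (simp_all add: D_def fps_of_poly_power[symmetric] mult.assoc fps_mult_right_const_nth)
  define c where "c n = suminf (\<lambda>k. w ^ k * fps_nth (D k) n)" for n
  have summable: "summable (\<lambda>k. norm (w ^ k * fps_nth (D k) n))" for n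
  proof (rule summable_comparison_test)
    show "summable (\<lambda>k. of_nat n * (norm w * K) ^ k)"
      using w K_ge_1 by (intro summable_mult summable_geometric) auto
    have "norm (w ^ k * fps_nth (D k) n) \<le> of_nat n * (norm w * K) ^ k" for k
    proof -
      have "real n / real k \<le> real n"
        using divide_left_mono[of 1 "real k" "real n"] by (cases "k = 0") auto
      then have "real n / real k * norm (poly.coeff (B ^ k) n) \<le> real n * K ^ k"
        by (intro mult_mono norm_coeff_power_le sum_norm_le_K) auto
      then have "norm w ^ k * (real n / real k * norm (poly.coeff (B ^ k) n)) \<le> norm w ^ k * (real n * K ^ k)"
        by (intro mult_left_mono) auto
      then show ?thesis
        by (simp add: D_nth norm_mult norm_power norm_divide power_mult_distrib mult_ac)
    qed
    then show "\<exists>N. \<forall>k\<ge>N. norm (norm (w ^ k * fps_nth (D k) n)) \<le> of_nat n * (norm w * K) ^ k"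
      by simp
  qed
  have c_sums: "(\<lambda>k. w ^ k * fps_nth (D k) n) sums c n" for n
    unfolding c_def by (intro summable_sums summable_norm_cancel[OF summable])
  have D_Suc: "?b * D k = D (Suc k)" if "k \<ge> 1" for k
  proof -
    have "D k = fps_X * fps_deriv ?b * ?b ^ (k - 1)" if "k \<ge> 1" for k
    proof -
      have "fps_const (of_nat k) * fps_const (1 / of_nat k) = (1 :: complex fps)"
        using that by (simp add: fps_const_mult[symmetric] del: fps_const_mult)
      then show ?thesis
        unfolding D_def fps_deriv_power' by (simp add: fps_of_nat[symmetric] mult_ac)
    qed
    from this[of k] this[of "Suc k"] that show ?thesis
      by (simp add: mult_ac power_eq_if)
  qed
  \<comment> \<open>Since B times \<open>D k\<close> is \<open>D (Suc k)\<close> for k at least 1,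
    multiplication by 1 - wB makes the series in k telescope, coefficient by coefficient, to its
    first term w X B'.\<close>
  have c_eq: "Abs_fps c * (1 - fps_const w * ?b) = fps_const w * fps_X * fps_deriv ?b"
  proof (rule fps_ext)
    fix n
    let ?u = "\<lambda>k. w ^ k * fps_nth (D k) n"
    have "(\<lambda>k. ?u k - w * (\<Sum>i = 0..n. poly.coeff B i * (w ^ k * fps_nth (D k) (n - i)))) sums
        (c n - w * (\<Sum>i = 0..n. poly.coeff B i * c (n - i)))"
      by (intro sums_diff sums_mult sums_sum c_sums)
    moreover have "?u k - w * (\<Sum>i = 0..n. poly.coeff B i * (w ^ k * fps_nth (D k) (n - i))) =
        (if k = 0 then 0 else ?u k - ?u (Suc k))" for k
    proof (cases "k = 0")
      case True
      then show ?thesis by (simp add: D_nth)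
    next
      case False
      have "fps_nth (?b * D k) n = (\<Sum>i = 0..n. poly.coeff B i * fps_nth (D k) (n - i))"
        by (simp add: fps_mult_nth)
      then have "w * (\<Sum>i = 0..n. poly.coeff B i * (w ^ k * fps_nth (D k) (n - i))) =
          w ^ Suc k * fps_nth (?b * D k) n"
        by (simp only:) (simp add: sum_distrib_left mult_ac)
      with False show ?thesis by (simp add: D_Suc)
    qed
    ultimately have "(\<lambda>k. if k = 0 then 0 else ?u k - ?u (Suc k)) sums
        (c n - w * (\<Sum>i = 0..n. poly.coeff B i * c (n - i)))"
      by simp
    then have "(\<lambda>k. ?u (Suc k) - ?u (Suc (Suc k))) sums
        (c n - w * (\<Sum>i = 0..n. poly.coeff B i * c (n - i)))"
      using sums_Suc_iff[of "\<lambda>k. if k = 0 then 0 else ?u k - ?u (Suc k)"] by simp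
    moreover have "(\<lambda>k. ?u (Suc k) - ?u (Suc (Suc k))) sums (?u (Suc 0) - 0)"
      by (rule telescope_sums'[where f = "\<lambda>k. ?u (Suc k)"])
         (rule LIMSEQ_Suc[OF summable_LIMSEQ_zero[OF summable_norm_cancel[OF summable]]])
    ultimately have "c n - w * (\<Sum>i = 0..n. poly.coeff B i * c (n - i)) = w * fps_nth (D 1) n"
      using sums_unique2 by fastforce
    moreover have "fps_nth (Abs_fps c * (1 - fps_const w * ?b)) n =
        c n - w * (\<Sum>i = 0..n. poly.coeff B i * c (n - i))"
      by (simp add: right_diff_distrib mult.left_commute[of _ "fps_const w"]
          mult.commute[of "Abs_fps c" "?b"] fps_mult_nth[of ?b])
    moreover have "D 1 = fps_X * fps_deriv ?b"
      by (simp add: D_def)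
    ultimately show "fps_nth (Abs_fps c * (1 - fps_const w * ?b)) n =
        fps_nth (fps_const w * fps_X * fps_deriv ?b) n"
      by (simp add: mult.assoc)
  qed
  let ?P = "Abs_fps (\<lambda>s. if s = 0 then 0 else \<Sum>j<e. q j ^ s)"
  let ?G = "\<Prod>j<e. 1 - fps_const (q j) * fps_X"
  \<comment> \<open>Reflection turns X - q_j into 1 - q_j X and undoes the reversal of B. It
    reflects about the exact degree, which is e because the product is monic.\<close>
  have G: "fps_const (1 - w * poly.coeff B 0) * ?G = 1 - fps_const w * ?b"
  proof -
    have "reflect_poly (\<Prod>j<e. [:- q j, 1:]) = (\<Prod>j<e. [:1, - q j:])"
      by (simp add: reflect_poly_prod reflect_poly_pCons' monom_Suc monom_0)
    moreover have linear: "fps_of_poly [:1, - a:] = 1 - fps_const a * fps_X" for a :: complex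
      by (simp add: fps_of_poly_pCons fps_const_neg[symmetric] del: fps_const_neg)
    have "fps_of_poly (\<Prod>j<e. [:1, - q j:]) = ?G"
      by (simp only: fps_of_poly_prod linear)
    ultimately have "?G = fps_of_poly (reflect_poly (\<Prod>j<e. [:- q j, 1:]))" by metis
    then have G_nth: "fps_nth ?G n = (if n > e then 0 else poly.coeff (\<Prod>j<e. [:- q j, 1:]) (e - n))" for n
      by (simp add: coeff_reflect_poly degree_prod_linear)
    have "(1 - w * poly.coeff B 0) * fps_nth ?G n = (if n = 0 then 1 else 0) - w * poly.coeff B n" for n
    proof (cases "n > e")
      case True
      then show ?thesis using G_nth deg_B e_pos by (simp add: coeff_eq_0)
    next
      case False
      then have "e - n \<le> e" "e - n = e \<longleftrightarrow> n = 0" "e - (e - n) = n" using e_pos by auto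
      with False q[of "e - n"] show ?thesis by (simp add: G_nth)
    qed
    then show ?thesis by (simp add: fps_eq_iff)
  qed
  have P_eq: "?P * (1 - fps_const w * ?b) = fps_const w * fps_X * fps_deriv ?b"
  proof -
    have "?P * (1 - fps_const w * ?b) = fps_const (1 - w * poly.coeff B 0) * (?P * ?G)"
      unfolding G[symmetric] by (simp add: mult_ac)
    also have "\<dots> = - fps_X * fps_deriv (fps_const (1 - w * poly.coeff B 0) * ?G)"
      unfolding power_sums_generating by simp
    also have "\<dots> = fps_const w * fps_X * fps_deriv ?b"
      unfolding G by simp
    finally show ?thesis .
  qed
  have nz: "1 - fps_const w * ?b \<noteq> 0"
  proof
    assume "1 - fps_const w * ?b = 0"
    then have "fps_nth (1 - fps_const w * ?b) 0 = 0" by (simp only: fps_zero_nth)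
    then have "w * poly.coeff B 0 = 1" by simp
    then show False using norm_w_coeff_0(2) by simp
  qed
  have "Abs_fps c * (1 - fps_const w * ?b) = ?P * (1 - fps_const w * ?b)"
    by (simp only: c_eq P_eq)
  then have "Abs_fps c = ?P" by (simp only: mult_right_cancel[OF nz])
  then have "fps_nth (Abs_fps c) s = fps_nth ?P s" by (rule arg_cong)
  then have "c s = (\<Sum>j<e. q j ^ s)"
    using \<open>s \<ge> 1\<close> by simp
  with c_sums[of s] show ?thesis by (simp add: D_nth mult_ac)
qed

text \<open>The term with powers A^h and B^k of the double series. The range of s depends on h
  alone, so that for fixed h the series in k can be summed under the sum over s; coefficients of B^k
  beyond degree ek vanish anyway.\<close>

definition F :: "nat \<Rightarrow> nat \<Rightarrow> complex" where
  "F h k = w ^ (h + k) * (\<Sum>s = 1..e * h. of_nat s / of_nat (h * k) *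
     (poly.coeff (A ^ h) s * poly.coeff (B ^ k) s))"

text \<open>From s at most eh follows that s/(hk) is at most e. The l^1 bound for A^h and a uniform
  bound for the coefficients of B^k then give geometric decay in h and in k.\<close>

lemma norm_F_le: "norm (F h k) \<le> e * (norm w * K) ^ h * (norm w * K) ^ k"
proof -
  have "norm (\<Sum>s = 1..e * h. of_nat s / of_nat (h * k) * (poly.coeff (A ^ h) s * poly.coeff (B ^ k) s)) \<le>
      (\<Sum>s = 1..e * h. e * K ^ k * norm (poly.coeff (A ^ h) s))"
  proof (rule sum_norm_le)
    fix s assume s: "s \<in> {1..e * h}"
    have "real s / real (h * k) \<le> e"
    proof (cases "h * k = 0")
      case False
      then have "s \<le> e * h * 1" "1 \<le> k" using s by auto
      then have "s \<le> e * h * k"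
        using mult_le_mono2[of 1 k "e * h"] by linarith
      then have "real s \<le> real e * real h * real k"
        by (metis of_nat_le_iff of_nat_mult)
      then show ?thesis using False by (simp add: field_simps)
    qed auto
    then have "real s / real (h * k) * (norm (poly.coeff (B ^ k) s) * norm (poly.coeff (A ^ h) s)) \<le>
        e * (K ^ k * norm (poly.coeff (A ^ h) s))"
      using K_ge_1 by (intro mult_mono mult_right_mono norm_coeff_power_le sum_norm_le_K) auto
    then show "norm (of_nat s / of_nat (h * k) * (poly.coeff (A ^ h) s * poly.coeff (B ^ k) s)) \<le>
        e * K ^ k * norm (poly.coeff (A ^ h) s)"
      by (simp add: norm_mult norm_divide mult_ac)
  qed
  also have "\<dots> = e * K ^ k * (\<Sum>s = 1..e * h. norm (poly.coeff (A ^ h) s))"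
    by (simp add: sum_distrib_left)
  also have "\<dots> \<le> e * K ^ k * K ^ h"
  proof (rule mult_left_mono)
    have "(\<Sum>s = 1..e * h. norm (poly.coeff (A ^ h) s)) \<le> (\<Sum>s\<le>e * h. norm (poly.coeff (A ^ h) s))"
      by (rule sum_mono2) auto
    also have "\<dots> \<le> K ^ h"
      by (rule sum_norm_coeff_power) (rule sum_norm_le_K)
    finally show "(\<Sum>s = 1..e * h. norm (poly.coeff (A ^ h) s)) \<le> K ^ h" .
  qed (use K_ge_1 in auto)
  finally have "norm w ^ (h + k) * norm (\<Sum>s = 1..e * h. of_nat s / of_nat (h * k) *
      (poly.coeff (A ^ h) s * poly.coeff (B ^ k) s)) \<le> norm w ^ (h + k) * (e * K ^ k * K ^ h)"
    by (intro mult_left_mono) auto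
  then show ?thesis
    by (simp add: F_def norm_mult norm_power power_add power_mult_distrib mult_ac)
qed

lemma F_summable: "(\<lambda>(h, k). F h k) summable_on UNIV \<times> UNIV"
proof -
  let ?r = "norm w * K"
  have r: "norm ?r < 1" "?r \<ge> 0" using w K_ge_1 by auto
  have geo: "((\<lambda>n. ?r ^ n) has_sum (1 / (1 - ?r))) UNIV"
    using r by (intro norm_summable_imp_has_sum geometric_sums) (auto simp: norm_power)
  have "(\<lambda>x. norm (case x of (h, k) \<Rightarrow> ?r ^ h * ?r ^ k)) summable_on UNIV \<times> UNIV"
    unfolding Infinite_Sum.abs_summable_on_Sigma_iff
  proof (intro conjI ballI)
    have inner: "((\<lambda>k. ?r ^ h * ?r ^ k) has_sum (?r ^ h * (1 / (1 - ?r)))) UNIV" for h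
      by (rule has_sum_cmult_right[OF geo])
    have nrm: "(\<lambda>k. norm (case (h, k) of (h, k) \<Rightarrow> ?r ^ h * ?r ^ k)) = (\<lambda>k. ?r ^ h * ?r ^ k)" for h
      using r by (auto simp: norm_mult norm_power)
    show "(\<lambda>k. norm (case (h, k) of (h, k) \<Rightarrow> ?r ^ h * ?r ^ k)) summable_on UNIV" for h
      unfolding nrm using inner by (rule has_sum_imp_summable)
    have "((\<lambda>h. ?r ^ h * (1 / (1 - ?r))) has_sum (1 / (1 - ?r) * (1 / (1 - ?r)))) UNIV"
      by (rule has_sum_cmult_left[OF geo])
    moreover have "(\<lambda>h. norm (infsum (\<lambda>k. norm (case (h, k) of (h, k) \<Rightarrow> ?r ^ h * ?r ^ k)) UNIV)) =
        (\<lambda>h. ?r ^ h * (1 / (1 - ?r)))"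
      unfolding nrm infsumI[OF inner] using r by (auto simp: norm_mult norm_power)
    ultimately show "(\<lambda>h. norm (infsum (\<lambda>k. norm (case (h, k) of (h, k) \<Rightarrow> ?r ^ h * ?r ^ k)) UNIV)) summable_on UNIV"
      by (simp only: has_sum_imp_summable)
  qed
  then have "(\<lambda>x. norm (e * (case x of (h, k) \<Rightarrow> ?r ^ h * ?r ^ k))) summable_on UNIV \<times> UNIV"
    unfolding norm_mult by (rule summable_on_cmult_right)
  then have "(\<lambda>x. norm (case x of (h, k) \<Rightarrow> F h k)) summable_on UNIV \<times> UNIV"
  proof (rule Infinite_Sum.abs_summable_on_comparison_test)
    fix x :: "nat \<times> nat"
    obtain h k where x: "x = (h, k)" by (cases x)
    have "norm (F h k) \<le> e * (?r ^ h * ?r ^ k)"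
      using norm_F_le[of h k] by (simp only: mult.assoc)
    also have "\<dots> \<le> norm (e * (?r ^ h * ?r ^ k))" by simp
    finally show "norm (case x of (h, k) \<Rightarrow> F h k) \<le> norm (e * (case x of (h, k) \<Rightarrow> ?r ^ h * ?r ^ k))"
      by (simp only: x case_prod_conv)
  qed
  then show ?thesis by (rule abs_summable_summable)
qed

text \<open>The logarithm produces the sum row by row, while the coefficient of w^d needs the
  antidiagonals h + k = d; absolute summability permits the exchange.\<close>

lemma F_rearranged:
  assumes "\<And>h. (\<lambda>k. F h k) sums \<phi> h" "\<phi> sums S"
  shows "(\<lambda>d. \<Sum>h\<le>d. F h (d - h)) sums S"
proof -
  have inner: "((\<lambda>k. F h k) has_sum \<phi> h) UNIV" for h
  proof (rule norm_summable_imp_has_sum)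
    show "summable (\<lambda>k. norm (F h k))"
    proof (rule summable_comparison_test)
      show "summable (\<lambda>k. e * (norm w * K) ^ h * (norm w * K) ^ k)"
        using w K_ge_1 by (intro summable_mult summable_geometric) auto
      show "\<exists>N. \<forall>k\<ge>N. norm (norm (F h k)) \<le> e * (norm w * K) ^ h * (norm w * K) ^ k"
        using norm_F_le by simp
    qed
  qed (rule assms(1))
  obtain S' where S': "((\<lambda>(h, k). F h k) has_sum S') (UNIV \<times> UNIV)"
    using F_summable by (auto simp: summable_on_def)
  then have "(\<phi> has_sum S') UNIV"
    by (rule has_sum_SigmaD) (use inner in simp)
  then have "\<phi> sums S'" by (rule has_sum_imp_sums)
  with assms(2) have "S' = S" by (rule sums_unique2[symmetric])
  have "((\<lambda>(d, h). F h (d - h)) has_sum S') (SIGMA d:UNIV. {..d})"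
    using S'
    by (subst has_sum_reindex_bij_witness[of _ "\<lambda>(h, k). (h + k, h)" "\<lambda>(d, h). (h, d - h)"
          "UNIV \<times> UNIV" "\<lambda>(h, k). F h k" _ S' S']) auto
  then have "((\<lambda>d. \<Sum>h\<le>d. F h (d - h)) has_sum S') UNIV"
    by (rule has_sum_SigmaD) simp
  then show ?thesis
    unfolding \<open>S' = S\<close> by (rule has_sum_imp_sums)
qed

lemma log_series: "norm x < 1 \<Longrightarrow> (\<lambda>n. x ^ n / of_nat n) sums (- Ln (1 - x))" for x :: complex
  using sums_minus[OF Ln_series'[of "- x"]] by simp

lemma char_res_expansion:
  "\<exists>X. (\<lambda>d. tau d * w ^ d) sums X \<and> char_res w = exp (- X)"
proof -
  obtain q where q: "\<And>i. i \<le> e \<Longrightarrow> (if i = e then 1 else 0) - w * poly.coeff B (e - i) =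
      (1 - w * poly.coeff B 0) * poly.coeff (\<Prod>j<e. [:- q j, 1:]) i"
    and q1: "\<And>j. j < e \<Longrightarrow> norm (q j) < 1"
    and res: "char_res w = (1 - w * poly.coeff B 0) ^ e * (\<Prod>j<e. 1 - w * poly A (q j))"
    by (rule roots_exist) blast
  let ?LA = "- Ln (1 - w * poly.coeff A 0)" and ?LB = "- Ln (1 - w * poly.coeff B 0)"
  let ?L = "\<lambda>j. - Ln (1 - w * poly A (q j))"
  have small: "norm (w * poly A (q j)) < 1" if "j < e" for j
  proof -
    have "norm (poly A (q j)) \<le> K"
      using q1[OF that] by (intro norm_poly_le sum_norm_le_K) auto
    then have "norm w * norm (poly A (q j)) \<le> norm w * K" by (rule mult_left_mono) auto
    with w show ?thesis by (simp add: norm_mult)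
  qed
  \<comment> \<open>Logarithms only enter through their exponentials, so adding principal values
    over the roots raises no question of branches.\<close>
  have exp_L: "exp (- (- Ln (1 - x))) = 1 - x" if "norm x < 1" for x
    using that by (subst minus_minus, intro exp_Ln) auto
  have "char_res w = exp (- (of_nat e * ?LB + (\<Sum>j<e. ?L j)))"
  proof -
    have "exp (- (of_nat e * ?LB + (\<Sum>j<e. ?L j))) = exp (- ?LB) ^ e * (\<Prod>j<e. exp (- ?L j))"
      by (simp add: exp_add exp_diff exp_minus exp_sum exp_of_nat_mult[symmetric] sum_negf divide_inverse
          del: exp_Ln)
    also have "(\<Prod>j<e. exp (- ?L j)) = (\<Prod>j<e. 1 - w * poly A (q j))"
      using small by (intro prod.cong exp_L) auto
    also have "exp (- ?LB) = 1 - w * poly.coeff B 0"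
      by (rule exp_L) (rule norm_w_coeff_0)
    finally show ?thesis by (simp add: res)
  qed
  moreover
  define t where "t h = (\<Sum>j<e. (w * poly A (q j)) ^ h / of_nat h)" for h
  \<comment> \<open>The term s = 0 of A^h carries the zeroth power sum e, which
    \<open>power_sum_series\<close> does not cover. It is split off here and summed separately as a
    logarithm in \<alpha>_0.\<close>
  define \<phi> where "\<phi> h = t h - of_nat e * ((w * poly.coeff A 0) ^ h / of_nat h)" for h
  have t_sums: "t sums (\<Sum>j<e. ?L j)"
    unfolding t_def using small by (intro sums_sum log_series) auto
  have A_sums: "(\<lambda>h. of_nat e * ((w * poly.coeff A 0) ^ h / of_nat h)) sums (of_nat e * ?LA)"
    by (intro sums_mult log_series norm_w_coeff_0)
  have B_sums: "(\<lambda>h. of_nat e * ((w * poly.coeff B 0) ^ h / of_nat h)) sums (of_nat e * ?LB)"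
    by (intro sums_mult log_series norm_w_coeff_0)
  have \<phi>_sums: "\<phi> sums ((\<Sum>j<e. ?L j) - of_nat e * ?LA)"
    unfolding \<phi>_def by (intro sums_diff t_sums A_sums)
  have F_sums: "(\<lambda>k. F h k) sums \<phi> h" for h
  proof -
    have "degree (A ^ h) \<le> e * h"
      using order_trans[OF degree_power_le mult_le_mono1[OF deg_A]] .
    then have poly_Ah: "poly (A ^ h) u = (\<Sum>s\<le>e * h. poly.coeff (A ^ h) s * u ^ s)" for u
      unfolding poly_altdef by (intro sum.mono_neutral_left) (auto simp: coeff_eq_0)
    have "t h = w ^ h / of_nat h * (\<Sum>j<e. poly (A ^ h) (q j))"
      by (simp add: t_def sum_distrib_left power_mult_distrib poly_power)
    also have "(\<Sum>j<e. poly (A ^ h) (q j)) = (\<Sum>s\<le>e * h. poly.coeff (A ^ h) s * (\<Sum>j<e. q j ^ s))"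
      unfolding poly_Ah by (subst sum.swap) (simp add: sum_distrib_left)
    also have "{..e * h} = insert 0 {1..e * h}" by auto
    finally have t_eq: "t h = w ^ h / of_nat h * (of_nat e * poly.coeff A 0 ^ h) +
        w ^ h / of_nat h * (\<Sum>s = 1..e * h. poly.coeff (A ^ h) s * (\<Sum>j<e. q j ^ s))"
      by (simp add: distrib_left coeff_0_power mult_ac)
    have "(\<lambda>k. w ^ h / of_nat h * (\<Sum>s = 1..e * h. poly.coeff (A ^ h) s *
        (of_nat s / of_nat k * (w ^ k * poly.coeff (B ^ k) s)))) sums
        (w ^ h / of_nat h * (\<Sum>s = 1..e * h. poly.coeff (A ^ h) s * (\<Sum>j<e. q j ^ s)))"
      using q by (intro sums_mult sums_sum power_sum_series) auto
    also have "(\<lambda>k. w ^ h / of_nat h * (\<Sum>s = 1..e * h. poly.coeff (A ^ h) s *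
        (of_nat s / of_nat k * (w ^ k * poly.coeff (B ^ k) s)))) = (\<lambda>k. F h k)"
      by (rule ext) (simp add: F_def sum_distrib_left power_add mult_ac)
    also have "w ^ h / of_nat h * (\<Sum>s = 1..e * h. poly.coeff (A ^ h) s * (\<Sum>j<e. q j ^ s)) = \<phi> h"
      unfolding \<phi>_def t_eq by (simp add: power_mult_distrib)
    finally show ?thesis .
  qed
  \<comment> \<open>The pure series in \<beta>_0 and \<alpha>_0 and the mixed series regrouped by
    powers of w; the logarithm in \<alpha>_0 subtracted in \<open>\<phi>\<close> is added
    back.\<close>
  have "(\<lambda>d. of_nat e * ((w * poly.coeff B 0) ^ d / of_nat d) +
      (of_nat e * ((w * poly.coeff A 0) ^ d / of_nat d) + (\<Sum>h\<le>d. F h (d - h)))) sums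
      (of_nat e * ?LB + (of_nat e * ?LA + ((\<Sum>j<e. ?L j) - of_nat e * ?LA)))"
    by (intro sums_add A_sums B_sums F_rearranged[OF F_sums \<phi>_sums])
  moreover have "of_nat e * ((w * poly.coeff B 0) ^ d / of_nat d) +
      (of_nat e * ((w * poly.coeff A 0) ^ d / of_nat d) + (\<Sum>h\<le>d. F h (d - h))) = tau d * w ^ d" for d
  proof -
    have "(\<Sum>h\<le>d. F h (d - h)) = (\<Sum>h = 1..<d. F h (d - h))"
    proof (rule sum.mono_neutral_right)
      show "\<forall>h\<in>{..d} - {1..<d}. F h (d - h) = 0"
        by (auto simp: F_def)
    qed auto
    also have "\<dots> = (\<Sum>h = 1..<d. w ^ d * (\<Sum>s = 1..min h (d - h) * e. of_nat s / of_nat (h * (d - h)) *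
      (poly.coeff (A ^ h) s * poly.coeff (B ^ (d - h)) s)))"
    proof (rule sum.cong)
      fix h assume h: "h \<in> {1..<d}"
      have deg: "degree (B ^ (d - h)) \<le> e * (d - h)"
        using order_trans[OF degree_power_le mult_le_mono1[OF deg_B]] .
      have "(\<Sum>s = 1..e * h. of_nat s / of_nat (h * (d - h)) * (poly.coeff (A ^ h) s * poly.coeff (B ^ (d - h)) s)) =
        (\<Sum>s = 1..min h (d - h) * e. of_nat s / of_nat (h * (d - h)) * (poly.coeff (A ^ h) s * poly.coeff (B ^ (d - h)) s))"
      proof (rule sum.mono_neutral_right)
        show "{1..min h (d - h) * e} \<subseteq> {1..e * h}"
          by (auto simp: min_def mult.commute split: if_splits intro: order_trans)
        show "\<forall>s\<in>{1..e * h} - {1..min h (d - h) * e}.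
          of_nat s / of_nat (h * (d - h)) * (poly.coeff (A ^ h) s * poly.coeff (B ^ (d - h)) s) = 0"
        proof
          fix s assume "s \<in> {1..e * h} - {1..min h (d - h) * e}"
          then have "degree (B ^ (d - h)) < s"
            using deg by (auto simp: min_def mult.commute not_le split: if_splits)
          then show "of_nat s / of_nat (h * (d - h)) * (poly.coeff (A ^ h) s * poly.coeff (B ^ (d - h)) s) = 0"
            by (simp add: coeff_eq_0)
        qed
      qed auto
      with h show "F h (d - h) = w ^ d * (\<Sum>s = 1..min h (d - h) * e. of_nat s / of_nat (h * (d - h)) *
        (poly.coeff (A ^ h) s * poly.coeff (B ^ (d - h)) s))"
        by (simp add: F_def)
    qed simp
    finally show ?thesis
      by (simp add: tau_def power_mult_distrib sum_distrib_left[symmetric] algebra_simps add_divide_distrib)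
  qed
  ultimately have "(\<lambda>d. tau d * w ^ d) sums (of_nat e * ?LB + (\<Sum>j<e. ?L j))"
    "char_res w = exp (- (of_nat e * ?LB + (\<Sum>j<e. ?L j)))"
    by simp_all
  then show ?thesis by blast
qed

end

text \<open>Each entry of the e by e matrix is a sum of products of two polynomials of degree at
  most 1 in w.\<close>

lemma char_res_poly:
  obtains r where "degree r \<le> 2 * e" "\<And>w. poly r w = char_res w"
proof -
  let ?f = "\<lambda>i. [:if i = 0 then 1 else 0, - poly.coeff A i:]"
  let ?g = "\<lambda>i. if i \<le> e then [:if i = e then 1 else 0, - poly.coeff B (e - i):] else 0"
  let ?r = "bezout_res e ?f ?g"
  have deg: "degree (?f i) \<le> 1" "degree (?g i) \<le> 1" for i
    by auto
  have "degree (bezout_mat e ?f ?g $$ (i, j)) \<le> 2" if "i < e" "j < e" for i j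
  proof -
    have diff: "degree (a * b - c * d) \<le> 2" if "degree a \<le> 1" "degree b \<le> 1" "degree c \<le> 1" "degree d \<le> 1"
      for a b c d :: "complex poly"
      using degree_diff_le[of "a * b" 2 "c * d"] degree_mult_le[of a b] degree_mult_le[of c d] that by linarith
    show ?thesis
      unfolding bezout_mat_index[OF that] by (intro degree_sum_le finite_lessThan diff deg)
  qed
  then have "degree ?r \<le> 2 * e"
    unfolding bezout_res_def by (rule degree_det_le) auto
  moreover have "poly ?r w = char_res w" for w
  proof -
    interpret hom: comm_ring_hom "\<lambda>p :: complex poly. poly p w"
      by unfold_locales auto
    have "(\<lambda>i. poly (?f i) w) = (\<lambda>i. (if i = 0 then 1 else 0) - w * poly.coeff A i)"
      by (rule ext) simp
    moreover have "(\<lambda>i. poly (?g i) w) =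
        (\<lambda>i. if i \<le> e then (if i = e then 1 else 0) - w * poly.coeff B (e - i) else 0)"
      by (rule ext) simp
    ultimately show ?thesis
      by (simp only: hom.bezout_res_hom char_res_def)
  qed
  ultimately show ?thesis by (rule that)
qed

text \<open>Near 0 the polynomial equals the exponential of an analytic function. Uniqueness of
  power series turns this into a formal identity, in which convergence no longer matters.\<close>

theorem char_res_coeffs:
  obtains r where "degree r \<le> 2 * e" "\<And>w. poly r w = char_res w"
    "fps_of_poly r = fps_compose (fps_exp 1) (- Abs_fps tau)"
proof -
  obtain r where r: "degree r \<le> 2 * e" "\<And>w. poly r w = char_res w"
    by (rule char_res_poly) blast
  define X where "X w = suminf (\<lambda>d. tau d * w ^ d)" for w
  have X: "(\<lambda>d. tau d * w ^ d) sums X w" "char_res w = exp (- X w)" if "norm w * K < 1" for w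
    using char_res_expansion[OF that] by (auto simp: X_def sums_iff)
  have ev: "eventually (\<lambda>w :: complex. norm w * K < 1) (nhds 0)"
  proof -
    have "open {w :: complex. norm w * K < 1}"
      by (intro open_Collect_less continuous_intros)
    from eventually_nhds_in_open[OF this, of 0] show ?thesis by simp
  qed
  have "X has_fps_expansion Abs_fps tau"
    by (rule has_fps_expansionI) (use ev in \<open>rule eventually_mono\<close>, use X in simp)
  then have "(\<lambda>w. - X w) has_fps_expansion - Abs_fps tau"
    by (rule has_fps_expansion_minus)
  then have "(exp \<circ> (\<lambda>w. - X w)) has_fps_expansion fps_compose (fps_exp 1) (- Abs_fps tau)"
    by (intro has_fps_expansion_compose has_fps_expansion_exp1) (simp_all add: tau_def)
  moreover have "eventually (\<lambda>w. (exp \<circ> (\<lambda>w. - X w)) w = poly r w) (nhds 0)"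
    by (rule eventually_mono[OF ev]) (use X r in simp)
  ultimately have "poly r has_fps_expansion fps_compose (fps_exp 1) (- Abs_fps tau)"
    unfolding has_fps_expansion_def by (auto elim: eventually_elim2)
  moreover have "poly r has_fps_expansion fps_of_poly r"
    by (simp add: has_fps_expansion_def)
  ultimately have "fps_of_poly r = fps_compose (fps_exp 1) (- Abs_fps tau)"
    by (intro fps_expansion_unique_complex)
  with r show ?thesis by (rule that)
qed

end


section \<open>The characteristic polynomial\<close>

text \<open>The coefficient is a sum over all lists of naturals with sum k; lists with an entry 0
  drop out because there is no constant term. This is where the positivity of the d_j comes
  from.\<close>

lemma fps_power_nth_compositions:
  fixes a :: "'a::comm_ring_1 fps"
  assumes "fps_nth a 0 = 0"
  shows "fps_nth (a ^ i) k = (\<Sum>ds | length ds = i \<and> (\<forall>d\<in>set ds. d > 0) \<and> sum_list ds = k.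
    \<Prod>j<i. fps_nth a (ds ! j))"
proof (cases i)
  case 0
  then have "{ds :: nat list. length ds = i \<and> (\<forall>d\<in>set ds. d > 0) \<and> sum_list ds = k} =
      (if k = 0 then {[]} else {})"
    by auto
  with 0 show ?thesis by simp
next
  case (Suc n)
  have "fps_nth (a ^ i) k = (\<Sum>v\<in>natpermute k i. \<Prod>j<i. fps_nth a (v ! j))"
    unfolding Suc fps_power_nth_Suc by (simp only: Suc_eq_plus1[symmetric] atLeast0AtMost lessThan_Suc_atMost)
  also have "\<dots> = (\<Sum>ds | length ds = i \<and> (\<forall>d\<in>set ds. d > 0) \<and> sum_list ds = k. \<Prod>j<i. fps_nth a (ds ! j))"
  proof (rule sum.mono_neutral_right)
    show "\<forall>v\<in>natpermute k i - {ds. length ds = i \<and> (\<forall>d\<in>set ds. d > 0) \<and> sum_list ds = k}.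
        (\<Prod>j<i. fps_nth a (v ! j)) = 0"
    proof
      fix v assume "v \<in> natpermute k i - {ds. length ds = i \<and> (\<forall>d\<in>set ds. d > 0) \<and> sum_list ds = k}"
      then have "length v = i" "0 \<in> set v" by (auto simp: natpermute_def)
      then obtain j where "j < i" "v ! j = 0" by (auto simp: in_set_conv_nth)
      with assms show "(\<Prod>j<i. fps_nth a (v ! j)) = 0"
        by (intro prod_zero) (auto intro!: bexI[of _ j])
    qed
  next
    show "finite (natpermute k i)" by (rule natpermute_finite)
  qed (auto simp: natpermute_def)
  finally show ?thesis .
qed

context char_poly_expansion
begin

text \<open>For z nonzero, extracting z from both forms scales the determinant by z^(2e) and leaves
  \<open>char_res\<close> at 1/z. The bound 2e on the degree keeps all powers of z
  nonnegative.\<close>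

theorem bezout_res_char_poly:
  "bezout_res e (\<lambda>i. z * (if i = 0 then 1 else 0) - poly.coeff A i)
     (\<lambda>i. if i \<le> e then z * (if i = e then 1 else 0) - poly.coeff B (e - i) else 0) =
   z ^ (2 * e) + (\<Sum>k = 1..2 * e. z ^ (2 * e - k) * (\<Sum>i = 1..k. 1 / fact i *
     (\<Sum>ds | length ds = i \<and> (\<forall>d\<in>set ds. d > 0) \<and> sum_list ds = k. \<Prod>j<i. - tau (ds ! j))))"
    (is "?D z = _")
proof -
  obtain r where deg: "degree r \<le> 2 * e" and r: "\<And>w. poly r w = char_res w"
    and fps_r: "fps_of_poly r = fps_compose (fps_exp 1) (- Abs_fps tau)"
    by (rule char_res_coeffs) blast
  have tau_0: "tau 0 = 0" by (simp add: tau_def)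
  let ?c = "\<lambda>k i. 1 / fact i * (\<Sum>ds | length ds = i \<and> (\<forall>d\<in>set ds. d > 0) \<and> sum_list ds = k.
    \<Prod>j<i. - tau (ds ! j))"
  have coeff_r: "poly.coeff r k = (\<Sum>i = 0..k. ?c k i)" for k
  proof -
    have "poly.coeff r k = fps_nth (fps_compose (fps_exp 1) (- Abs_fps tau)) k"
      unfolding fps_r[symmetric] by simp
    also have "\<dots> = (\<Sum>i = 0..k. ?c k i)"
      unfolding fps_compose_nth
      by (intro sum.cong refl, subst fps_power_nth_compositions) (simp_all add: tau_0)
    finally show ?thesis .
  qed
  have c_0: "?c k 0 = (if k = 0 then 1 else 0)" for k
  proof -
    have "{ds :: nat list. length ds = 0 \<and> (\<forall>d\<in>set ds. d > 0) \<and> sum_list ds = k} =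
        (if k = 0 then {[]} else {})"
      by auto
    then show ?thesis by simp
  qed
  have "poly.coeff r 0 = 1" using coeff_r[of 0] c_0[of 0] by simp
  have coeff_r_pos: "poly.coeff r k = (\<Sum>i = 1..k. ?c k i)" if "k \<ge> 1" for k
    unfolding coeff_r using that c_0[of k] by (subst sum.atLeast_Suc_atMost) simp_all
  have D_eq: "?D z = (\<Sum>k\<le>2 * e. poly.coeff r k * z ^ (2 * e - k))" if "z \<noteq> 0" for z
  proof -
    have "(\<lambda>i. z * (if i = 0 then 1 else 0) - poly.coeff A i) =
        (\<lambda>i. z * ((if i = 0 then 1 else 0) - 1 / z * poly.coeff A i))"
      "(\<lambda>i. if i \<le> e then z * (if i = e then 1 else 0) - poly.coeff B (e - i) else 0) =
        (\<lambda>i. z * (if i \<le> e then (if i = e then 1 else 0) - 1 / z * poly.coeff B (e - i) else 0))"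
      using that by (auto simp: fun_eq_iff field_simps)
    then have "?D z = (z * z) ^ e * char_res (1 / z)"
      by (simp only: bezout_res_scale char_res_def)
    also have "\<dots> = z ^ (2 * e) * poly r (1 / z)"
      by (simp add: r power_mult power2_eq_square)
    also have "poly r (1 / z) = (\<Sum>k\<le>2 * e. poly.coeff r k * (1 / z) ^ k)"
      unfolding poly_altdef by (rule sum.mono_neutral_left) (use deg in \<open>auto simp: coeff_eq_0\<close>)
    also have "z ^ (2 * e) * \<dots> = (\<Sum>k\<le>2 * e. poly.coeff r k * z ^ (2 * e - k))"
      unfolding sum_distrib_left
      by (rule sum.cong) (use that in \<open>auto simp: power_diff power_divide\<close>)
    finally show ?thesis .
  qed
  \<comment> \<open>The case z = 0, where 1/z is of no use, follows by density; functions of one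
    variable are indexed by the unit type.\<close>
  have "?D z = (\<Sum>k\<le>2 * e. poly.coeff r k * z ^ (2 * e - k))"
  proof (rule polyfun_density[where p = "\<lambda>x. ?D (x ())" and r = "\<lambda>x. x ()" and x = "\<lambda>_. z"
        and y = "\<lambda>_. 1" and q = "\<lambda>x. \<Sum>k\<le>2 * e. poly.coeff r k * x () ^ (2 * e - k)"])
    show "?D (x ()) = (\<Sum>k\<le>2 * e. poly.coeff r k * x () ^ (2 * e - k))" if "x () \<noteq> 0"
      for x :: "unit \<Rightarrow> complex"
      by (rule D_eq) (rule that)
  qed (simp | intro pf_intros)+
  also have "{..2 * e} = insert 0 {1..2 * e}" by auto
  also have "(\<Sum>k\<in>insert 0 {1..2 * e}. poly.coeff r k * z ^ (2 * e - k)) =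
      z ^ (2 * e) + (\<Sum>k = 1..2 * e. z ^ (2 * e - k) * (\<Sum>i = 1..k. ?c k i))"
    by (simp add: \<open>poly.coeff r 0 = 1\<close> coeff_r_pos mult.commute)
  finally show ?thesis .
qed

end

section \<open>From the tensor to its two binary forms\<close>

lemma prod_list_mvar:
  assumes "set is \<subseteq> {1..2::nat}"
  shows "prod_list (map mvar is) = (Poly_Mapping.single
    (Poly_Mapping.single 1 (count_list is 1) + Poly_Mapping.single 2 (count_list is 2)) 1 :: (nat, complex) mpoly)"
  using assms
proof (induction "is")
  case (Cons i "is")
  then have "i = 1 \<or> i = 2" by auto
  moreover have "Poly_Mapping.single v (Suc (count_list is u)) =
      Poly_Mapping.single v (Suc 0) + Poly_Mapping.single v (count_list is u)" for u v :: nat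
    by (simp flip: single_add)
  ultimately show ?case
    using Cons by (auto simp: mvar_def mult_single add_ac)
qed auto

lemma lookup_tensor_form:
  "Poly_Mapping.lookup (tensor_form 2 m T i) (binary_monom (m - 1) c) =
    (\<Sum>is | is \<in> multi_indices 2 (m - 1) \<and> count_list is 2 = c. T (i # is))"
proof -
  have "prod_list (map mvar is) = (Poly_Mapping.single (binary_monom (m - 1) (count_list is 2)) 1 :: (nat, complex) mpoly)"
    if "is \<in> multi_indices 2 (m - 1)" for "is"
  proof -
    have "set is \<subseteq> {1..2}" "count_list is 1 = m - 1 - count_list is 2"
      using that count_list_1_2[of "is"] by (auto simp: multi_indices_def)
    then show ?thesis by (simp add: prod_list_mvar binary_monom_def)
  qed
  then have "tensor_form 2 m T i = (\<Sum>is\<in>multi_indices 2 (m - 1).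
      Poly_Mapping.single (binary_monom (m - 1) (count_list is 2)) (T (i # is)))"
    unfolding tensor_form_def by (intro sum.cong) (auto simp: mconst_def mult_single)
  then have "Poly_Mapping.lookup (tensor_form 2 m T i) (binary_monom (m - 1) c) =
      (\<Sum>is\<in>multi_indices 2 (m - 1). if count_list is 2 = c then T (i # is) else 0)"
    using inj_binary_monom[of "m - 1"] by (simp add: lookup_sum lookup_single when_def inj_eq)
  also have "\<dots> = (\<Sum>is | is \<in> multi_indices 2 (m - 1) \<and> count_list is 2 = c. T (i # is))"
    by (subst sum.inter_filter[symmetric]) simp_all
  finally show ?thesis .
qed

lemma lookup_tensor_form_1:
  "Poly_Mapping.lookup (tensor_form 2 m T 1) (binary_monom (m - 1) c) = alpha m T c"
  by (simp only: lookup_tensor_form alpha_def)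

text \<open>\<open>beta\<close> counts indices equal to 1, whereas monomials are numbered by the
  exponent of x_2; this is the source of the reversal.\<close>

lemma lookup_tensor_form_2:
  assumes "c \<le> m - 1"
  shows "Poly_Mapping.lookup (tensor_form 2 m T 2) (binary_monom (m - 1) c) = beta m T (m - 1 - c)"
proof -
  have "{is. is \<in> multi_indices 2 (m - 1) \<and> count_list is 2 = c} =
      {is. is \<in> multi_indices 2 (m - 1) \<and> count_list is 1 = m - 1 - c}"
  proof (rule Collect_cong, rule conj_cong)
    fix "is" assume "is \<in> multi_indices 2 (m - 1)"
    then have "count_list is 1 + count_list is 2 = m - 1"
      using count_list_1_2[of "is"] by (simp add: multi_indices_def)
    with assms show "count_list is 2 = c \<longleftrightarrow> count_list is 1 = m - 1 - c" by linarith
  qed simp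
  then show ?thesis by (simp only: lookup_tensor_form beta_def)
qed

lemma alpha_identity_tensor:
  assumes "m \<ge> 1"
  shows "alpha m identity_tensor a = (if a = 0 then 1 else 0)"
proof (cases "a = 0")
  case True
  then show ?thesis using assms by (simp add: alpha_0 identity_tensor_def)
next
  case False
  have "identity_tensor (1 # is) = 0" if "count_list is 2 = a" for "is"
  proof -
    have two: "2 \<in> set is" using that False by (metis count_list_0_iff)
    have "\<not> (\<forall>i\<in>set (1 # is). \<forall>j\<in>set (1 # is). i = j)"
    proof
      assume *: "\<forall>i\<in>set (1 # is). \<forall>j\<in>set (1 # is). i = j"
      have "1 = (2 :: nat)" by (rule *[rule_format]) (use two in simp_all)
      then show False by simp
    qed
    then show ?thesis by (simp only: identity_tensor_def if_False)
  qed
  then show ?thesis using False by (simp add: alpha_def)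
qed

lemma beta_identity_tensor:
  assumes "m \<ge> 1"
  shows "beta m identity_tensor b = (if b = 0 then 1 else 0)"
proof (cases "b = 0")
  case True
  then show ?thesis using assms by (simp add: beta_0 identity_tensor_def)
next
  case False
  have "identity_tensor (2 # is) = 0" if "count_list is 1 = b" for "is"
  proof -
    have one: "1 \<in> set is" using that False by (metis count_list_0_iff)
    have "\<not> (\<forall>i\<in>set (2 # is). \<forall>j\<in>set (2 # is). i = j)"
    proof
      assume *: "\<forall>i\<in>set (2 # is). \<forall>j\<in>set (2 # is). i = j"
      have "1 = (2 :: nat)" by (rule *[rule_format]) (use one in simp_all)
      then show False by simp
    qed
    then show ?thesis by (simp only: identity_tensor_def if_False)
  qed
  then show ?thesis using False by (simp add: beta_def)
qed

lemma alpha_linear: "alpha m (\<lambda>is. z * S is - T is) a = z * alpha m S a - alpha m T a"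
  by (simp add: alpha_def sum_subtractf sum_distrib_left)

lemma beta_linear: "beta m (\<lambda>is. z * S is - T is) b = z * beta m S b - beta m T b"
  by (simp add: beta_def sum_subtractf sum_distrib_left)

lemma tensor_char_poly_2:
  assumes "m \<ge> 2"
  shows "tensor_char_poly 2 m T z = bezout_res (m - 1)
    (\<lambda>i. z * (if i = 0 then 1 else 0) - poly.coeff (alpha_poly m T) i)
    (\<lambda>i. if i \<le> m - 1 then z * (if i = m - 1 then 1 else 0) - poly.coeff (beta_poly m T) (m - 1 - i) else 0)"
proof -
  have m: "m - 1 > 0" "m \<ge> 1" using assms by auto
  show ?thesis
    unfolding tensor_char_poly_def Edet_def Res_2[OF m(1)]
  proof (rule arg_cong2[of _ _ _ _ "bezout_res (m - 1)"]; rule ext)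
    fix i
    show "(if i \<le> m - 1 then Poly_Mapping.lookup (tensor_form 2 m (\<lambda>is. z * identity_tensor is - T is) 1)
          (binary_monom (m - 1) i) else 0) =
        z * (if i = 0 then 1 else 0) - poly.coeff (alpha_poly m T) i"
      unfolding lookup_tensor_form_1 alpha_linear alpha_identity_tensor[OF m(2)] coeff_alpha_poly
      by (auto simp: alpha_eq_0)
    show "(if i \<le> m - 1 then Poly_Mapping.lookup (tensor_form 2 m (\<lambda>is. z * identity_tensor is - T is) 2)
          (binary_monom (m - 1) i) else 0) =
        (if i \<le> m - 1 then z * (if i = m - 1 then 1 else 0) - poly.coeff (beta_poly m T) (m - 1 - i) else 0)"
    proof (cases "i \<le> m - 1")
      case True
      then have "m - 1 - i = 0 \<longleftrightarrow> i = m - 1" by auto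
      with True show ?thesis
        by (simp only: if_True lookup_tensor_form_2 beta_linear beta_identity_tensor[OF m(2)] coeff_beta_poly)
    qed simp
  qed
qed

theorem theorem9p1:
  fixes m :: nat and T :: tensor
  assumes "m \<ge> 2"
  shows "(\<forall>z. tensor_char_poly 2 m T z =
            z ^ (2 * (m - 1)) +
            (\<Sum>k = 1..2 * (m - 1). z ^ (2 * (m - 1) - k) *
              (\<Sum>i = 1..k. 1 / fact i *
                (\<Sum>ds | length ds = i \<and> (\<forall>d\<in>set ds. d > 0) \<and> sum_list ds = k.
                  \<Prod>j<i. - Tr 2 m T (ds ! j) / of_nat (ds ! j)))))
       \<and> (\<forall>d\<in>{1..2 * (m - 1)}. Tr 2 m T d =
            of_nat (m - 1) *
            (T (replicate m 1) ^ d + T (replicate m 2) ^ d +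
             (\<Sum>(h, k) | h + k = d \<and> h \<ge> 1 \<and> k \<ge> 1.
               \<Sum>s = 1..min h k * (m - 1).
                 of_nat (s * (h + k)) / of_nat (h * k * (m - 1)) *
                 (\<Sum>(as, bs)\<in>bounded_tuples m h s \<times> bounded_tuples m k s.
                   (\<Prod>p<h. alpha m T (as ! p)) * (\<Prod>q<k. beta m T (bs ! q))))))"
proof (intro conjI allI ballI)
  define A B where "A = alpha_poly m T" and "B = beta_poly m T"
  interpret char_poly_expansion "m - 1" A B
    using assms degree_alpha_poly[of m T] degree_beta_poly[of m T]
    by unfold_locales (simp_all add: A_def B_def)
  \<comment> \<open>Multiplying the trace formula by 1/d cancels d and the factor m - 1 in every
    mixed term, which leaves s/(hk).\<close>
  have tau: "tau d = Tr 2 m T d / of_nat d" if "d > 0" for d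
  proof -
    have cancel: "of_nat n / of_nat d * (of_nat (s * d) / of_nat (c * n) * x) = of_nat s / of_nat c * x"
      if "n > 0" for c n s :: nat and x :: complex
      using that \<open>d > 0\<close> by (cases "c = 0") (auto simp: field_simps)
    have "Tr 2 m T d / of_nat d = of_nat (m - 1) / of_nat d * (poly.coeff A 0 ^ d + poly.coeff B 0 ^ d) +
        (\<Sum>h = 1..<d. \<Sum>s = 1..min h (d - h) * (m - 1). of_nat (m - 1) / of_nat d *
          (of_nat (s * d) / of_nat (h * (d - h) * (m - 1)) *
          (poly.coeff (A ^ h) s * poly.coeff (B ^ (d - h)) s)))"
      using that assms by (simp add: Tr_2 A_def B_def coeff_alpha_poly coeff_beta_poly
          distrib_left add_divide_distrib sum_distrib_left sum_divide_distrib)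
    also have "\<dots> = tau d"
      unfolding tau_def
      by (intro arg_cong2[of _ _ _ _ "(+)"] sum.cong refl cancel) (use that assms in auto)
    finally show ?thesis by simp
  qed
  fix z
  show "tensor_char_poly 2 m T z = z ^ (2 * (m - 1)) +
    (\<Sum>k = 1..2 * (m - 1). z ^ (2 * (m - 1) - k) * (\<Sum>i = 1..k. 1 / fact i *
      (\<Sum>ds | length ds = i \<and> (\<forall>d\<in>set ds. d > 0) \<and> sum_list ds = k.
        \<Prod>j<i. - Tr 2 m T (ds ! j) / of_nat (ds ! j))))"
    unfolding tensor_char_poly_2[OF assms] A_def[symmetric] B_def[symmetric] bezout_res_char_poly
    by (intro arg_cong2[of _ _ _ _ "(+)"] arg_cong2[of _ _ _ _ "(*)"] sum.cong prod.cong refl)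
       (auto simp: tau simp del: One_nat_def)
next
  fix d assume "d \<in> {1..2 * (m - 1)}"
  then have d: "d \<ge> 1" by simp
  have m: "m \<ge> 1" using assms by simp
  have "(\<Sum>(h, k) | h + k = d \<and> h \<ge> 1 \<and> k \<ge> 1. \<Sum>s = 1..min h k * (m - 1).
      of_nat (s * (h + k)) / of_nat (h * k * (m - 1)) *
      (\<Sum>(as, bs)\<in>bounded_tuples m h s \<times> bounded_tuples m k s.
        (\<Prod>p<h. alpha m T (as ! p)) * (\<Prod>q<k. beta m T (bs ! q)))) =
    (\<Sum>h = 1..<d. \<Sum>s = 1..min h (d - h) * (m - 1).
      of_nat (s * d) / of_nat (h * (d - h) * (m - 1)) *
      (poly.coeff (alpha_poly m T ^ h) s * poly.coeff (beta_poly m T ^ (d - h)) s))"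
  proof (rule sum.reindex_bij_witness[of _ "\<lambda>h. (h, d - h)" fst], goal_cases)
    case (5 x)
    then obtain h k where x: "x = (h, k)" "d = h + k" by auto
    have "(\<Sum>(as, bs)\<in>bounded_tuples m h s \<times> bounded_tuples m k s.
        (\<Prod>p<h. alpha m T (as ! p)) * (\<Prod>q<k. beta m T (bs ! q))) =
      poly.coeff (alpha_poly m T ^ h) s * poly.coeff (beta_poly m T ^ k) s" for s
      by (simp only: sum_bounded_tuples[OF degree_alpha_poly, symmetric]
          sum_bounded_tuples[OF degree_beta_poly, symmetric] coeff_alpha_poly coeff_beta_poly
          sum_product sum.cartesian_product)
    then show ?case by (simp add: x)
  qed auto
  then show "Tr 2 m T d = of_nat (m - 1) * (T (replicate m 1) ^ d + T (replicate m 2) ^ d +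
    (\<Sum>(h, k) | h + k = d \<and> h \<ge> 1 \<and> k \<ge> 1. \<Sum>s = 1..min h k * (m - 1).
      of_nat (s * (h + k)) / of_nat (h * k * (m - 1)) *
      (\<Sum>(as, bs)\<in>bounded_tuples m h s \<times> bounded_tuples m k s.
        (\<Prod>p<h. alpha m T (as ! p)) * (\<Prod>q<k. beta m T (bs ! q)))))"
    unfolding Tr_2[OF assms d] alpha_0[OF m] beta_0[OF m] by simp
qed

end
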